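(* Let $\tau$ be a (possibly killed) subordinator, not identically zero, with Laplace exponent $\Phi$, and let $G(t)$ be its undershoot at level $t$. Let $\alpha\in(0,1)$ and $\hat{\alpha}=1-\alpha$. Let $\ell:(0,\infty)\to(0,\infty)$ be slowly varying at $\infty$, and suppose $\varepsilon:(0,\infty)\to(0,1)$ satisfies $\varepsilon(t)\to 0$ and $\varepsilon(t)t\to\infty$ as $t\to\infty$. Then the following statements hold. (1) Assume $\Phi(\lambda)\sim \lambda^\alpha \ell(1/\lambda)$ as $\lambda\to0+$. Then $$\mathbb{P}\bigg(\frac{G(t)}{t}\leq \varepsilon(t)\bigg)\sim\frac{\sin(\pi\alpha)}{\pi\alpha}\,\frac{\ell(t)}{\ell(\varepsilon(t)t)}\,\varepsilon(t)^\alpha,\qquad t\to\infty.$$ Suppose additionally that $\tau$ is special. Then $$\mathbb{P}\bigg(\frac{G(t)}{t}\geq 1-\varepsilon(t)\bigg)\sim\frac{\sin(\pi\hat{\alpha})}{\pi\hat{\alpha}}\,\frac{\ell(\varepsilon(t)t)}{\ell(t)}\,\varepsilon(t)^{\hat{\alpha}},\qquad t\to\infty.$$ (2) Assume $\Phi(\lambda)\asymp \lambda^\alpha \ell(1/\lambda)$ as $\lambda\to0+$. Then $$\mathbb{P}\bigg(\frac{G(t)}{t}\leq \varepsilon(t)\bigg)\asymp\frac{\ell(t)}{\ell(\varepsilon(t)t)}\,\varepsilon(t)^\alpha,\qquad t\to\infty.$$ Suppose additionally that $\tau$ is special. Then $$\mathbb{P}\bigg(\frac{G(t)}{t}\geq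 1-\varepsilon(t)\bigg)\asymp\frac{\ell(\varepsilon(t)t)}{\ell(t)}\,\varepsilon(t)^{\hat{\alpha}},\qquad t\to\infty.$$
   Context: Asymptotic notation: $f(x)\sim g(x)$ as $x\to a$ means $f(x)/g(x)\to1$. For non-negative $f,g$, $f(x)\asymp g(x)$ as $x\to a$ means that there are constants $0<C_1\le C_2<\infty$ with $C_1f(x)\le g(x)\le C_2f(x)$ for all $x$ in some neighborhood of $a$. A positive measurable function $\ell$ is slowly varying at $\infty$ if $\ell(\lambda x)/\ell(x)\to1$ as $x\to\infty$ for every $\lambda>0$. Subordinators: a (killed) subordinator $\tau=(\tau(s))_{s\ge0}$, defined on a probability space $(\Omega,\mathcal F,\mathbb P)$, is a non-negative Lévy process killed (sent to the cemetery point $\infty$) at an independent exponential random time (possibly never killed). Its Laplace exponent $\Phi:(0,\infty)\to[0,\infty)$ is defined by $\mathbb{E}\exp(-\lambda\tau(s))=\exp(-\Phi(\lambda)s)$, $\lambda,s>0$ (with $\exp(-\infty)=0$). "Not identically zero" means $\Phi\neq0$. Undershoot: $L(t)=\inf\{s\ge0: \tau(s)\in(t,\infty]\}$ and $G(t)=\tau(L(t)-)$, $t\ge0$; almost surely $G(t)=\sup\{\tau(s): s\ge0,\ \tau(s)\le t\}$. Special: a Bernstein function is an infinitely differentiable $\Phi:(0,\infty)\to[0,\infty)$ with $(-d/d\lambda)^n\Phi(\lambda)\le0$ for all integers $n\ge1$ and all $\lambda>0$. A Bernstein function $\Phi\ne0$ is special if $\lambda/\Phi(\lambda)$ is also a Bernstein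 function. The subordinator $\tau$ is special if its Laplace exponent $\Phi$ is special. *)

theory Defs
  imports "HOL-Probability.Probability" "HOL-Library.Landau_Symbols"
begin

section \<open>Subordinators\<close>

definition levy_process :: "'w measure \<Rightarrow> (real \<Rightarrow> 'w \<Rightarrow> real) \<Rightarrow> bool" where
  "levy_process M X \<longleftrightarrow>
     (\<forall>s\<ge>0. X s \<in> borel_measurable M) \<and>
     (AE w in M. X 0 w = 0) \<and>
     (\<forall>n (t :: nat \<Rightarrow> real). 0 \<le> t 0 \<and> (\<forall>i<n. t i \<le> t (Suc i)) \<longrightarrow>
        prob_space.indep_vars M (\<lambda>_. borel) (\<lambda>i w. X (t (Suc i)) w - X (t i) w) {..<n}) \<and>
     (\<forall>s\<ge>0. \<forall>h\<ge>0. distr M borel (\<lambda>w. X (s + h) w - X s w) = distr M borel (X h)) \<and>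
     (\<forall>w\<in>space M. \<forall>s\<ge>0. ((\<lambda>u. X u w) \<longlongrightarrow> X s w) (at_right s)) \<and>
     (\<forall>w\<in>space M. \<forall>s>0. \<exists>l. ((\<lambda>u. X u w) \<longlongrightarrow> l) (at_left s))"

definition nonneg_levy_process :: "'w measure \<Rightarrow> (real \<Rightarrow> 'w \<Rightarrow> real) \<Rightarrow> bool" where
  "nonneg_levy_process M X \<longleftrightarrow>
     levy_process M X \<and> (\<forall>s\<ge>0. \<forall>w\<in>space M. 0 \<le> X s w)"

text \<open>
  The cemetery point is \<open>\<infinity> :: ereal\<close>.  The first disjunct below is the case without killing;
  in the second one \<open>\<xi>\<close> is the killing time, independent of the whole process \<open>X\<close>,
  which is regarded as a random element of the product space over the time set.
\<close>

definition killed_subordinator :: "'w measure \<Rightarrow> (real \<Rightarrow> 'w \<Rightarrow> ereal) \<Rightarrow> bool" where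
  "killed_subordinator M \<tau> \<longleftrightarrow>
     (\<exists>X. nonneg_levy_process M X \<and>
        ((\<forall>s\<ge>0. \<forall>w\<in>space M. \<tau> s w = ereal (X s w)) \<or>
         (\<exists>q>0. \<exists>\<xi>. distributed M lborel \<xi> (exponential_density q) \<and>
            prob_space.indep_set M
              (sets (vimage_algebra (space M) \<xi> borel))
              (sets (vimage_algebra (space M) (\<lambda>w. \<lambda>s\<in>{0..}. X s w)
                       (PiM {0..} (\<lambda>_. borel)))) \<and>
            (\<forall>s\<ge>0. \<forall>w\<in>space M. \<tau> s w = (if s < \<xi> w then ereal (X s w) else \<infinity>)))))"

definition exp_neg :: "ereal \<Rightarrow> real" where
  "exp_neg x = (if x = \<infinity> then 0 else exp (- real_of_ereal x))"

definition is_laplace_exponent ::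
    "'w measure \<Rightarrow> (real \<Rightarrow> 'w \<Rightarrow> ereal) \<Rightarrow> (real \<Rightarrow> real) \<Rightarrow> bool" where
  "is_laplace_exponent M \<tau> \<Phi> \<longleftrightarrow>
     (\<forall>x>0. 0 \<le> \<Phi> x) \<and>
     (\<forall>x>0. \<forall>s>0. (\<integral>w. exp_neg (ereal x * \<tau> s w) \<partial>M) = exp (- \<Phi> x * s))"


section \<open>First passage and undershoot\<close>

text \<open>The infimum of the empty set is \<open>\<infinity>\<close>.\<close>

definition first_passage :: "(real \<Rightarrow> 'w \<Rightarrow> ereal) \<Rightarrow> real \<Rightarrow> 'w \<Rightarrow> ereal" where
  "first_passage \<tau> t w = Inf {ereal s | s. 0 \<le> s \<and> ereal t < \<tau> s w}"

text \<open>
  Left limit of a path at a time in \<open>[0, \<infinity>]\<close>, with the convention \<open>f(0-) = 0\<close>.  For a subordinator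
  that is not identically zero and a level \<open>t > 0\<close>, the times \<open>0\<close> and \<open>\<infinity>\<close>
  occur as first passage times only on a null set.
\<close>

definition left_limit :: "(real \<Rightarrow> ereal) \<Rightarrow> ereal \<Rightarrow> ereal" where
  "left_limit f r =
     (if r \<le> 0 then 0
      else if r = \<infinity> then Lim at_top f
      else Lim (at_left (real_of_ereal r)) f)"

definition undershoot :: "(real \<Rightarrow> 'w \<Rightarrow> ereal) \<Rightarrow> real \<Rightarrow> 'w \<Rightarrow> ereal" where
  "undershoot \<tau> t w = left_limit (\<lambda>s. \<tau> s w) (first_passage \<tau> t w)"


section \<open>Special subordinators\<close>

text \<open>Functions on \<open>(0, \<infinity>)\<close> are total functions whose values outside \<open>(0, \<infinity>)\<close> are irrelevant.\<close>

definition bernstein_function :: "(real \<Rightarrow> real) \<Rightarrow> bool" where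
  "bernstein_function f \<longleftrightarrow>
     (\<forall>x>0. 0 \<le> f x) \<and>
     (\<forall>n. \<forall>x>0. (deriv ^^ n) f differentiable (at x)) \<and>
     (\<forall>n\<ge>1. \<forall>x>0. (- 1) ^ n * (deriv ^^ n) f x \<le> 0)"

definition special_bernstein_function :: "(real \<Rightarrow> real) \<Rightarrow> bool" where
  "special_bernstein_function f \<longleftrightarrow>
     bernstein_function f \<and> (\<exists>x>0. f x \<noteq> 0) \<and> bernstein_function (\<lambda>x. x / f x)"

definition special_subordinator :: "'w measure \<Rightarrow> (real \<Rightarrow> 'w \<Rightarrow> ereal) \<Rightarrow> bool" where
  "special_subordinator M \<tau> \<longleftrightarrow>
     (\<exists>\<Phi>. is_laplace_exponent M \<tau> \<Phi> \<and> special_bernstein_function \<Phi>)"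


section \<open>Slow variation\<close>

definition slowly_varying :: "(real \<Rightarrow> real) \<Rightarrow> bool" where
  "slowly_varying l \<longleftrightarrow>
     l \<in> borel_measurable (restrict_space borel {0<..}) \<and>
     (\<forall>x>0. 0 < l x) \<and>
     (\<forall>c>0. ((\<lambda>x. l (c * x) / l x) \<longlongrightarrow> 1) at_top)"

end

theory Submission
  imports Defs
begin

text \<open>
  Let \<open>X\<close> be the subordinator and \<open>T\<close> its first passage time over the level \<open>t\<close>.  The proof looks at
  the path at a random time in a short interval before \<open>T\<close>.  For \<open>h > 0\<close> and an interval \<open>B\<close>, the times
  \<open>s\<close> with \<open>X\<^sub>s \<in> B\<close> and \<open>X\<^sub>s \<le> t < X\<^sub>s\<^sub>+\<^sub>h\<close> are, up to two points, the times in \<open>(T - h, T)\<close> at which the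
  path is in \<open>B\<close>.  So the total length of these times, divided by \<open>h\<close>, is at most \<open>1\<close>, and as \<open>h\<close> tends
  to \<open>0\<close> it tends to the indicator of the event that the path is in \<open>B\<close> just before \<open>T\<close>
  (\<open>crossing_time_limit\<close>).  By independence and stationarity of the increments, the mean length is
  the expectation of \<open>U (B \<inter> (t - X\<^sub>h, t])\<close>, where \<open>U\<close> is the renewal measure, that is, the mean
  occupation measure of \<open>X\<close> (\<open>crossing_time_eq\<close>).

  Two choices of \<open>B\<close> give the two estimates.  Let \<open>0 < y < t\<close> and let \<open>G\<close> be the undershoot.

  \<^item> For \<open>B = [0, y]\<close> the mean length lies between \<open>U(y) P(X\<^sub>h > t)\<close> and \<open>U(y) P(X\<^sub>h > t - y)\<close>.  So
    \<open>P(G \<le> y)\<close> is comparable to \<open>U(y)\<close> times the tail rate \<open>P(X\<^sub>h > t) / h\<close>.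

  \<^item> For \<open>B = (t - y, t]\<close> it is the mean of \<open>U (t - min y X\<^sub>h, t]\<close>.  So \<open>P(G \<ge> t - y)\<close> is comparable to
    the slope of \<open>U\<close> at \<open>t\<close> times the truncated mean rate \<open>E (min y X\<^sub>h) / h\<close>.

  What remains is Tauberian.  The Laplace transform of \<open>U\<close> is \<open>1 / \<Phi>\<close>.  The truncated mean rate is
  the distribution function of a measure with Laplace transform \<open>(1 - exp (- h \<Phi>(\<lambda>))) / (h \<lambda>)\<close>,
  which is equivalent to \<open>\<Phi>(\<lambda>) / \<lambda>\<close> as \<open>\<lambda>\<close> tends to \<open>0\<close>, uniformly in \<open>0 < h \<le> 1\<close>, because \<open>\<Phi>(\<lambda>)\<close>
  tends to \<open>0\<close>.  Karamata's theorem, stated along an arbitrary filter so that it is uniform in \<open>h\<close>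
  (\<open>karamata_tauberian\<close>), gives the asymptotics of both functions.  The tail rate is monotone and is
  the derivative of the truncated mean rate, so its asymptotics follow by comparing it with difference
  quotients.  The slope of \<open>U\<close> is treated in the same way as soon as the average of \<open>U\<close> over an
  interval decreases when the interval moves to the right.  The constants are products
  \<open>1 / (\<Gamma>(1 + a) \<Gamma>(1 - a))\<close>, and Euler's reflection formula turns them into sines.  Under the weaker
  two-sided hypothesis, Tauberian limits are replaced by elementary bounds: \<open>U(y) \<Phi>(1/y)\<close> is bounded
  above and below for every subordinator, \<open>E (min y X\<^sub>h) / h\<close> is comparable to \<open>y \<Phi>(1/y)\<close>, and
  \<open>0 < \<alpha> < 1\<close> makes the difference quotients between \<open>x\<close> and \<open>K x\<close> of the right order if \<open>K\<close> is large.

  The decrease of the averages is where a special exponent enters.  The function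
  \<open>f(\<lambda>) = \<lambda> / \<Phi>(\<lambda>)\<close> is \<open>\<lambda>\<close> times the Laplace transform of \<open>U\<close>.  If \<open>f\<close> is a Bernstein function,
  then its iterated differences have constant sign.  Written in the variable \<open>s = exp (- \<theta> v)\<close>, this
  says that the integrals of the Bernstein basis polynomials against \<open>s U(ds)\<close> increase with the index
  (\<open>bernstein_mass_mono\<close>).  Weierstrass approximation by Bernstein polynomials turns this into the
  statement that \<open>s U(ds)\<close> has increasing averages on \<open>(0, 1)\<close>, and \<open>\<theta> \<longrightarrow> 0\<close> gives decreasing averages of
  \<open>U\<close> (\<open>interval_average_antimono\<close>).

  Killing at rate \<open>q > 0\<close> forces \<open>\<Phi> \<ge> q\<close>, whereas both hypotheses on \<open>\<Phi>\<close> force \<open>\<Phi>\<close> to vanish at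
  \<open>0\<close>.  Hence the killed case does not occur.
\<close>

section \<open>A uniform Karamata Tauberian theorem\<close>

lemma Gamma_shift: "0 < \<rho> \<Longrightarrow> Gamma (1 + \<rho>) = \<rho> * Gamma (\<rho> :: real)"
proof -
  assume "0 < \<rho>"
  then have "\<rho> \<notin> \<int>\<^sub>\<le>\<^sub>0" using nonpos_Ints_nonpos[of \<rho>] by auto
  then show ?thesis using Gamma_plus1[of \<rho>] by (simp add: add.commute)
qed

text \<open>
  The limit measure of the Tauberian theorem. Its density is normalised so that its Laplace
  transform is \<open>c powr - \<rho>\<close>.
\<close>

definition gamma_index_measure :: "real \<Rightarrow> real measure" where
  "gamma_index_measure \<rho> =
     density lborel (\<lambda>v. ennreal (indicator {0..} v * v powr (\<rho> - 1) / Gamma \<rho>))"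

text \<open>
  Up to the weight \<open>exp (- v / x)\<close>, which makes \<open>\<mu>\<close> finite, this is
  the integral of \<open>g\<close> against the image of \<open>\<mu>\<close> under
  \<open>v \<mapsto> exp (- v / x)\<close>, a measure on \<open>[0, 1]\<close>. Its moments are
  values of the Laplace transform of \<open>\<mu>\<close>, so weak convergence can be read off from
  Laplace transforms by polynomial approximation.
\<close>

definition exp_test :: "real measure \<Rightarrow> real \<Rightarrow> (real \<Rightarrow> real) \<Rightarrow> real" where
  "exp_test \<mu> x g = (LINT v|\<mu>. exp (- (v / x)) * g (exp (- (v / x))))"

lemma sets_gamma_index_measure [simp, measurable_cong]: "sets (gamma_index_measure \<rho>) = sets borel"
  by (simp add: gamma_index_measure_def)

lemma AE_gamma_index_measure_nonneg: "AE v in gamma_index_measure \<rho>. 0 \<le> v"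
  unfolding gamma_index_measure_def by (subst AE_density) (auto simp: indicator_def)

lemma gamma_index_measure_exp:
  assumes \<rho>: "0 < \<rho>" and c: "0 < c"
  shows "has_bochner_integral (gamma_index_measure \<rho>) (\<lambda>v. exp (- (c * v))) (c powr (- \<rho>))"
proof (rule has_bochner_integral_nn_integral)
  have G: "Gamma \<rho> > 0" using \<rho> by (simp add: Gamma_real_pos)
  have "(\<integral>\<^sup>+v. ennreal (exp (- (c * v))) \<partial>gamma_index_measure \<rho>) =
      (\<integral>\<^sup>+v. ennreal (indicator {0..} v * v powr (\<rho> - 1) / Gamma \<rho>) * ennreal (exp (- (c * v))) \<partial>lborel)"
    unfolding gamma_index_measure_def by (subst nn_integral_density) auto
  also have "\<dots> = (\<integral>\<^sup>+v. ennreal (c powr (1 - \<rho>) / Gamma \<rho>) *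
        ennreal (indicator {0..} (0 + c * v) * (0 + c * v) powr (\<rho> - 1) / exp (0 + c * v)) \<partial>lborel)"
  proof (intro nn_integral_cong)
    fix v :: real
    show "ennreal (indicator {0..} v * v powr (\<rho> - 1) / Gamma \<rho>) * ennreal (exp (- (c * v))) =
       ennreal (c powr (1 - \<rho>) / Gamma \<rho>) *
        ennreal (indicator {0..} (0 + c * v) * (0 + c * v) powr (\<rho> - 1) / exp (0 + c * v))"
    proof (cases "v \<ge> 0")
      case True
      have "(c powr (1 - \<rho>)) * (c * v) powr (\<rho> - 1) = v powr (\<rho> - 1)"
        using c True by (simp add: powr_mult powr_add[symmetric] mult.assoc[symmetric])
      then have "v powr (\<rho> - 1) / Gamma \<rho> * exp (- (c * v)) =
         c powr (1 - \<rho>) / Gamma \<rho> * ((c * v) powr (\<rho> - 1) / exp (c * v))"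
        by (simp add: exp_minus field_simps)
      moreover have "0 \<le> c * v" using c True by simp
      ultimately show ?thesis using True c G by (simp add: ennreal_mult[symmetric])
    next
      case False
      moreover have "\<not> 0 \<le> c * v" using c False by (simp add: zero_le_mult_iff)
      ultimately show ?thesis by simp
    qed
  qed
  also have "\<dots> = ennreal (c powr (1 - \<rho>) / Gamma \<rho>) *
      (\<integral>\<^sup>+v. ennreal (indicator {0..} (0 + c * v) * (0 + c * v) powr (\<rho> - 1) / exp (0 + c * v)) \<partial>lborel)"
    by (subst nn_integral_cmult) auto
  also have "\<dots> = ennreal (c powr (1 - \<rho>) / Gamma \<rho>) * ennreal (Gamma \<rho> / c)"
  proof -
    have "ennreal (Gamma \<rho>) = \<bar>c\<bar> * (\<integral>\<^sup>+v. ennreal (indicator {0..} (0 + c * v) * (0 + c * v) powr (\<rho> - 1) / exp (0 + c * v)) \<partial>lborel)"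
      using Gamma_conv_nn_integral_real[OF \<rho>]
        nn_integral_real_affine[of "\<lambda>t. ennreal (indicator {0..} t * t powr (\<rho> - 1) / exp t)" c 0] c
      by simp
    then have "ennreal (1 / c) * ennreal (Gamma \<rho>) = (ennreal (1 / c) * \<bar>c\<bar>) * (\<integral>\<^sup>+v. ennreal (indicator {0..} (0 + c * v) * (0 + c * v) powr (\<rho> - 1) / exp (0 + c * v)) \<partial>lborel)"
      by (simp add: mult.assoc)
    then have "(\<integral>\<^sup>+v. ennreal (indicator {0..} (0 + c * v) * (0 + c * v) powr (\<rho> - 1) / exp (0 + c * v)) \<partial>lborel) = ennreal (Gamma \<rho> / c)"
      using c G by (simp add: ennreal_mult[symmetric])
    then show ?thesis by simp
  qed
  also have "\<dots> = ennreal (c powr (1 - \<rho>) / c)"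
    using c G by (simp add: ennreal_mult[symmetric])
  also have "c powr (1 - \<rho>) / c = c powr (- \<rho>)"
    using c by (simp add: powr_diff powr_minus field_simps)
  finally show "(\<integral>\<^sup>+v. ennreal (exp (- (c * v))) \<partial>gamma_index_measure \<rho>) = ennreal (c powr (- \<rho>))" .
qed auto

lemma emeasure_gamma_index_measure:
  assumes \<rho>: "0 < \<rho>" and c: "0 \<le> c"
  shows "emeasure (gamma_index_measure \<rho>) {..c} = ennreal (c powr \<rho> / Gamma (1 + \<rho>))"
proof -
  have G: "Gamma \<rho> > 0" using \<rho> by (simp add: Gamma_real_pos)
  note G1 = Gamma_shift[OF \<rho>]
  have "emeasure (gamma_index_measure \<rho>) {..c} =
      (\<integral>\<^sup>+v. ennreal (indicator {0..} v * v powr (\<rho> - 1) / Gamma \<rho>) * indicator {..c} v \<partial>lborel)"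
    unfolding gamma_index_measure_def by (subst emeasure_density) auto
  also have "\<dots> = (\<integral>\<^sup>+v. ennreal (1 / Gamma \<rho>) * (ennreal (v powr (\<rho> - 1)) * indicator {0..c} v) \<partial>lborel)"
    using G by (intro nn_integral_cong) (auto simp: indicator_def ennreal_mult[symmetric])
  also have "\<dots> = ennreal (1 / Gamma \<rho>) * ennreal (c powr \<rho> / \<rho>)"
    using nn_integral_has_integral_lebesgue'[OF _ has_integral_powr_from_0[of "\<rho> - 1" c]] \<rho> c
    by (subst nn_integral_cmult) auto
  also have "\<dots> = ennreal (c powr \<rho> / Gamma (1 + \<rho>))"
    using G \<rho> by (simp add: G1 ennreal_mult[symmetric] field_simps)
  finally show ?thesis .
qed

context
  fixes \<mu> :: "real measure" and x :: real
  assumes sets_\<mu> [measurable_cong]: "sets \<mu> = sets borel"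
    and AE_nonneg: "AE v in \<mu>. 0 \<le> v"
    and x_pos: "0 < x"
    and integrable_exp: "integrable \<mu> (\<lambda>v. exp (- (v / x)))"
begin

lemma exp_test_integrable:
  assumes [measurable]: "g \<in> borel_measurable borel" and g: "\<And>s. 0 \<le> s \<Longrightarrow> s \<le> 1 \<Longrightarrow> \<bar>g s\<bar> \<le> B"
  shows "integrable \<mu> (\<lambda>v. exp (- (v / x)) * g (exp (- (v / x))))"
proof (rule Bochner_Integration.integrable_bound)
  show "integrable \<mu> (\<lambda>v. B * exp (- (v / x)))" using integrable_exp by simp
  have "B \<ge> 0" using g[of 0] by auto
  show "AE v in \<mu>. norm (exp (- (v / x)) * g (exp (- (v / x)))) \<le> norm (B * exp (- (v / x)))"
    using AE_nonneg
  proof eventually_elim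
    case (elim v)
    then have "\<bar>g (exp (- (v / x)))\<bar> \<le> B" using x_pos by (intro g) auto
    then show ?case using \<open>B \<ge> 0\<close> by (simp add: abs_mult mult.commute mult_right_mono)
  qed
qed simp

lemma exp_test_approx:
  assumes [measurable]: "g \<in> borel_measurable borel" "p \<in> borel_measurable borel"
    and g: "\<And>s. 0 \<le> s \<Longrightarrow> s \<le> 1 \<Longrightarrow> \<bar>g s\<bar> \<le> B"
    and p: "\<And>s. 0 \<le> s \<Longrightarrow> s \<le> 1 \<Longrightarrow> \<bar>g s - p s\<bar> \<le> \<delta>"
  shows "\<bar>exp_test \<mu> x g - exp_test \<mu> x p\<bar> \<le> \<delta> * (LINT v|\<mu>. exp (- (v / x)))"
proof -
  have p': "\<bar>p s\<bar> \<le> B + \<delta>" if "0 \<le> s" "s \<le> 1" for s using g[OF that] p[OF that] by linarith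
  have ig: "integrable \<mu> (\<lambda>v. exp (- (v / x)) * g (exp (- (v / x))))"
    by (rule exp_test_integrable[of g B]) (use g in auto)
  have ip: "integrable \<mu> (\<lambda>v. exp (- (v / x)) * p (exp (- (v / x))))"
    by (rule exp_test_integrable[of p "B + \<delta>"]) (use p' in auto)
  have "\<bar>exp_test \<mu> x g - exp_test \<mu> x p\<bar> =
     \<bar>LINT v|\<mu>. exp (- (v / x)) * g (exp (- (v / x))) - exp (- (v / x)) * p (exp (- (v / x)))\<bar>"
    unfolding exp_test_def
    using ig ip by (subst Bochner_Integration.integral_diff) auto
  also have "\<dots> \<le> (LINT v|\<mu>. \<bar>exp (- (v / x)) * g (exp (- (v / x))) - exp (- (v / x)) * p (exp (- (v / x)))\<bar>)"
    by (rule integral_abs_bound)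
  also have "\<dots> \<le> (LINT v|\<mu>. \<delta> * exp (- (v / x)))"
  proof (rule integral_mono_AE)
    show "integrable \<mu> (\<lambda>v. \<bar>exp (- (v / x)) * g (exp (- (v / x))) - exp (- (v / x)) * p (exp (- (v / x)))\<bar>)"
      using ig ip by auto
    show "AE v in \<mu>. \<bar>exp (- (v / x)) * g (exp (- (v / x))) - exp (- (v / x)) * p (exp (- (v / x)))\<bar> \<le> \<delta> * exp (- (v / x))"
      using AE_nonneg
    proof eventually_elim
      case (elim v)
      have "\<bar>g (exp (- (v / x))) - p (exp (- (v / x)))\<bar> \<le> \<delta>" using elim x_pos by (intro p) auto
      moreover have "exp (- (v / x)) * g (exp (- (v / x))) - exp (- (v / x)) * p (exp (- (v / x))) =
          (g (exp (- (v / x))) - p (exp (- (v / x)))) * exp (- (v / x))" by (simp add: algebra_simps)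
      ultimately show ?case by (simp add: abs_mult mult_right_mono)
    qed
  qed (use integrable_exp in auto)
  also have "\<dots> = \<delta> * (LINT v|\<mu>. exp (- (v / x)))" by simp
  finally show ?thesis .
qed

lemma exp_test_power:
  "exp_test \<mu> x (\<lambda>s. s ^ k) = (LINT v|\<mu>. exp (- (real (Suc k) * v / x)))"
  unfolding exp_test_def
  by (intro Bochner_Integration.integral_cong) (auto simp: exp_of_nat_mult[symmetric] exp_add[symmetric] field_simps add_divide_distrib)

text \<open>
  Iterating this identity reduces Bernstein polynomials to powers.
\<close>

lemma exp_test_power_diff:
  "exp_test \<mu> x (\<lambda>s. s ^ k * (1 - s) ^ Suc m) =
   exp_test \<mu> x (\<lambda>s. s ^ k * (1 - s) ^ m) - exp_test \<mu> x (\<lambda>s. s ^ Suc k * (1 - s) ^ m)"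
proof -
  have *: "\<bar>s ^ i * (1 - s) ^ j\<bar> \<le> 1" if "0 \<le> s" "s \<le> 1" for s :: real and i j
    using that by (auto simp: abs_mult power_abs intro!: mult_le_one power_le_one)
  have i: "integrable \<mu> (\<lambda>v. exp (- (v / x)) * (exp (- (v / x)) ^ i * (1 - exp (- (v / x))) ^ j))" for i j
    by (rule exp_test_integrable[of "\<lambda>s. s ^ i * (1 - s) ^ j" 1]) (use * in auto)
  show ?thesis
    unfolding exp_test_def Bochner_Integration.integral_diff[OF i i, symmetric]
    by (intro Bochner_Integration.integral_cong) (auto simp: algebra_simps)
qed

lemma exp_test_Bernstein:
  "exp_test \<mu> x (\<lambda>s. \<Sum>k\<le>n. c k * Bernstein n k s) =
     (\<Sum>k\<le>n. c k * real (n choose k) * exp_test \<mu> x (\<lambda>s. s ^ k * (1 - s) ^ (n - k)))"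
proof -
  have *: "\<bar>s ^ i * (1 - s) ^ j\<bar> \<le> 1" if "0 \<le> s" "s \<le> 1" for s :: real and i j
    using that by (auto simp: abs_mult power_abs intro!: mult_le_one power_le_one)
  have "exp_test \<mu> x (\<lambda>s. \<Sum>k\<le>n. c k * Bernstein n k s) =
     (LINT v|\<mu>. (\<Sum>k\<le>n. c k * real (n choose k) * (exp (- (v / x)) * (exp (- (v / x)) ^ k * (1 - exp (- (v / x))) ^ (n - k)))))"
    unfolding exp_test_def Bernstein_def by (simp add: sum_distrib_left mult_ac)
  also have "\<dots> = (\<Sum>k\<le>n. LINT v|\<mu>. c k * real (n choose k) * (exp (- (v / x)) * (exp (- (v / x)) ^ k * (1 - exp (- (v / x))) ^ (n - k))))"
    by (intro Bochner_Integration.integral_sum integrable_mult_right exp_test_integrable[of "\<lambda>s. s ^ i * (1 - s) ^ j" 1 for i j] *) auto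
  also have "\<dots> = (\<Sum>k\<le>n. c k * real (n choose k) * exp_test \<mu> x (\<lambda>s. s ^ k * (1 - s) ^ (n - k)))"
    unfolding exp_test_def by simp
  finally show ?thesis .
qed

end

text \<open>
  Convergence holds for powers of \<open>s\<close> by hypothesis, hence for Bernstein polynomials.
  These approximate \<open>g\<close> uniformly, and the error of the approximation is controlled by
  the normalising constant.
\<close>

lemma exp_test_tendsto:
  fixes \<mu> :: "'i \<Rightarrow> real measure" and x :: "'i \<Rightarrow> real" and F :: "'i filter"
  assumes \<rho>: "0 < \<rho>"
    and sets: "\<And>i. sets (\<mu> i) = sets borel"
    and AE_nonneg: "\<And>i. AE v in \<mu> i. 0 \<le> v"
    and ev: "\<forall>\<^sub>F i in F. 0 < x i \<and> integrable (\<mu> i) (\<lambda>v. exp (- (v / x i))) \<and>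
                  0 < (LINT v|\<mu> i. exp (- (v / x i)))"
    and lim: "\<And>k. 1 \<le> k \<Longrightarrow>
        ((\<lambda>i. (LINT v|\<mu> i. exp (- (real k * v / x i))) / (LINT v|\<mu> i. exp (- (v / x i)))) \<longlongrightarrow> real k powr (- \<rho>)) F"
    and cont: "continuous_on UNIV g"
  shows "((\<lambda>i. exp_test (\<mu> i) (x i) g / (LINT v|\<mu> i. exp (- (v / x i)))) \<longlongrightarrow> exp_test (gamma_index_measure \<rho>) 1 g) F"
proof -
  define L where "L i = (LINT v|\<mu> i. exp (- (v / x i)))" for i
  let ?\<nu> = "gamma_index_measure \<rho>"
  have g_meas: "g \<in> borel_measurable borel" using cont by (rule borel_measurable_continuous_onI)
  have int\<nu>: "integrable ?\<nu> (\<lambda>v. exp (- (v / 1)))"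
    using gamma_index_measure_exp[OF \<rho>, of 1] by (simp add: has_bochner_integral_iff)
  have L\<nu>: "(LINT v|?\<nu>. exp (- (v / 1))) = 1"
    using gamma_index_measure_exp[OF \<rho>, of 1] by (simp add: has_bochner_integral_iff)
  note ctx\<nu> = sets_gamma_index_measure AE_gamma_index_measure_nonneg zero_less_one int\<nu>
  have pw: "((\<lambda>i. exp_test (\<mu> i) (x i) (\<lambda>s. s ^ k * (1 - s) ^ m) / L i) \<longlongrightarrow>
      exp_test ?\<nu> 1 (\<lambda>s. s ^ k * (1 - s) ^ m)) F" for k m
  proof (induction m arbitrary: k)
    case 0
    have "exp_test ?\<nu> 1 (\<lambda>s. s ^ k) = real (Suc k) powr (- \<rho>)"
      using gamma_index_measure_exp[OF \<rho>, of "real (Suc k)"]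
      by (subst exp_test_power[OF ctx\<nu>]) (simp add: has_bochner_integral_iff)
    moreover have "\<forall>\<^sub>F i in F. exp_test (\<mu> i) (x i) (\<lambda>s. s ^ k) / L i =
        (LINT v|\<mu> i. exp (- (real (Suc k) * v / x i))) / (LINT v|\<mu> i. exp (- (v / x i)))"
      using ev by eventually_elim (simp add: L_def exp_test_power[OF sets AE_nonneg])
    ultimately show ?case using lim[of "Suc k"] by (simp add: tendsto_cong)
  next
    case (Suc m)
    have "\<forall>\<^sub>F i in F. exp_test (\<mu> i) (x i) (\<lambda>s. s ^ k * (1 - s) ^ Suc m) / L i =
      exp_test (\<mu> i) (x i) (\<lambda>s. s ^ k * (1 - s) ^ m) / L i - exp_test (\<mu> i) (x i) (\<lambda>s. s ^ Suc k * (1 - s) ^ m) / L i"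
      using ev by eventually_elim (simp only: exp_test_power_diff[OF sets AE_nonneg] diff_divide_distrib)
    moreover have "((\<lambda>i. exp_test (\<mu> i) (x i) (\<lambda>s. s ^ k * (1 - s) ^ m) / L i - exp_test (\<mu> i) (x i) (\<lambda>s. s ^ Suc k * (1 - s) ^ m) / L i)
        \<longlongrightarrow> exp_test ?\<nu> 1 (\<lambda>s. s ^ k * (1 - s) ^ Suc m)) F"
      unfolding exp_test_power_diff[OF ctx\<nu>] by (intro tendsto_diff Suc)
    ultimately show ?case by (simp only: tendsto_cong)
  qed
  have poly: "((\<lambda>i. exp_test (\<mu> i) (x i) (\<lambda>s. \<Sum>k\<le>n. c k * Bernstein n k s) / L i) \<longlongrightarrow>
      exp_test ?\<nu> 1 (\<lambda>s. \<Sum>k\<le>n. c k * Bernstein n k s)) F" for c :: "nat \<Rightarrow> real" and n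
  proof -
    have "\<forall>\<^sub>F i in F. exp_test (\<mu> i) (x i) (\<lambda>s. \<Sum>k\<le>n. c k * Bernstein n k s) / L i =
       (\<Sum>k\<le>n. c k * real (n choose k) * (exp_test (\<mu> i) (x i) (\<lambda>s. s ^ k * (1 - s) ^ (n - k)) / L i))"
      using ev by eventually_elim (simp add: exp_test_Bernstein[OF sets AE_nonneg] sum_divide_distrib)
    moreover have "((\<lambda>i. \<Sum>k\<le>n. c k * real (n choose k) * (exp_test (\<mu> i) (x i) (\<lambda>s. s ^ k * (1 - s) ^ (n - k)) / L i)) \<longlongrightarrow>
      exp_test ?\<nu> 1 (\<lambda>s. \<Sum>k\<le>n. c k * Bernstein n k s)) F"
      unfolding exp_test_Bernstein[OF ctx\<nu>] by (intro tendsto_sum tendsto_mult pw tendsto_const)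
    ultimately show ?thesis by (simp only: tendsto_cong)
  qed
  have "bounded (g ` {0..1})"
    using cont by (intro compact_imp_bounded compact_continuous_image) (auto intro: continuous_on_subset)
  then obtain B where B: "\<And>s. 0 \<le> s \<Longrightarrow> s \<le> 1 \<Longrightarrow> \<bar>g s\<bar> \<le> B" by (force simp: bounded_iff)
  show ?thesis
  proof (rule tendstoI)
    fix e :: real assume e: "0 < e"
    obtain n where n: "\<And>s. s \<in> {0..1} \<Longrightarrow> \<bar>g s - (\<Sum>k\<le>n. g (real k / real n) * Bernstein n k s)\<bar> < e / 4"
      using Bernstein_Weierstrass[of g "e / 4"] cont e by (meson continuous_on_subset le_refl subset_UNIV zero_less_divide_iff zero_less_numeral)
    define p where "p = (\<lambda>s. \<Sum>k\<le>n. g (real k / real n) * Bernstein n k s)"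
    have p: "\<bar>g s - p s\<bar> \<le> e / 4" if "0 \<le> s" "s \<le> 1" for s using n[of s] that by (auto simp: p_def)
    have p_meas: "p \<in> borel_measurable borel" unfolding p_def Bernstein_def by simp
    have "\<forall>\<^sub>F i in F. dist (exp_test (\<mu> i) (x i) p / L i) (exp_test ?\<nu> 1 p) < e / 4"
      using poly[of "\<lambda>k. g (real k / real n)" n] e unfolding p_def by (intro tendstoD) auto
    with ev show "\<forall>\<^sub>F i in F. dist (exp_test (\<mu> i) (x i) g / (LINT v|\<mu> i. exp (- (v / x i)))) (exp_test ?\<nu> 1 g) < e"
    proof eventually_elim
      case (elim i)
      have 1: "\<bar>exp_test (\<mu> i) (x i) g - exp_test (\<mu> i) (x i) p\<bar> \<le> e / 4 * L i"
        unfolding L_def by (rule exp_test_approx[OF sets AE_nonneg _ _ g_meas p_meas B p]) (use elim in auto)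
      have 2: "\<bar>exp_test ?\<nu> 1 g - exp_test ?\<nu> 1 p\<bar> \<le> e / 4"
        using exp_test_approx[OF ctx\<nu> g_meas p_meas B p] L\<nu> by simp
      have Lp: "L i > 0" using elim by (simp add: L_def)
      have "\<bar>exp_test (\<mu> i) (x i) g / L i - exp_test (\<mu> i) (x i) p / L i\<bar> \<le> e / 4"
      proof -
        have "\<bar>exp_test (\<mu> i) (x i) g / L i - exp_test (\<mu> i) (x i) p / L i\<bar> =
          \<bar>exp_test (\<mu> i) (x i) g - exp_test (\<mu> i) (x i) p\<bar> / L i"
          using Lp by (simp add: diff_divide_distrib[symmetric] abs_divide)
        also have "\<dots> \<le> e / 4" using 1 Lp by (simp add: pos_divide_le_eq)
        finally show ?thesis .
      qed
      then show ?case using 2 elim(2) e unfolding L_def dist_real_def by linarith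
    qed
  qed
qed

text \<open>
  Divided by \<open>s\<close>, to undo the weight in \<^const>\<open>exp_test\<close>, and made
  continuous by cutting the denominator off at \<open>a\<close>: the piecewise linear function that
  rises from \<open>0\<close> at \<open>a\<close> to \<open>1\<close> at \<open>b\<close>.
\<close>

definition ramp :: "real \<Rightarrow> real \<Rightarrow> real \<Rightarrow> real" where
  "ramp a b s = max 0 (min 1 ((s - a) / (b - a))) / max s a"

lemma ramp_bounds:
  assumes "0 < a" "a < b" "0 < s"
  shows "indicator {b..} s \<le> s * ramp a b s" "s * ramp a b s \<le> indicator {a..} s"
proof -
  have "s * ramp a b s = max 0 (min 1 ((s - a) / (b - a)))"
    using assms by (cases "s \<ge> a") (auto simp: ramp_def max_def min_def divide_simps split: if_splits)
  then show "indicator {b..} s \<le> s * ramp a b s" "s * ramp a b s \<le> indicator {a..} s"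
    using assms by (auto simp: indicator_def max_def min_def divide_simps split: if_splits)
qed

lemma continuous_ramp: "0 < a \<Longrightarrow> a < b \<Longrightarrow> continuous_on UNIV (ramp a b)"
  unfolding ramp_def by (intro continuous_intros) auto

lemma exp_test_ramp_bounds:
  fixes \<mu> :: "real measure" and x :: real
  assumes sets_\<mu> [measurable_cong]: "sets \<mu> = sets borel"
    and AE_nonneg: "AE v in \<mu>. 0 \<le> v"
    and x_pos: "0 < x"
    and integrable_exp: "integrable \<mu> (\<lambda>v. exp (- (v / x)))"
    and ab: "c < d"
  shows "measure \<mu> {..x * c} \<le> exp_test \<mu> x (ramp (exp (- d)) (exp (- c)))"
    and "exp_test \<mu> x (ramp (exp (- d)) (exp (- c))) \<le> measure \<mu> {..x * d}"
proof -
  have fin: "integrable \<mu> (\<lambda>v. indicator {..x * d} v :: real)" for d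
  proof (rule Bochner_Integration.integrable_bound)
    show "integrable \<mu> (\<lambda>v. exp d * exp (- (v / x)))" using integrable_exp by simp
    show "AE v in \<mu>. norm (indicator {..x * d} v :: real) \<le> norm (exp d * exp (- (v / x)))"
      using x_pos by (auto simp: indicator_def exp_add[symmetric] field_simps)
  qed simp
  have sp: "space \<mu> = UNIV" using sets_eq_imp_space_eq[OF sets_\<mu>] by simp
  have m: "measure \<mu> {..x * d} = (LINT v|\<mu>. indicator {..x * d} v)" for d
    by (simp add: sp)
  have [measurable]: "ramp (exp (- d)) (exp (- c)) \<in> borel_measurable borel"
    using ab by (intro borel_measurable_continuous_onI continuous_ramp) auto
  have s: "exp (- d) \<le> exp (- (v / x)) \<longleftrightarrow> v \<le> x * d" for v d
    using x_pos by (auto simp: field_simps)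
  have b: "indicator {..x * c} v \<le> exp (- (v / x)) * ramp (exp (- d)) (exp (- c)) (exp (- (v / x)))"
      "exp (- (v / x)) * ramp (exp (- d)) (exp (- c)) (exp (- (v / x))) \<le> indicator {..x * d} v"
      "0 \<le> exp (- (v / x)) * ramp (exp (- d)) (exp (- c)) (exp (- (v / x)))" for v
  proof -
    have i: "indicator {..x * d} v = (indicator {exp (- d)..} (exp (- (v / x))) :: real)" for d
      unfolding indicator_def atLeast_iff atMost_iff s ..
    show "indicator {..x * c} v \<le> exp (- (v / x)) * ramp (exp (- d)) (exp (- c)) (exp (- (v / x)))"
      "exp (- (v / x)) * ramp (exp (- d)) (exp (- c)) (exp (- (v / x))) \<le> indicator {..x * d} v"
      unfolding i by (intro ramp_bounds; use ab in simp)+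
    show "0 \<le> exp (- (v / x)) * ramp (exp (- d)) (exp (- c)) (exp (- (v / x)))"
      unfolding ramp_def by (intro mult_nonneg_nonneg divide_nonneg_nonneg) (auto simp: le_max_iff_disj)
  qed
  have i: "integrable \<mu> (\<lambda>v. exp (- (v / x)) * ramp (exp (- d)) (exp (- c)) (exp (- (v / x))))"
    by (rule Bochner_Integration.integrable_bound[OF fin[of d]]) (use b in auto)
  show "measure \<mu> {..x * c} \<le> exp_test \<mu> x (ramp (exp (- d)) (exp (- c)))"
    unfolding exp_test_def m by (intro integral_mono fin i b)
  show "exp_test \<mu> x (ramp (exp (- d)) (exp (- c))) \<le> measure \<mu> {..x * d}"
    unfolding exp_test_def m by (intro integral_mono fin i b)
qed

text \<open>
  The indicator of \<open>[0, a]\<close> is squeezed between ramps. Their limits are masses of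
  intervals \<open>[0, c]\<close> with \<open>c\<close> close to \<open>a\<close>, and these depend
  continuously on \<open>c\<close>. The measure may depend on the index as well as the scale does;
  this is what makes the theorem applicable uniformly in a parameter.
\<close>

theorem karamata_tauberian:
  fixes \<mu> :: "'i \<Rightarrow> real measure" and x :: "'i \<Rightarrow> real" and F :: "'i filter"
  assumes \<rho>: "0 < \<rho>"
    and sets: "\<And>i. sets (\<mu> i) = sets borel"
    and AE_nonneg: "\<And>i. AE v in \<mu> i. 0 \<le> v"
    and ev: "\<forall>\<^sub>F i in F. 0 < x i \<and> integrable (\<mu> i) (\<lambda>v. exp (- (v / x i))) \<and>
                  0 < (LINT v|\<mu> i. exp (- (v / x i)))"
    and lim: "\<And>k. 1 \<le> k \<Longrightarrow>
        ((\<lambda>i. (LINT v|\<mu> i. exp (- (real k * v / x i))) / (LINT v|\<mu> i. exp (- (v / x i)))) \<longlongrightarrow> real k powr (- \<rho>)) F"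
    and a: "0 < a"
  shows "((\<lambda>i. measure (\<mu> i) {..x i * a} / (LINT v|\<mu> i. exp (- (v / x i)))) \<longlongrightarrow> a powr \<rho> / Gamma (1 + \<rho>)) F"
proof -
  define L where "L i = (LINT v|\<mu> i. exp (- (v / x i)))" for i
  let ?\<nu> = "gamma_index_measure \<rho>"
  define W where "W c = c powr \<rho> / Gamma (1 + \<rho>)" for c
  have int\<nu>: "integrable ?\<nu> (\<lambda>v. exp (- (v / 1)))"
    using gamma_index_measure_exp[OF \<rho>, of 1] by (simp add: has_bochner_integral_iff)
  note ctx\<nu> = sets_gamma_index_measure AE_gamma_index_measure_nonneg zero_less_one int\<nu>
  have Wm: "measure ?\<nu> {..1 * c} = W c" if "c \<ge> 0" for c
    using emeasure_gamma_index_measure[OF \<rho> that] \<rho>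
    by (simp add: W_def measure_def Gamma_real_pos less_imp_le)
  have Wc: "(W \<longlongrightarrow> W a) (at a)"
    unfolding W_def using a \<rho> Gamma_real_pos[of "1 + \<rho>"] by (intro tendsto_intros) (auto simp del: Gamma_real_pos)
  have tr: "((\<lambda>i. exp_test (\<mu> i) (x i) (ramp (exp (- d)) (exp (- c))) / L i) \<longlongrightarrow>
      exp_test ?\<nu> 1 (ramp (exp (- d)) (exp (- c)))) F" if "c < d" for c d
    unfolding L_def using that by (intro exp_test_tendsto[OF \<rho> sets AE_nonneg ev lim] continuous_ramp) auto
  show ?thesis
    unfolding L_def[symmetric] W_def[symmetric]
  proof (rule order_tendstoI)
    fix y assume y: "y < W a"
    have "\<forall>\<^sub>F c in at_left a. y < W c \<and> 0 < c"
      using order_tendstoD(1)[OF Wc y] a eventually_at_left_real[of 0 a]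
      by (auto simp: eventually_at_split eventually_conj_iff elim: eventually_mono)
    moreover have "\<forall>\<^sub>F c in at_left a. c < a" by (simp add: eventually_at_filter)
    ultimately have "\<forall>\<^sub>F c in at_left a. (y < W c \<and> 0 < c) \<and> c < a" by (rule eventually_conj)
    then obtain c where c: "y < W c" "0 < c" "c < a"
      by (metis (mono_tags, lifting) eventually_happens trivial_limit_at_left_real)
    have "W c \<le> exp_test ?\<nu> 1 (ramp (exp (- a)) (exp (- c)))"
      using exp_test_ramp_bounds(1)[OF ctx\<nu> c(3)] Wm[of c] c by simp
    then have "\<forall>\<^sub>F i in F. y < exp_test (\<mu> i) (x i) (ramp (exp (- a)) (exp (- c))) / L i"
      using c by (intro order_tendstoD(1)[OF tr]) auto
    with ev show "\<forall>\<^sub>F i in F. y < measure (\<mu> i) {..x i * a} / L i"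
    proof eventually_elim
      case (elim i)
      have "exp_test (\<mu> i) (x i) (ramp (exp (- a)) (exp (- c))) / L i \<le> measure (\<mu> i) {..x i * a} / L i"
        using elim c by (intro divide_right_mono exp_test_ramp_bounds(2)[OF sets AE_nonneg]) (auto simp: L_def)
      with elim show ?case by simp
    qed
  next
    fix y assume y: "W a < y"
    have "\<forall>\<^sub>F c in at_right a. W c < y"
      using order_tendstoD(2)[OF Wc y] by (auto simp: eventually_at_split)
    moreover have "\<forall>\<^sub>F c in at_right a. a < c" by (simp add: eventually_at_filter)
    ultimately have "\<forall>\<^sub>F c in at_right a. W c < y \<and> a < c" by (rule eventually_conj)
    then obtain c where c: "W c < y" "a < c"
      by (metis (mono_tags, lifting) eventually_happens trivial_limit_at_right_real)
    have "exp_test ?\<nu> 1 (ramp (exp (- c)) (exp (- a))) \<le> W c"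
      using exp_test_ramp_bounds(2)[OF ctx\<nu> c(2)] Wm[of c] c a by simp
    then have "\<forall>\<^sub>F i in F. exp_test (\<mu> i) (x i) (ramp (exp (- c)) (exp (- a))) / L i < y"
      using c by (intro order_tendstoD(2)[OF tr]) auto
    with ev show "\<forall>\<^sub>F i in F. measure (\<mu> i) {..x i * a} / L i < y"
    proof eventually_elim
      case (elim i)
      have "measure (\<mu> i) {..x i * a} / L i \<le> exp_test (\<mu> i) (x i) (ramp (exp (- c)) (exp (- a))) / L i"
        using elim c by (intro divide_right_mono exp_test_ramp_bounds(1)[OF sets AE_nonneg]) (auto simp: L_def)
      with elim show ?case by simp
    qed
  qed
qed

section \<open>Bernstein functions and decreasing averages\<close>

text \<open>
  The derivatives form a sequence, instead of being iterates of \<^const>\<open>deriv\<close>, so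
  that differences with a shifted copy can be taken termwise.
\<close>

definition completely_monotone_seq :: "(nat \<Rightarrow> real \<Rightarrow> real) \<Rightarrow> bool" where
  "completely_monotone_seq D \<longleftrightarrow>
     (\<forall>n. \<forall>x>0. (D n has_real_derivative D (Suc n) x) (at x) \<and> 0 \<le> (- 1) ^ n * D n x)"

fun alt_diff :: "(real \<Rightarrow> real) \<Rightarrow> real \<Rightarrow> nat \<Rightarrow> real \<Rightarrow> real" where
  "alt_diff f b 0 x = f x"
| "alt_diff f b (Suc m) x = alt_diff f b m x - alt_diff f b m (x + b)"

lemma alt_diff_Suc': "alt_diff f b (Suc m) x = alt_diff (\<lambda>y. f y - f (y + b)) b m x"
proof (induction m arbitrary: x)
  case (Suc m)
  have "alt_diff f b (Suc (Suc m)) x = alt_diff f b (Suc m) x - alt_diff f b (Suc m) (x + b)"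
    by (rule alt_diff.simps(2))
  also have "\<dots> = alt_diff (\<lambda>y. f y - f (y + b)) b (Suc m) x"
    unfolding Suc by simp
  finally show ?case .
qed simp

lemma alt_diff_uminus: "alt_diff (\<lambda>y. - f y) b m x = - alt_diff f b m x"
  by (induction m arbitrary: x) auto

lemma shift_difference_sign:
  fixes g g' :: "real \<Rightarrow> real"
  assumes "\<And>x. 0 < x \<Longrightarrow> (g has_real_derivative g' x) (at x)" "\<And>x. 0 < x \<Longrightarrow> c * g' x \<le> 0"
    and "0 < x" "0 < b"
  shows "0 \<le> c * (g x - g (x + b))"
proof -
  have "c * g (x + b) \<le> c * g x"
  proof (rule DERIV_nonpos_imp_nonincreasing[of x "x + b" "\<lambda>y. c * g y"])
    fix y assume "x \<le> y" "y \<le> x + b"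
    then show "\<exists>z. ((\<lambda>y. c * g y) has_real_derivative z) (at y) \<and> z \<le> 0"
      using assms by (intro exI[of _ "c * g' y"]) (auto intro!: DERIV_cmult)
  qed (use assms in auto)
  then show ?thesis by (simp add: algebra_simps)
qed

lemma has_derivative_shift_diff:
  assumes "\<And>x. 0 < x \<Longrightarrow> (g has_real_derivative g' x) (at x)" "0 < x" "0 < b"
  shows "((\<lambda>y. g y - g (y + b)) has_real_derivative (g' x - g' (x + b))) (at x)"
  using assms by (intro DERIV_diff) (auto simp: DERIV_shift[symmetric])

lemma completely_monotone_seq_diff:
  assumes "completely_monotone_seq D" "0 < b"
  shows "completely_monotone_seq (\<lambda>n x. D n x - D n (x + b))"
proof -
  have d: "(D n has_real_derivative D (Suc n) x) (at x)" if "0 < x" for n x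
    using assms that by (auto simp: completely_monotone_seq_def)
  have s: "(- 1) ^ n * D (Suc n) x \<le> 0" if "0 < x" for n x
  proof -
    have "0 \<le> (- 1) ^ Suc n * D (Suc n) x"
      using assms(1) that unfolding completely_monotone_seq_def by blast
    then show ?thesis by simp
  qed
  show ?thesis
    unfolding completely_monotone_seq_def
  proof (intro allI impI conjI)
    fix n and x :: real assume x: "0 < x"
    show "((\<lambda>x. D n x - D n (x + b)) has_real_derivative D (Suc n) x - D (Suc n) (x + b)) (at x)"
      by (rule has_derivative_shift_diff[OF d x assms(2)])
    show "0 \<le> (- 1) ^ n * (D n x - D n (x + b))"
      by (rule shift_difference_sign[OF d s x assms(2)])
  qed
qed

text \<open>
  Passing to \<open>f(x) - f(x + b)\<close> preserves complete monotonicity by the mean value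
  theorem, so the induction can proceed along the differences.
\<close>

lemma alt_diff_completely_monotone:
  "completely_monotone_seq D \<Longrightarrow> 0 < b \<Longrightarrow> 0 < x \<Longrightarrow> 0 \<le> alt_diff (D 0) b m x"
proof (induction m arbitrary: D)
  case 0
  then have "0 \<le> (- 1) ^ 0 * D 0 x" unfolding completely_monotone_seq_def by blast
  then show ?case by simp
next
  case (Suc m)
  show ?case unfolding alt_diff_Suc'
    by (rule Suc.IH[of "\<lambda>n x. D n x - D n (x + b)"]) (use Suc completely_monotone_seq_diff in auto)
qed

text \<open>
  The first difference \<open>f(x + b) - f(x)\<close> of a Bernstein function is completely
  monotone.
\<close>

lemma alt_diff_bernstein_function:
  assumes f: "bernstein_function f" and b: "0 < b" and x: "0 < x"
  shows "alt_diff f b (Suc m) x \<le> 0"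
proof -
  define D where "D n y = - ((deriv ^^ n) f y - (deriv ^^ n) f (y + b))" for n y
  have d: "((deriv ^^ n) f has_real_derivative (deriv ^^ Suc n) f x) (at x)" if "0 < x" for n x
  proof -
    have "(deriv ^^ n) f differentiable (at x)" using f that unfolding bernstein_function_def by blast
    then show ?thesis by (simp add: DERIV_deriv_iff_real_differentiable)
  qed
  have s: "(- ((- 1) ^ n)) * (deriv ^^ Suc n) f x \<le> 0" if "0 < x" for n x
  proof -
    have "(- 1) ^ Suc n * (deriv ^^ Suc n) f x \<le> 0"
      using f that unfolding bernstein_function_def by (metis le_add1 plus_1_eq_Suc)
    then show ?thesis by (simp del: funpow.simps)
  qed
  have "completely_monotone_seq D"
    unfolding completely_monotone_seq_def
  proof (intro allI impI conjI)
    fix n and x :: real assume x: "0 < x"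
    show "(D n has_real_derivative D (Suc n) x) (at x)"
      unfolding D_def by (intro DERIV_minus has_derivative_shift_diff[OF d x b])
    show "0 \<le> (- 1) ^ n * D n x"
      using shift_difference_sign[OF d s x b, of n] by (simp add: D_def algebra_simps)
  qed
  from alt_diff_completely_monotone[OF this b x, of m]
  show ?thesis unfolding alt_diff_Suc' D_def alt_diff_uminus by simp
qed

text \<open>
  The setting for a special exponent \<open>\<Phi>\<close>, with
  \<open>f(c) = c / \<Phi>(c)\<close>. It will follow that \<open>U\<close> behaves as if it had a
  decreasing density on \<open>(0, \<infinity>)\<close>.
\<close>

locale bernstein_renewal =
  fixes U :: "real measure" and f :: "real \<Rightarrow> real"
  assumes sets_U [measurable_cong]: "sets U = sets borel"
    and AE_nonneg: "AE v in U. 0 \<le> v"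
    and integrable_exp: "\<And>c. 0 < c \<Longrightarrow> integrable U (\<lambda>v. exp (- (c * v)))"
    and f_eq: "\<And>c. 0 < c \<Longrightarrow> f c = c * (LINT v|U. exp (- (c * v)))"
    and bernstein: "bernstein_function f"
begin

abbreviation E :: "real \<Rightarrow> real \<Rightarrow> real" where
  "E \<theta> v \<equiv> exp (- (\<theta> * v))"

lemma integrable_exp_bounded:
  assumes "0 < c" and "g \<in> borel_measurable borel" and "\<And>s. 0 \<le> s \<Longrightarrow> s \<le> 1 \<Longrightarrow> \<bar>g s\<bar> \<le> B"
  shows "integrable U (\<lambda>v. exp (- (c * v)) * g (exp (- (c * v))))"
  using exp_test_integrable[OF sets_U AE_nonneg, of "1 / c" g B] integrable_exp[of c] assms
  by (simp add: mult.commute)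

lemma integrable_exp_power:
  assumes "0 < c"
  shows "integrable U (\<lambda>v. exp (- (c * v)) * (exp (- (c * v)) ^ i * (1 - exp (- (c * v))) ^ j))"
  by (rule integrable_exp_bounded[of c "\<lambda>s. s ^ i * (1 - s) ^ j" 1])
     (use assms in \<open>auto simp: abs_mult power_abs intro!: mult_le_one power_le_one\<close>)

lemma integrable_exp_power':
  assumes "0 < c" "1 \<le> i"
  shows "integrable U (\<lambda>v. exp (- (c * v)) ^ i * (1 - exp (- (c * v))) ^ j)"
  using integrable_exp_power[OF assms(1), of "i - 1" j] assms(2)
  by (simp add: power_eq_if[of _ i] mult.assoc)

text \<open>
  With \<open>s = exp (- \<theta> v)\<close>, the value \<open>f(k \<theta>)\<close> is
  \<open>\<theta>\<close> times the integral of \<open>k s ^ k\<close>, and differences in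
  \<open>k\<close> multiply \<open>s ^ k\<close> by \<open>1 - s\<close>. The integrand is
  \<open>s\<close> times the derivative of \<open>s ^ k (1 - s) ^ m\<close> in \<open>s\<close>.
\<close>

lemma alt_diff_eq_integral:
  assumes \<theta>: "0 < \<theta>" and k: "1 \<le> k"
  shows "alt_diff f \<theta> m (real k * \<theta>) = \<theta> * (LINT v|U.
     real k * (exp (- (\<theta> * v)) ^ k * (1 - exp (- (\<theta> * v))) ^ m)
     - real m * (exp (- (\<theta> * v)) ^ Suc k * (1 - exp (- (\<theta> * v))) ^ (m - 1)))"
  using k
proof (induction m arbitrary: k)
  case 0
  have "exp (- (real k * \<theta> * v)) = exp (- (\<theta> * v)) ^ k" for v
    by (simp add: exp_of_nat_mult[symmetric] mult_ac)
  then show ?case using 0 \<theta> by (simp add: f_eq)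
next
  case (Suc m)
  have *: "alt_diff f \<theta> m (real k * \<theta> + \<theta>) = alt_diff f \<theta> m (real (Suc k) * \<theta>)"
    by (simp add: algebra_simps)
  define h where "h k m s = real k * (s ^ k * (1 - s) ^ m) - real m * (s ^ Suc k * (1 - s) ^ (m - 1))"
    for k m and s :: real
  have int: "integrable U (\<lambda>v. h k m (exp (- (\<theta> * v))))" if "1 \<le> k" for k m
    unfolding h_def using that
    by (intro Bochner_Integration.integrable_diff integrable_mult_right integrable_exp_power' \<theta>) auto
  have pw: "h k m s - h (Suc k) m s = h k (Suc m) s" for s
  proof (cases m)
    case 0
    then show ?thesis by (simp add: h_def algebra_simps)
  next
    case (Suc j)
    define P where "P = s ^ k"
    define Q where "Q = (1 - s) ^ j"
    show ?thesis unfolding h_def Suc by (simp flip: P_def Q_def) (simp add: algebra_simps)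
  qed
  have IH: "alt_diff f \<theta> m (real k * \<theta>) = \<theta> * (LINT v|U. h k m (exp (- (\<theta> * v))))" if "1 \<le> k" for k
    unfolding h_def by (rule Suc.IH[OF that])
  have "alt_diff f \<theta> (Suc m) (real k * \<theta>) =
      \<theta> * (LINT v|U. h k m (exp (- (\<theta> * v))) - h (Suc k) m (exp (- (\<theta> * v))))"
    using Suc.prems unfolding alt_diff.simps *
    by (subst Bochner_Integration.integral_diff) (auto simp: IH[of "Suc k"] IH[of k] int right_diff_distrib simp del: of_nat_Suc)
  then show ?case unfolding pw unfolding h_def .
qed

definition bernstein_mass :: "real \<Rightarrow> nat \<Rightarrow> nat \<Rightarrow> real" where
  "bernstein_mass \<theta> n k = (LINT v|U. E \<theta> v * Bernstein n k (E \<theta> v))"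

lemma integrable_bernstein_mass:
  assumes "0 < \<theta>"
  shows "integrable U (\<lambda>v. E \<theta> v * Bernstein n k (E \<theta> v))"
  using integrable_mult_right[OF integrable_exp_power[OF assms, of k "n - k"], of "real (n choose k)"]
  unfolding Bernstein_def by (simp add: mult_ac)

text \<open>
  The derivative of a Bernstein basis polynomial of degree \<open>n + 1\<close> is
  \<open>n + 1\<close> times the difference of two consecutive basis polynomials of degree
  \<open>n\<close>. So the sign of the alternating differences of \<open>f\<close> is the sign of
  the increments of the masses.
\<close>

lemma bernstein_mass_mono:
  assumes \<theta>: "0 < \<theta>" and k: "k < n"
  shows "bernstein_mass \<theta> n k \<le> bernstein_mass \<theta> n (Suc k)"
proof -
  have "Suc k * (Suc n choose Suc k) = Suc n * (n choose k)"
    by (rule Suc_times_binomial)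
  then have b1: "real (Suc n choose Suc k) * real (Suc k) = real (Suc n) * real (n choose k)"
    by (metis of_nat_mult mult.commute)
  have "(n - k) * (Suc n choose Suc k) = Suc n * (n choose Suc k)"
    using binomial_absorb_comp[of "Suc n" "Suc k"] by simp
  then have b2: "real (Suc n choose Suc k) * real (n - k) = real (Suc n) * real (n choose Suc k)"
    by (metis of_nat_mult mult.commute)
  have nk: "n - k = Suc (n - Suc k)" using k by simp
  have pw: "real (Suc n choose Suc k) * (real (Suc k) * (s ^ Suc k * (1 - s) ^ (n - k))
       - real (n - k) * (s ^ Suc (Suc k) * (1 - s) ^ (n - k - 1)))
     = real (Suc n) * (s * Bernstein n k s - s * Bernstein n (Suc k) s)" for s :: real
  proof -
    have "real (Suc n choose Suc k) * (real (Suc k) * (s ^ Suc k * (1 - s) ^ (n - k))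
       - real (n - k) * (s ^ Suc (Suc k) * (1 - s) ^ (n - k - 1)))
      = (real (Suc n choose Suc k) * real (Suc k)) * (s ^ Suc k * (1 - s) ^ (n - k))
       - (real (Suc n choose Suc k) * real (n - k)) * (s ^ Suc (Suc k) * (1 - s) ^ (n - k - 1))"
      by (simp only: right_diff_distrib mult.assoc)
    also have "\<dots> = real (Suc n) * (s * Bernstein n k s - s * Bernstein n (Suc k) s)"
      unfolding b1 b2 Bernstein_def by (simp add: nk right_diff_distrib mult_ac)
    finally show ?thesis .
  qed
  have "alt_diff f \<theta> (n - k) (real (Suc k) * \<theta>) \<le> 0"
    using alt_diff_bernstein_function[OF bernstein \<theta>, of "real (Suc k) * \<theta>" "n - Suc k"] \<theta> k
    unfolding nk by simp
  then have "(LINT v|U. real (Suc k) * (E \<theta> v ^ Suc k * (1 - E \<theta> v) ^ (n - k))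
     - real (n - k) * (E \<theta> v ^ Suc (Suc k) * (1 - E \<theta> v) ^ (n - k - 1))) \<le> 0"
    using alt_diff_eq_integral[OF \<theta>, of "Suc k" "n - k"] \<theta> by (simp add: mult_le_0_iff)
  then have "real (Suc n choose Suc k) * (LINT v|U. real (Suc k) * (E \<theta> v ^ Suc k * (1 - E \<theta> v) ^ (n - k))
     - real (n - k) * (E \<theta> v ^ Suc (Suc k) * (1 - E \<theta> v) ^ (n - k - 1))) \<le> 0"
    by (simp add: mult_le_0_iff del: binomial_Suc_Suc)
  then have "(LINT v|U. real (Suc n) * (E \<theta> v * Bernstein n k (E \<theta> v) - E \<theta> v * Bernstein n (Suc k) (E \<theta> v))) \<le> 0"
    unfolding Bochner_Integration.integral_mult_right_zero[symmetric] pw .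
  then have "real (Suc n) * (bernstein_mass \<theta> n k - bernstein_mass \<theta> n (Suc k)) \<le> 0"
    unfolding Bochner_Integration.integral_mult_right_zero bernstein_mass_def
    by (subst (asm) Bochner_Integration.integral_diff) (intro integrable_bernstein_mass \<theta>)+
  then show ?thesis by (simp add: mult_le_0_iff)
qed

lemma sum_bernstein_mass:
  assumes \<theta>: "0 < \<theta>"
  shows "(\<Sum>k\<le>n. a k * bernstein_mass \<theta> n k) = (LINT v|U. E \<theta> v * (\<Sum>k\<le>n. a k * Bernstein n k (E \<theta> v)))"
proof -
  have "(LINT v|U. E \<theta> v * (\<Sum>k\<le>n. a k * Bernstein n k (E \<theta> v))) =
    (LINT v|U. (\<Sum>k\<le>n. a k * (E \<theta> v * Bernstein n k (E \<theta> v))))"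
    by (simp add: sum_distrib_left mult_ac)
  also have "\<dots> = (\<Sum>k\<le>n. LINT v|U. a k * (E \<theta> v * Bernstein n k (E \<theta> v)))"
    by (intro Bochner_Integration.integral_sum integrable_mult_right integrable_bernstein_mass \<theta>)
  finally show ?thesis by (simp add: bernstein_mass_def)
qed

lemma bernstein_mass_nonneg:
  assumes \<theta>: "0 < \<theta>"
  shows "0 \<le> bernstein_mass \<theta> n k"
  unfolding bernstein_mass_def
proof (rule integral_nonneg_AE)
  show "AE v in U. 0 \<le> E \<theta> v * Bernstein n k (E \<theta> v)"
    using AE_nonneg by eventually_elim (use \<theta> in \<open>intro mult_nonneg_nonneg Bernstein_nonneg, auto\<close>)
qed

lemma abel_sum_nonpos:
  assumes \<theta>: "0 < \<theta>" and J: "\<And>k. k \<le> Suc n \<Longrightarrow> 0 \<le> J k" "J (Suc n) = 0"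
  shows "(\<Sum>k\<le>n. (J (Suc k) - J k) * bernstein_mass \<theta> n k) \<le> (0::real)"
proof -
  have "(\<Sum>k\<le>m. (J (Suc k) - J k) * bernstein_mass \<theta> n k) \<le> J (Suc m) * bernstein_mass \<theta> n m" if "m \<le> n" for m
    using that
  proof (induction m)
    case 0
    then show ?case using J(1)[of 0] bernstein_mass_nonneg[OF \<theta>, of n 0] by (simp add: algebra_simps)
  next
    case (Suc m)
    have "J (Suc m) * bernstein_mass \<theta> n m \<le> J (Suc m) * bernstein_mass \<theta> n (Suc m)"
      using Suc.prems by (intro mult_left_mono bernstein_mass_mono \<theta> J) auto
    then show ?case using Suc by (simp add: algebra_simps)
  qed
  from this[of n] show ?thesis using J(2) by simp
qed

text \<open>
  A continuous form of the monotonicity of the masses: the measure \<open>s U(ds)\<close> behaves as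
  if it had an increasing density, so that integration by parts against the primitive
  \<open>J \<ge> 0\<close>, which vanishes at \<open>1\<close>, gives a nonpositive result. The
  proof is summation by parts for Bernstein approximations.
\<close>

lemma integral_nonpos_of_nonneg_primitive:
  assumes \<theta>: "0 < \<theta>" and cont: "continuous_on UNIV g"
    and J: "\<And>s. 0 \<le> s \<Longrightarrow> s \<le> 1 \<Longrightarrow> (J has_real_derivative g s) (at s)"
    and J_nonneg: "\<And>s. 0 \<le> s \<Longrightarrow> s \<le> 1 \<Longrightarrow> 0 \<le> J s" and J1: "J 1 = 0"
  shows "(LINT v|U. E \<theta> v * g (E \<theta> v)) \<le> 0"
proof (rule field_le_epsilon)
  fix e0 :: real assume e0: "0 < e0"
  define C where "C = (LINT v|U. E \<theta> v)"
  have C: "0 \<le> C" unfolding C_def by (intro integral_nonneg_AE) auto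
  define e where "e = e0 / (2 * (C + 1))"
  have e: "0 < e" using e0 C by (simp add: e_def)
  have g_meas [measurable]: "g \<in> borel_measurable borel" using cont by (rule borel_measurable_continuous_onI)
  have "bounded (g ` {0..1})"
    using cont by (intro compact_imp_bounded compact_continuous_image) (auto intro: continuous_on_subset)
  then obtain B where B: "\<And>s. 0 \<le> s \<Longrightarrow> s \<le> 1 \<Longrightarrow> \<bar>g s\<bar> \<le> B" by (force simp: bounded_iff)
  have "uniformly_continuous_on {0..1} g"
    using cont by (intro compact_uniformly_continuous) (auto intro: continuous_on_subset)
  then obtain d where d: "0 < d" "\<And>x y. x \<in> {0..1} \<Longrightarrow> y \<in> {0..1} \<Longrightarrow> \<bar>y - x\<bar> < d \<Longrightarrow> \<bar>g y - g x\<bar> < e"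
    using e unfolding uniformly_continuous_on_def dist_real_def by metis
  obtain N0 where N0: "\<And>n s. N0 \<le> n \<Longrightarrow> s \<in> {0..1} \<Longrightarrow> \<bar>g s - (\<Sum>k\<le>n. g (real k / real n) * Bernstein n k s)\<bar> < e"
    using Bernstein_Weierstrass[of g e] cont e by (meson continuous_on_subset subset_UNIV)
  obtain N1 :: nat where N1: "1 / d < real N1" using reals_Archimedean2 by blast
  define n where "n = max (max N0 N1) 1"
  have n: "N0 \<le> n" "1 \<le> n" "1 / d < real n" using N1 by (auto simp: n_def)
  \<comment> \<open>\<open>a k\<close> is the average of \<open>g\<close> over an interval of length \<open>1 / (n + 1)\<close> that contains \<open>k / n\<close>.\<close>
  define a where "a k = (real n + 1) * (J (real (Suc k) / (real n + 1)) - J (real k / (real n + 1)))" for k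
  have a: "\<bar>g (real k / real n) - a k\<bar> \<le> e" if k: "k \<le> n" for k
  proof -
    let ?l = "real k / (real n + 1)" and ?r = "real (Suc k) / (real n + 1)"
    have lr: "?l < ?r" "0 \<le> ?l" "?r \<le> 1" using k by (auto simp: divide_simps)
    have "\<exists>z>?l. z < ?r \<and> J ?r - J ?l = (?r - ?l) * g z"
    proof (rule MVT2)
      show "?l < ?r" by fact
      fix x assume x: "?l \<le> x" "x \<le> ?r"
      show "(J has_real_derivative g x) (at x)"
        using x lr by (intro J) linarith+
    qed
    then obtain z where z: "?l < z" "z < ?r" "J ?r - J ?l = (?r - ?l) * g z" by auto
    have az: "a k = g z"
      unfolding a_def z(3) by (simp add: field_simps)
    have kn: "?l \<le> real k / real n" "real k / real n \<le> ?r"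
      using k n by (auto simp: divide_simps algebra_simps)
    have "\<bar>real k / real n - z\<bar> \<le> ?r - ?l" using z kn by linarith
    also have "\<dots> = 1 / (real n + 1)" by (simp add: field_simps)
    also have "\<dots> < d"
    proof -
      have "1 < real n * d" using n(3) d(1) by (simp add: field_simps)
      then have "1 < (real n + 1) * d" using d(1) by (simp add: algebra_simps)
      then show ?thesis by (simp add: field_simps)
    qed
    finally have "\<bar>real k / real n - z\<bar> < d" .
    moreover have "z \<in> {0..1}" using z(1,2) lr unfolding atLeastAtMost_iff by linarith
    moreover have "real k / real n \<in> {0..1}" using k n by auto
    ultimately have "\<bar>g (real k / real n) - g z\<bar> < e" by (intro d(2)) auto
    then show ?thesis using az by simp
  qed
  have "(LINT v|U. E \<theta> v * g (E \<theta> v)) \<le> (LINT v|U. E \<theta> v * (\<Sum>k\<le>n. (a k + 2 * e) * Bernstein n k (E \<theta> v)))"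
  proof (rule integral_mono_AE)
    show "integrable U (\<lambda>v. E \<theta> v * g (E \<theta> v))"
      by (rule integrable_exp_bounded[OF \<theta> g_meas B])
    have "integrable U (\<lambda>v. \<Sum>k\<le>n. (a k + 2 * e) * (E \<theta> v * Bernstein n k (E \<theta> v)))"
      by (intro Bochner_Integration.integrable_sum integrable_mult_right integrable_bernstein_mass \<theta>)
    then show "integrable U (\<lambda>v. E \<theta> v * (\<Sum>k\<le>n. (a k + 2 * e) * Bernstein n k (E \<theta> v)))"
      by (simp add: sum_distrib_left mult_ac)
    show "AE v in U. E \<theta> v * g (E \<theta> v) \<le> E \<theta> v * (\<Sum>k\<le>n. (a k + 2 * e) * Bernstein n k (E \<theta> v))"
      using AE_nonneg
    proof eventually_elim
      case (elim v)
      define s where "s = E \<theta> v"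
      have s: "0 \<le> s" "s \<le> 1" using elim \<theta> by (auto simp: s_def)
      have "g s \<le> (\<Sum>k\<le>n. g (real k / real n) * Bernstein n k s) + e"
        using N0[OF n(1), of s] s by auto
      also have "\<dots> = (\<Sum>k\<le>n. (g (real k / real n) + e) * Bernstein n k s)"
        by (simp add: distrib_right sum.distrib sum_distrib_left[symmetric])
      also have "\<dots> \<le> (\<Sum>k\<le>n. (a k + 2 * e) * Bernstein n k s)"
      proof (intro sum_mono mult_right_mono Bernstein_nonneg s)
        fix k assume "k \<in> {..n}"
        then show "g (real k / real n) + e \<le> a k + 2 * e" using a[of k] by (simp add: abs_le_iff)
      qed
      finally show ?case unfolding s_def[symmetric] using s by (intro mult_left_mono) auto
    qed
  qed
  also have "\<dots> = (\<Sum>k\<le>n. (a k + 2 * e) * bernstein_mass \<theta> n k)" by (rule sum_bernstein_mass[OF \<theta>, symmetric])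
  also have "\<dots> = (\<Sum>k\<le>n. a k * bernstein_mass \<theta> n k) + 2 * e * (\<Sum>k\<le>n. 1 * bernstein_mass \<theta> n k)"
    by (simp add: distrib_right sum.distrib sum_distrib_left)
  also have "(\<Sum>k\<le>n. 1 * bernstein_mass \<theta> n k) = C"
    unfolding sum_bernstein_mass[OF \<theta>] C_def by simp
  also have "(\<Sum>k\<le>n. a k * bernstein_mass \<theta> n k) = (real n + 1) * (\<Sum>k\<le>n. (J (real (Suc k) / (real n + 1)) - J (real k / (real n + 1))) * bernstein_mass \<theta> n k)"
    unfolding a_def sum_distrib_left mult.assoc ..
  also have "\<dots> \<le> 0"
  proof -
    have "(\<Sum>k\<le>n. (J (real (Suc k) / (real n + 1)) - J (real k / (real n + 1))) * bernstein_mass \<theta> n k) \<le> 0"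
      using J1 by (intro abel_sum_nonpos[OF \<theta>, where J = "\<lambda>k. J (real k / (real n + 1))"] J_nonneg)
        (auto simp: divide_simps add.commute)
    then show ?thesis by (intro mult_nonneg_nonpos) auto
  qed
  also have "0 + 2 * e * C \<le> 0 + e0"
  proof -
    have "2 * e * C = e0 * (C / (C + 1))" using C by (simp add: e_def field_simps)
    also have "\<dots> \<le> e0 * 1" using e0 C by (intro mult_left_mono) auto
    finally show ?thesis by simp
  qed
  finally show "(LINT v|U. E \<theta> v * g (E \<theta> v)) \<le> 0 + e0" by simp
qed

text \<open>
  A continuous approximation from below of the indicator of \<open>(l, r)\<close>, with slope
  \<open>n\<close> at the end points.
\<close>

definition bump :: "real \<Rightarrow> real \<Rightarrow> nat \<Rightarrow> real \<Rightarrow> real" where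
  "bump l r n s = max 0 (min 1 (real n * min (s - l) (r - s)))"

lemma continuous_bump: "continuous_on S (bump l r n)"
  unfolding bump_def by (intro continuous_intros)

lemma bump_bounds: "0 \<le> bump l r n s" "bump l r n s \<le> 1" "bump l r n s \<le> indicator {l<..<r} s"
  "s \<le> l \<or> r \<le> s \<Longrightarrow> bump l r n s = 0"
proof -
  show 0: "bump l r n s = 0" if "s \<le> l \<or> r \<le> s"
  proof -
    have "real n * min (s - l) (r - s) \<le> 0" using that by (intro mult_nonneg_nonpos) auto
    then show ?thesis by (simp add: bump_def)
  qed
  show "0 \<le> bump l r n s" "bump l r n s \<le> 1" by (auto simp: bump_def)
  then show "bump l r n s \<le> indicator {l<..<r} s" using 0 by (auto simp: indicator_def)
qed

lemma bump_integrable: "bump l r n integrable_on {x..y}"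
  by (intro integrable_continuous_interval continuous_bump)

lemma integral_bump_0: "y \<le> l \<or> r \<le> x \<Longrightarrow> integral {x..y} (bump l r n) = 0"
  by (subst integral_cong[of _ _ "\<lambda>_. 0"]) (auto simp: bump_bounds)

lemma integral_bump_le:
  assumes "-1 \<le> l" "l < r" "r \<le> 1"
  shows "integral {-1..1} (bump l r n) \<le> r - l"
proof -
  have "integral {-1..1} (bump l r n) = integral {-1..l} (bump l r n) + integral {l..1} (bump l r n)"
    using assms by (intro Henstock_Kurzweil_Integration.integral_combine[symmetric] bump_integrable) auto
  also have "integral {l..1} (bump l r n) = integral {l..r} (bump l r n) + integral {r..1} (bump l r n)"
    using assms by (intro Henstock_Kurzweil_Integration.integral_combine[symmetric] bump_integrable) auto
  also have "integral {l..r} (bump l r n) \<le> integral {l..r} (\<lambda>_. 1)"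
    by (intro integral_le bump_integrable bump_bounds) auto
  finally show ?thesis using assms by (simp add: integral_bump_0)
qed

lemma integral_bump_ge:
  assumes "-1 \<le> l" "l < r" "r \<le> 1" "0 < n" "2 / real n \<le> r - l"
  shows "r - l - 2 / real n \<le> integral {-1..1} (bump l r n)"
proof -
  have "r - l - 2 / real n = integral {l + 1 / real n..r - 1 / real n} (\<lambda>_. 1)"
    using assms by simp
  also have "\<dots> = integral {l + 1 / real n..r - 1 / real n} (bump l r n)"
    using assms by (intro integral_cong) (auto simp: bump_def min_def max_def field_simps)
  also have "\<dots> \<le> integral {-1..1} (bump l r n)"
  proof (intro integral_subset_le bump_integrable)
    have "0 < 1 / real n" using assms by simp
    then show "{l + 1 / real n..r - 1 / real n} \<subseteq> {- 1..1}"
      using assms unfolding atLeastatMost_subset_iff by linarith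
  qed (auto simp: bump_bounds)
  finally show ?thesis .
qed

text \<open>
  The test function is the difference of the two bumps, weighted to have total integral
  \<open>0\<close>; as the first bump lies to the left of the second one, the primitive is
  nonnegative.
\<close>

lemma bump_average_mono:
  assumes \<theta>: "0 < \<theta>" and lr: "0 \<le> l" "l < r" "r \<le> l'" "l' < r'" "r' \<le> 1"
  shows "integral {-1..1} (bump l' r' n) * (LINT v|U. E \<theta> v * bump l r n (E \<theta> v)) \<le>
         integral {-1..1} (bump l r n) * (LINT v|U. E \<theta> v * bump l' r' n (E \<theta> v))"
proof -
  define m where "m = integral {-1..1} (bump l r n)"
  define m' where "m' = integral {-1..1} (bump l' r' n)"
  define g where "g s = m' * bump l r n s - m * bump l' r' n s" for s
  define J where "J s = integral {-1..s} g" for s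
  have cont: "continuous_on S g" for S
    unfolding g_def by (intro continuous_intros continuous_bump)
  have J_eq: "J s = m' * integral {-1..s} (bump l r n) - m * integral {-1..s} (bump l' r' n)" for s
    unfolding J_def g_def
    by (subst Henstock_Kurzweil_Integration.integral_diff)
       (auto intro!: integrable_on_cmult_left[unfolded scaleR_conv_of_real] integrable_continuous_interval continuous_intros continuous_bump)
  have m_nonneg: "0 \<le> m" "0 \<le> m'"
    unfolding m_def m'_def by (intro Henstock_Kurzweil_Integration.integral_nonneg bump_integrable bump_bounds)+
  have le: "integral {-1..s} (bump l r n) \<le> integral {-1..1} (bump l r n)" if "s \<le> 1" for s l r
    using that by (intro integral_subset_le bump_integrable) (auto simp: bump_bounds)
  have J_nonneg: "0 \<le> J s" if s: "0 \<le> s" "s \<le> 1" for s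
  proof (cases "s \<le> l'")
    case True
    then have "integral {-1..s} (bump l' r' n) = 0" by (intro integral_bump_0) auto
    moreover have "0 \<le> integral {-1..s} (bump l r n)"
      by (intro Henstock_Kurzweil_Integration.integral_nonneg bump_integrable bump_bounds)
    ultimately show ?thesis using m_nonneg by (simp add: J_eq)
  next
    case False
    have "m = integral {-1..s} (bump l r n) + integral {s..1} (bump l r n)"
      unfolding m_def using s by (intro Henstock_Kurzweil_Integration.integral_combine[symmetric] bump_integrable) auto
    moreover have "integral {s..1} (bump l r n) = 0" using False lr by (intro integral_bump_0) auto
    ultimately have "integral {-1..s} (bump l r n) = m" by simp
    moreover have "m * integral {-1..s} (bump l' r' n) \<le> m * m'"
      unfolding m'_def using m_nonneg le[OF s(2)] by (intro mult_left_mono) auto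
    ultimately show ?thesis by (simp add: J_eq mult.commute)
  qed
  have J1: "J 1 = 0" by (simp add: J_eq m_def m'_def)
  have J': "(J has_real_derivative g s) (at s)" if s: "0 \<le> s" "s \<le> 1" for s
  proof -
    have "(J has_real_derivative g s) (at s within {-1..2})"
      unfolding J_def using s by (intro integral_has_real_derivative cont) auto
    moreover have "at s within {-1..2} = at s" using s by (intro at_within_Icc_at) auto
    ultimately show ?thesis by simp
  qed
  have int: "integrable U (\<lambda>v. E \<theta> v * bump l r n (E \<theta> v))" for l r
    by (rule integrable_exp_bounded[OF \<theta>, of _ 1])
       (auto simp: bump_bounds intro!: borel_measurable_continuous_onI continuous_bump)
  have "(LINT v|U. E \<theta> v * g (E \<theta> v)) \<le> 0"
    by (rule integral_nonpos_of_nonneg_primitive[OF \<theta> cont J' J_nonneg J1])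
  also have "(\<lambda>v. E \<theta> v * g (E \<theta> v)) =
     (\<lambda>v. m' * (E \<theta> v * bump l r n (E \<theta> v)) - m * (E \<theta> v * bump l' r' n (E \<theta> v)))"
    by (auto simp: g_def algebra_simps)
  finally show ?thesis
    unfolding m_def[symmetric] m'_def[symmetric]
    by (subst (asm) Bochner_Integration.integral_diff) (auto intro!: int)
qed

lemma exp_interval_average_mono:
  assumes \<theta>: "0 < \<theta>" and lr: "0 \<le> l" "l < r" "r \<le> l'" "l' < r'" "r' \<le> 1"
  shows "(r' - l') * (LINT v|U. E \<theta> v * indicator {l<..<r} (E \<theta> v)) \<le>
         (r - l) * (LINT v|U. E \<theta> v * indicator {l'<..<r'} (E \<theta> v))"
    (is "_ * ?K \<le> _ * ?K'")
proof (rule LIMSEQ_le_const2)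
  define k where "k n = (LINT v|U. E \<theta> v * bump l r n (E \<theta> v))" for n
  have [measurable]: "bump l r n \<in> borel_measurable borel" for l r n
    by (intro borel_measurable_continuous_onI continuous_bump)
  have int: "integrable U (\<lambda>v. E \<theta> v * bump l r n (E \<theta> v))" for l r n
    by (rule integrable_exp_bounded[OF \<theta>, of _ 1]) (auto simp: bump_bounds)
  have "k \<longlonglongrightarrow> ?K"
    unfolding k_def
  proof (rule integral_dominated_convergence[where w = "\<lambda>v. E \<theta> v"])
    show "AE v in U. (\<lambda>n. E \<theta> v * bump l r n (E \<theta> v)) \<longlonglongrightarrow> E \<theta> v * indicator {l<..<r} (E \<theta> v)"
    proof (intro AE_I2 tendsto_mult tendsto_const)
      fix v
      define s where "s = E \<theta> v"
      have "(\<lambda>n. bump l r n s) \<longlonglongrightarrow> indicator {l<..<r} s"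
      proof (cases "s \<in> {l<..<r}")
        case True
        then have p: "0 < min (s - l) (r - s)" by auto
        have "\<forall>\<^sub>F n in sequentially. 1 / min (s - l) (r - s) < real n"
          using filterlim_real_sequentially by (simp add: filterlim_at_top_dense)
        then have "\<forall>\<^sub>F n in sequentially. bump l r n s = 1"
          by eventually_elim (use p in \<open>simp add: bump_def pos_divide_less_eq\<close>)
        then show ?thesis using True by (simp add: tendsto_eventually)
      next
        case False
        then show ?thesis by (auto simp: bump_bounds indicator_def not_less)
      qed
      then show "(\<lambda>n. bump l r n (E \<theta> v)) \<longlonglongrightarrow> indicator {l<..<r} (E \<theta> v)"
        by (simp add: s_def)
    qed
    show "AE v in U. norm (E \<theta> v * bump l r n (E \<theta> v)) \<le> E \<theta> v" for n
      by (auto simp: abs_mult bump_bounds)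
  qed (use integrable_exp[OF \<theta>] in auto)
  then show "(\<lambda>n. (r' - l' - 2 / real n) * k n) \<longlonglongrightarrow> (r' - l') * ?K"
    by (auto intro!: tendsto_eq_intros lim_const_over_n)
  have "\<forall>\<^sub>F n in sequentially. 2 / (r' - l') < real n"
    using filterlim_real_sequentially by (simp add: filterlim_at_top_dense)
  then obtain N where N: "\<And>n. N \<le> n \<Longrightarrow> 2 / (r' - l') < real n" by (auto simp: eventually_sequentially)
  show "\<exists>N. \<forall>n\<ge>N. (r' - l' - 2 / real n) * k n \<le> (r - l) * ?K'"
  proof (intro exI[of _ N] allI impI)
    fix n assume "N \<le> n"
    then have n: "2 / (r' - l') < real n" by (rule N)
    have "0 < 2 / (r' - l')" using lr by simp
    then have n0: "0 < real n" using n by linarith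
    have n2: "2 / real n \<le> r' - l'" using n n0 lr by (simp add: field_simps)
    have k0: "0 \<le> k n" unfolding k_def by (intro integral_nonneg_AE) (auto simp: bump_bounds)
    have "(r' - l' - 2 / real n) * k n \<le> integral {-1..1} (bump l' r' n) * k n"
      using n0 n2 lr k0 by (intro mult_right_mono integral_bump_ge) auto
    also have "\<dots> \<le> integral {-1..1} (bump l r n) * (LINT v|U. E \<theta> v * bump l' r' n (E \<theta> v))"
      unfolding k_def by (rule bump_average_mono[OF \<theta> lr])
    also have "\<dots> \<le> (r - l) * ?K'"
    proof (rule mult_mono)
      show "integral {-1..1} (bump l r n) \<le> r - l" using lr by (intro integral_bump_le) auto
      show "(LINT v|U. E \<theta> v * bump l' r' n (E \<theta> v)) \<le> ?K'"
        by (intro integral_mono int integrable_exp_bounded[OF \<theta>, of _ 1] mult_left_mono bump_bounds)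
           (auto simp: indicator_def)
      show "0 \<le> (LINT v|U. E \<theta> v * bump l' r' n (E \<theta> v))"
        by (intro integral_nonneg_AE) (auto simp: bump_bounds)
    qed (use lr in simp)
    finally show "(r' - l' - 2 / real n) * k n \<le> (r - l) * ?K'" .
  qed
qed

lemma integrable_indicator_bounded:
  assumes [measurable]: "A \<in> sets borel" and A: "A \<subseteq> {..x}"
  shows "integrable U (\<lambda>v. indicator A v :: real)"
proof (rule Bochner_Integration.integrable_bound)
  show "integrable U (\<lambda>v. exp x * exp (- (1 * v)))" using integrable_exp[of 1] by simp
  show "AE v in U. norm (indicator A v :: real) \<le> norm (exp x * exp (- (1 * v)))"
    using A by (auto simp: indicator_def exp_add[symmetric])
qed simp

lemma measure_eq_integral:
  assumes "A \<in> sets borel"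
  shows "measure U A = (LINT v|U. indicator A v)"
  using sets_eq_imp_space_eq[OF sets_U] by simp

text \<open>
  The map \<open>v \<mapsto> exp (- \<theta> v)\<close> reverses the order of the intervals and is
  nearly affine for small \<open>\<theta>\<close>. After division by \<open>\<theta>\<close>, the
  lengths of the images tend to the lengths of the intervals, and the weight \<open>s\<close> tends
  to \<open>1\<close>.
\<close>

theorem open_interval_average_antimono:
  assumes ab: "0 \<le> a" "a < b" "b \<le> c" "c < d"
  shows "(b - a) * measure U {c<..<d} \<le> (d - c) * measure U {a<..<b}"
proof -
  have ineq: "exp (- (\<theta> * d)) * ((exp (- (\<theta> * a)) - exp (- (\<theta> * b))) / \<theta>) * measure U {c<..<d} \<le>
      exp (- (\<theta> * a)) * ((exp (- (\<theta> * c)) - exp (- (\<theta> * d))) / \<theta>) * measure U {a<..<b}" if \<theta>: "0 < \<theta>" for \<theta>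
  proof -
    let ?l = "exp (- (\<theta> * d))" and ?r = "exp (- (\<theta> * c))" and ?l' = "exp (- (\<theta> * b))" and ?r' = "exp (- (\<theta> * a))"
    have lr: "0 \<le> ?l" "?l < ?r" "?r \<le> ?l'" "?l' < ?r'" "?r' \<le> 1"
      using \<theta> ab by auto
    have ind: "indicator {exp (- (\<theta> * y))<..<exp (- (\<theta> * x))} (E \<theta> v) = (indicator {x<..<y} v :: real)" for x y v
      using \<theta> by (auto simp: indicator_def)
    have int: "integrable U (\<lambda>v. indicator {x<..<y} v :: real)" for x y
      by (rule integrable_indicator_bounded[of _ y]) auto
    have int': "integrable U (\<lambda>v. E \<theta> v * indicator {x<..<y} v)" for x y
      using integrable_real_mult_indicator[OF _ integrable_exp[OF \<theta>], of "{x<..<y}"] sets_U by (simp add: mult.commute)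
    have K: "?l * measure U {c<..<d} \<le> (LINT v|U. E \<theta> v * indicator {?l<..<?r} (E \<theta> v))"
    proof -
      have "?l * measure U {c<..<d} = (LINT v|U. ?l * indicator {c<..<d} v)"
        by (subst measure_eq_integral) auto
      also have "\<dots> \<le> (LINT v|U. E \<theta> v * indicator {c<..<d} v)"
        by (intro integral_mono integrable_mult_right int int') (use \<theta> in \<open>simp add: indicator_def\<close>)
      finally show ?thesis unfolding ind .
    qed
    have K': "(LINT v|U. E \<theta> v * indicator {?l'<..<?r'} (E \<theta> v)) \<le> ?r' * measure U {a<..<b}"
    proof -
      have "(LINT v|U. E \<theta> v * indicator {a<..<b} v) \<le> (LINT v|U. ?r' * indicator {a<..<b} v)"
        by (intro integral_mono integrable_mult_right int int') (use \<theta> in \<open>simp add: indicator_def\<close>)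
      also have "\<dots> = ?r' * measure U {a<..<b}" by (subst measure_eq_integral) auto
      finally show ?thesis unfolding ind .
    qed
    have "(?r' - ?l') * (?l * measure U {c<..<d}) \<le> (?r' - ?l') * (LINT v|U. E \<theta> v * indicator {?l<..<?r} (E \<theta> v))"
      using lr by (intro mult_left_mono K) auto
    also have "\<dots> \<le> (?r - ?l) * (LINT v|U. E \<theta> v * indicator {?l'<..<?r'} (E \<theta> v))"
      by (rule exp_interval_average_mono[OF \<theta> lr])
    also have "\<dots> \<le> (?r - ?l) * (?r' * measure U {a<..<b})"
      using lr by (intro mult_left_mono K') auto
    finally have "(?r' - ?l') * (?l * measure U {c<..<d}) / \<theta> \<le> (?r - ?l) * (?r' * measure U {a<..<b}) / \<theta>"
      using \<theta> by (intro divide_right_mono) auto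
    then show ?thesis by (simp add: mult_ac)
  qed
  have lim: "((\<lambda>\<theta>. (exp (- (\<theta> * x)) - exp (- (\<theta> * y))) / \<theta>) \<longlongrightarrow> y - x) (at_right 0)" for x y :: real
  proof -
    have "((\<lambda>\<theta>. exp (- (\<theta> * x)) - exp (- (\<theta> * y))) has_real_derivative y - x) (at 0 within {0<..})"
      by (auto intro!: derivative_eq_intros)
    then show ?thesis
      unfolding has_field_derivative_iff by simp
  qed
  have lim0: "((\<lambda>\<theta>. exp (- (\<theta> * x))) \<longlongrightarrow> 1) (at_right 0)" for x :: real
  proof -
    have "((\<lambda>\<theta>. exp (- (\<theta> * x))) \<longlongrightarrow> exp (- (0 * x))) (at_right 0)"
      by (intro tendsto_intros)
    then show ?thesis by simp
  qed
  have "1 * (b - a) * measure U {c<..<d} \<le> 1 * (d - c) * measure U {a<..<b}"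
  proof (rule tendsto_le)
    show "((\<lambda>\<theta>. exp (- (\<theta> * a)) * ((exp (- (\<theta> * c)) - exp (- (\<theta> * d))) / \<theta>) * measure U {a<..<b}) \<longlongrightarrow> 1 * (d - c) * measure U {a<..<b}) (at_right 0)"
      by (intro tendsto_mult lim lim0 tendsto_const)
    show "((\<lambda>\<theta>. exp (- (\<theta> * d)) * ((exp (- (\<theta> * a)) - exp (- (\<theta> * b))) / \<theta>) * measure U {c<..<d}) \<longlongrightarrow> 1 * (b - a) * measure U {c<..<d}) (at_right 0)"
      by (intro tendsto_mult lim lim0 tendsto_const)
    show "\<forall>\<^sub>F \<theta> in at_right 0. exp (- (\<theta> * d)) * ((exp (- (\<theta> * a)) - exp (- (\<theta> * b))) / \<theta>) * measure U {c<..<d} \<le>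
      exp (- (\<theta> * a)) * ((exp (- (\<theta> * c)) - exp (- (\<theta> * d))) / \<theta>) * measure U {a<..<b}"
      by (rule eventually_at_right_less[THEN eventually_mono]) (rule ineq)
  qed simp
  then show ?thesis by simp
qed

theorem interval_average_antimono:
  assumes ab: "0 \<le> a" "a < b" "b \<le> c" "c < d"
  shows "(b - a) * measure U {c<..d} \<le> (d - c) * measure U {a<..b}"
proof (rule tendsto_lowerbound)
  show "((\<lambda>e. (e - c) * measure U {a<..b}) \<longlongrightarrow> (d - c) * measure U {a<..b}) (at_right d)"
    by (intro tendsto_intros)
  have mono: "measure U A \<le> measure U B" if "A \<subseteq> B" "A \<in> sets borel" "B \<in> sets borel" "B \<subseteq> {..x}" for A B x
    unfolding measure_eq_integral[OF that(2)] measure_eq_integral[OF that(3)]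
    using that by (intro integral_mono integrable_indicator_bounded[of _ x]) (auto simp: indicator_def)
  show "\<forall>\<^sub>F e in at_right d. (b - a) * measure U {c<..d} \<le> (e - c) * measure U {a<..b}"
    unfolding eventually_at_filter
  proof (intro always_eventually allI impI)
    fix e assume "e \<noteq> d" "e \<in> {d<..}"
    then have e: "d < e" by simp
    have "(b - a) * measure U {c<..d} \<le> (b - a) * measure U {c<..<e}"
      using ab e by (intro mult_left_mono mono[of _ _ e]) auto
    also have "\<dots> \<le> (e - c) * measure U {a<..<b}"
      using ab e by (intro open_interval_average_antimono) auto
    also have "\<dots> \<le> (e - c) * measure U {a<..b}"
      using ab e by (intro mult_left_mono mono[of _ _ b]) auto
    finally show "(b - a) * measure U {c<..d} \<le> (e - c) * measure U {a<..b}" .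
  qed
qed simp

end

section \<open>Subordinators and their renewal measure\<close>

locale subordinator = prob_space M for M :: "'w measure" +
  fixes X :: "real \<Rightarrow> 'w \<Rightarrow> real" and \<Phi> :: "real \<Rightarrow> real"
  assumes nonneg_levy: "nonneg_levy_process M X"
    and laplace: "\<And>c s. 0 < c \<Longrightarrow> 0 < s \<Longrightarrow> expectation (\<lambda>w. exp (- (c * X s w))) = exp (- \<Phi> c * s)"
    and \<Phi>_nonneg: "\<And>c. 0 < c \<Longrightarrow> 0 \<le> \<Phi> c"
    and nonzero: "\<exists>c>0. \<Phi> c \<noteq> 0"
begin

lemma levy: "levy_process M X"
  using nonneg_levy by (simp add: nonneg_levy_process_def)

lemma X_measurable [measurable]: "0 \<le> s \<Longrightarrow> X s \<in> borel_measurable M"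
  using levy unfolding levy_process_def by blast

lemma X_nonneg: "0 \<le> s \<Longrightarrow> w \<in> space M \<Longrightarrow> 0 \<le> X s w"
  using nonneg_levy by (simp add: nonneg_levy_process_def)

lemma X_0: "AE w in M. X 0 w = 0"
  using levy unfolding levy_process_def by blast

lemma X_right_cont: "0 \<le> s \<Longrightarrow> w \<in> space M \<Longrightarrow> ((\<lambda>u. X u w) \<longlongrightarrow> X s w) (at_right s)"
  using levy unfolding levy_process_def by blast

lemma X_left_lim: "0 < s \<Longrightarrow> w \<in> space M \<Longrightarrow> \<exists>l. ((\<lambda>u. X u w) \<longlongrightarrow> l) (at_left s)"
  using levy unfolding levy_process_def by blast

lemma X_stationary: "0 \<le> s \<Longrightarrow> 0 \<le> h \<Longrightarrow> distr M borel (\<lambda>w. X (s + h) w - X s w) = distr M borel (X h)"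
  using levy unfolding levy_process_def by blast

lemma increment_nonneg:
  assumes "0 \<le> s" "0 \<le> h"
  shows "AE w in M. X s w \<le> X (s + h) w"
proof -
  have "AE x in distr M borel (X h). 0 \<le> x"
    using assms X_nonneg by (subst AE_distr_iff) auto
  then have "AE x in distr M borel (\<lambda>w. X (s + h) w - X s w). 0 \<le> x"
    unfolding X_stationary[OF assms] .
  then show ?thesis
    using assms by (subst (asm) AE_distr_iff) auto
qed

text \<open>
  Stationarity gives monotonicity on rational times outside a null set; right continuity extends it
  to all times.
\<close>

lemma AE_mono: "AE w in M. \<forall>s r. 0 \<le> s \<longrightarrow> s \<le> r \<longrightarrow> X s w \<le> X r w"
proof -
  have "AE w in M. \<forall>p q :: rat. 0 \<le> p \<longrightarrow> p \<le> q \<longrightarrow> X (real_of_rat p) w \<le> X (real_of_rat q) w"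
    unfolding AE_all_countable
  proof (intro allI)
    fix p q :: rat
    show "AE w in M. 0 \<le> p \<longrightarrow> p \<le> q \<longrightarrow> X (real_of_rat p) w \<le> X (real_of_rat q) w"
    proof (cases "0 \<le> p \<and> p \<le> q")
      case True
      then have "AE w in M. X (real_of_rat p) w \<le> X (real_of_rat p + (real_of_rat q - real_of_rat p)) w"
        by (intro increment_nonneg) (auto simp: of_rat_less_eq)
      then show ?thesis by simp
    qed auto
  qed
  with AE_space show ?thesis
  proof eventually_elim
    case (elim w)
    show ?case
    proof (intro allI impI)
      fix s r :: real assume sr: "0 \<le> s" "s \<le> r"
      show "X s w \<le> X r w"
      proof (rule ccontr)
        assume "\<not> X s w \<le> X r w"
        then have less: "X r w < X s w" by simp
        then have "s \<noteq> r" by auto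
        with sr have sr': "s < r" by simp
        obtain m where m: "X r w < m" "m < X s w" using dense[OF less] by blast
        have "\<forall>\<^sub>F u in at_right r. X u w < m"
          using X_right_cont[of r w] sr elim m by (auto dest: order_tendstoD)
        then obtain b where b: "r < b" "\<And>u. r < u \<Longrightarrow> u < b \<Longrightarrow> X u w < m"
          by (auto simp: eventually_at_right_field)
        have "\<forall>\<^sub>F u in at_right s. m < X u w"
          using X_right_cont[of s w] sr elim m by (auto dest: order_tendstoD)
        then obtain a where a: "s < a" "\<And>u. s < u \<Longrightarrow> u < a \<Longrightarrow> m < X u w"
          by (auto simp: eventually_at_right_field)
        obtain p where p: "s < real_of_rat p" "real_of_rat p < min a r"
          using of_rat_dense[of s "min a r"] a sr' by auto
        obtain q where q: "r < real_of_rat q" "real_of_rat q < b"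
          using of_rat_dense[of r b] b by auto
        have "real_of_rat 0 < real_of_rat p" unfolding of_rat_0 using p(1) sr(1) by linarith
        then have p0: "0 \<le> p" unfolding of_rat_less by simp
        have "real_of_rat p < real_of_rat q" using p q by simp
        then have pq: "p \<le> q" unfolding of_rat_less by simp
        have "X (real_of_rat p) w \<le> X (real_of_rat q) w" using elim p0 pq by blast
        with a(2)[of "real_of_rat p"] b(2)[of "real_of_rat q"] p q show False by auto
      qed
    qed
  qed
qed

text \<open>
  Right continuity makes \<open>X\<close> the limit of processes that are constant on time intervals
  of length \<open>1 / (n + 1)\<close>; the approximating times lie strictly to the right. The
  cut-off \<open>max 0\<close> keeps \<open>X\<close> away from negative times, at which nothing is
  known about it.
\<close>

lemma X_joint_measurable [measurable]:
  "(\<lambda>(s, w). X (max 0 s) w) \<in> borel_measurable (borel \<Otimes>\<^sub>M M)"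
proof (rule borel_measurable_LIMSEQ_real)
  define t where "t n s = (real (nat \<lfloor>max 0 s * real (Suc n)\<rfloor>) + 1) / real (Suc n)" for n and s :: real
  show "(\<lambda>(s, w). X (t n s) w) \<in> borel_measurable (borel \<Otimes>\<^sub>M M)" for n
  proof -
    have "(\<lambda>z. (\<lambda>i z. X ((real i + 1) / real (Suc n)) (snd z)) (nat \<lfloor>max 0 (fst z) * real (Suc n)\<rfloor>) z) \<in> borel_measurable (borel \<Otimes>\<^sub>M M)"
    proof (rule measurable_compose_countable[where f = "\<lambda>i z. X ((real i + 1) / real (Suc n)) (snd z)"
          and g = "\<lambda>z. nat \<lfloor>max 0 (fst z) * real (Suc n)\<rfloor>"])
      fix i :: nat
      have "0 \<le> (real i + 1) / real (Suc n)" by simp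
      from X_measurable[OF this]
      show "(\<lambda>z. X ((real i + 1) / real (Suc n)) (snd z)) \<in> borel_measurable (borel \<Otimes>\<^sub>M M)"
        by (rule measurable_compose[OF measurable_snd])
    qed measurable
    then show ?thesis by (simp add: t_def case_prod_beta')
  qed
  fix z :: "real \<times> 'w" assume z: "z \<in> space (borel \<Otimes>\<^sub>M M)"
  obtain s w where zsw: "z = (s, w)" by force
  have w: "w \<in> space M" using z by (auto simp: zsw space_pair_measure)
  define u where "u = max 0 s"
  have gt: "u < t n s" and le: "t n s \<le> u + 1 / real (Suc n)" for n
  proof -
    have f: "real (nat \<lfloor>u * real (Suc n)\<rfloor>) = of_int \<lfloor>u * real (Suc n)\<rfloor>" by (simp add: u_def)
    have "u * real (Suc n) < of_int \<lfloor>u * real (Suc n)\<rfloor> + 1" by linarith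
    then show "u < t n s" unfolding t_def u_def[symmetric] f by (simp add: pos_less_divide_eq del: of_nat_Suc)
    have "of_int \<lfloor>u * real (Suc n)\<rfloor> + 1 \<le> u * real (Suc n) + 1" by linarith
    then show "t n s \<le> u + 1 / real (Suc n)" unfolding t_def u_def[symmetric] f
      by (simp add: pos_divide_le_eq distrib_right del: of_nat_Suc)
  qed
  have "(\<lambda>n. t n s) \<longlonglongrightarrow> u"
  proof (rule tendsto_sandwich[OF _ _ tendsto_const])
    show "(\<lambda>n. u + 1 / real (Suc n)) \<longlonglongrightarrow> u"
      using tendsto_add[OF tendsto_const LIMSEQ_inverse_real_of_nat, of u] by (simp add: inverse_eq_divide)
    show "\<forall>\<^sub>F n in sequentially. u \<le> t n s" by (intro always_eventually allI less_imp_le gt)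
    show "\<forall>\<^sub>F n in sequentially. t n s \<le> u + 1 / real (Suc n)" by (intro always_eventually allI le)
  qed
  then have "filterlim (\<lambda>n. t n s) (at_right u) sequentially"
    unfolding filterlim_at using gt by (auto intro!: always_eventually simp: less_imp_neq[symmetric])
  moreover have "((\<lambda>u. X u w) \<longlongrightarrow> X u w) (at_right u)"
    using w by (intro X_right_cont) (auto simp: u_def)
  ultimately show "(\<lambda>n. (\<lambda>(s, w). X (t n s) w) z) \<longlonglongrightarrow> (\<lambda>(s, w). X (max 0 s) w) z"
    unfolding zsw prod.case u_def[symmetric] by (rule filterlim_compose[rotated])
qed

lemma X_joint_measurable' [measurable (raw)]:
  assumes [measurable]: "f \<in> borel_measurable N" "g \<in> N \<rightarrow>\<^sub>M M"
  shows "(\<lambda>x. X (max 0 (f x)) (g x)) \<in> borel_measurable N"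
  using measurable_compose[OF measurable_Pair[OF assms] X_joint_measurable] by simp

text \<open>
  Independence is given for the increments over \<open>[0, s]\<close> and \<open>[s, s + h]\<close>;
  the former is \<open>X\<^sub>s\<close> outside the null set on which the process does not start at
  \<open>0\<close>.
\<close>

lemma distr_increment_pair:
  assumes s: "0 \<le> s" and h: "0 \<le> h"
  shows "distr M borel (X s) \<Otimes>\<^sub>M distr M borel (X h) =
    distr M (borel \<Otimes>\<^sub>M borel) (\<lambda>w. (X s w, X (s + h) w - X s w))"
proof (rule pair_measure_eqI)
  have [measurable]: "X s \<in> borel_measurable M" "X (s + h) \<in> borel_measurable M" "X h \<in> borel_measurable M" "X 0 \<in> borel_measurable M"
    using s h by auto
  show "sigma_finite_measure (distr M borel (X s))" "sigma_finite_measure (distr M borel (X h))"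
    by (intro prob_space_imp_sigma_finite prob_space_distr; measurable)+
  show "sets (distr M borel (X s) \<Otimes>\<^sub>M distr M borel (X h)) =
      sets (distr M (borel \<Otimes>\<^sub>M borel) (\<lambda>w. (X s w, X (s + h) w - X s w)))"
    unfolding sets_distr by (intro sets_pair_measure_cong) auto
  define t where "t i = (if i = 0 then 0 else if i = 1 then s else s + h)" for i :: nat
  have "indep_vars (\<lambda>_. borel) (\<lambda>i w. X (t (Suc i)) w - X (t i) w) {..<2}"
  proof -
    have "0 \<le> t 0 \<and> (\<forall>i<2. t i \<le> t (Suc i))" using s h by (auto simp: t_def)
    then show ?thesis using levy unfolding levy_process_def by blast
  qed
  note ind = indep_varsD[OF this]
  fix A B :: "real set" assume "A \<in> sets (distr M borel (X s))" "B \<in> sets (distr M borel (X h))"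
  then have [measurable]: "A \<in> sets borel" "B \<in> sets borel" by auto
  define C where "C i = (if i = 0 then A else B)" for i :: nat
  have "prob (\<Inter>i\<in>{..<2}. (\<lambda>w. X (t (Suc i)) w - X (t i) w) -` C i \<inter> space M) =
      (\<Prod>i\<in>{..<2}. prob ((\<lambda>w. X (t (Suc i)) w - X (t i) w) -` C i \<inter> space M))"
    by (rule ind[where A = C]) (auto simp: C_def lessThan_empty_iff)
  then have "prob (((\<lambda>w. X (t 1) w - X (t 0) w) -` C 0 \<inter> space M) \<inter> ((\<lambda>w. X (t 2) w - X (t 1) w) -` C 1 \<inter> space M)) =
     prob ((\<lambda>w. X (t 1) w - X (t 0) w) -` C 0 \<inter> space M) * prob ((\<lambda>w. X (t 2) w - X (t 1) w) -` C 1 \<inter> space M)"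
    by (simp add: lessThan_Suc numeral_2_eq_2 Int_commute mult.commute)
  then have "prob (((\<lambda>w. X s w - X 0 w) -` A \<inter> space M) \<inter> ((\<lambda>w. X (s + h) w - X s w) -` B \<inter> space M)) =
     prob ((\<lambda>w. X s w - X 0 w) -` A \<inter> space M) * prob ((\<lambda>w. X (s + h) w - X s w) -` B \<inter> space M)"
    unfolding t_def C_def by simp
  moreover have "prob (((\<lambda>w. X s w - X 0 w) -` A \<inter> space M) \<inter> ((\<lambda>w. X (s + h) w - X s w) -` B \<inter> space M)) =
     prob ((X s -` A \<inter> space M) \<inter> ((\<lambda>w. X (s + h) w - X s w) -` B \<inter> space M))"
  proof (rule finite_measure_eq_AE)
    show "AE w in M. (w \<in> ((\<lambda>w. X s w - X 0 w) -` A \<inter> space M) \<inter> ((\<lambda>w. X (s + h) w - X s w) -` B \<inter> space M)) \<longleftrightarrow>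
        (w \<in> (X s -` A \<inter> space M) \<inter> ((\<lambda>w. X (s + h) w - X s w) -` B \<inter> space M))"
      using X_0 by eventually_elim simp
  qed measurable
  moreover have "prob ((\<lambda>w. X s w - X 0 w) -` A \<inter> space M) = prob (X s -` A \<inter> space M)"
  proof (rule finite_measure_eq_AE)
    show "AE w in M. (w \<in> (\<lambda>w. X s w - X 0 w) -` A \<inter> space M) \<longleftrightarrow> (w \<in> X s -` A \<inter> space M)"
      using X_0 by eventually_elim simp
  qed measurable
  moreover have "prob ((\<lambda>w. X (s + h) w - X s w) -` B \<inter> space M) = prob (X h -` B \<inter> space M)"
    using arg_cong[OF X_stationary[OF s h], of "\<lambda>N. measure N B"] by (simp add: measure_distr)
  ultimately have "prob ((X s -` A \<inter> space M) \<inter> ((\<lambda>w. X (s + h) w - X s w) -` B \<inter> space M)) =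
      prob (X s -` A \<inter> space M) * prob (X h -` B \<inter> space M)" by simp
  moreover have "(\<lambda>w. (X s w, X (s + h) w - X s w)) -` (A \<times> B) \<inter> space M =
      (X s -` A \<inter> space M) \<inter> ((\<lambda>w. X (s + h) w - X s w) -` B \<inter> space M)" by auto
  ultimately show "emeasure (distr M borel (X s)) A * emeasure (distr M borel (X h)) B =
      emeasure (distr M (borel \<Otimes>\<^sub>M borel) (\<lambda>w. (X s w, X (s + h) w - X s w))) (A \<times> B)"
    by (subst (1 2 3) emeasure_distr) (simp_all add: emeasure_eq_measure ennreal_mult[symmetric])
qed

text \<open>
  The mean occupation measure of the path over the time set \<open>[0, \<infinity>)\<close>.
\<close>

definition renewal_measure :: "real measure" where
  "renewal_measure =
     distr (density (lborel \<Otimes>\<^sub>M M) (\<lambda>(s, w). indicator {0..} s)) borel (\<lambda>(s, w). X (max 0 s) w)"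

lemma sets_renewal_measure [simp, measurable_cong]: "sets renewal_measure = sets borel"
  by (simp add: renewal_measure_def)

lemma nn_integral_renewal_measure:
  assumes [measurable]: "g \<in> borel_measurable borel"
  shows "(\<integral>\<^sup>+v. g v \<partial>renewal_measure) =
    (\<integral>\<^sup>+s. \<integral>\<^sup>+w. indicator {0..} s * g (X (max 0 s) w) \<partial>M \<partial>lborel)"
  unfolding renewal_measure_def
  by (simp add: nn_integral_distr nn_integral_density nn_integral_fst[symmetric] case_prod_beta')

lemma AE_renewal_measure_nonneg: "AE v in renewal_measure. 0 \<le> v"
  unfolding renewal_measure_def
  by (subst AE_distr_iff) (auto simp: case_prod_beta' space_pair_measure X_nonneg intro!: AE_I2)

lemma integrable_exp_X: "0 \<le> h \<Longrightarrow> 0 \<le> c \<Longrightarrow> integrable M (\<lambda>w. exp (- (c * X h w)))"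
  by (rule integrable_const_bound[of _ 1]) (auto simp: X_nonneg intro!: AE_I2)

lemma integrable_min_X: "0 \<le> h \<Longrightarrow> 0 \<le> y \<Longrightarrow> integrable M (\<lambda>w. min y (X h w))"
  by (rule integrable_const_bound[of _ y]) (auto simp: X_nonneg min_def intro!: AE_I2)

lemma \<Phi>_mono:
  assumes "0 < c" "c \<le> d"
  shows "\<Phi> c \<le> \<Phi> d"
proof -
  have "expectation (\<lambda>w. exp (- (d * X 1 w))) \<le> expectation (\<lambda>w. exp (- (c * X 1 w)))"
    by (intro integral_mono integrable_exp_X) (use assms X_nonneg[of 1] in \<open>auto intro!: mult_right_mono\<close>)
  then show ?thesis using assms by (simp add: laplace)
qed

lemma exp_convex_bound:
  assumes "1 \<le> k" "0 \<le> (x::real)"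
  shows "1 - exp (- (k * x)) \<le> k * (1 - exp (- x))"
proof -
  have "(\<lambda>y. k * (1 - exp (- y)) - (1 - exp (- (k * y)))) 0 \<le> (\<lambda>y. k * (1 - exp (- y)) - (1 - exp (- (k * y)))) x"
  proof (rule DERIV_nonneg_imp_nondecreasing[OF assms(2)])
    fix y :: real assume y: "0 \<le> y" "y \<le> x"
    have "exp (- (k * y)) \<le> exp (- y)" using assms y by (simp add: mult_le_cancel_right1)
    then show "\<exists>z. ((\<lambda>y. k * (1 - exp (- y)) - (1 - exp (- (k * y)))) has_real_derivative z) (at y) \<and> 0 \<le> z"
      using assms by (intro exI[of _ "k * (exp (- y) - exp (- (k * y)))"]) (auto intro!: derivative_eq_intros simp: algebra_simps)
  qed
  then show ?thesis by simp
qed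

lemma tendsto_exp_rate: "((\<lambda>h. (1 - exp (- (h * a))) / h) \<longlongrightarrow> a) (at_right 0)" for a :: real
proof -
  have "((\<lambda>h. - exp (- (h * a))) has_real_derivative a) (at 0 within {0<..})"
    by (auto intro!: derivative_eq_intros)
  then show ?thesis unfolding has_field_derivative_iff by simp
qed

text \<open>
  The exponent is a limit of expectations of \<open>(1 - exp (- c X\<^sub>h)) / h\<close>, and
  \<open>1 - exp (- c x)\<close> is concave in \<open>c\<close> and vanishes at \<open>0\<close>.
\<close>

lemma \<Phi>_scale:
  assumes c: "0 < c" and k: "1 \<le> k"
  shows "\<Phi> (k * c) \<le> k * \<Phi> c"
proof (rule tendsto_le)
  show "((\<lambda>h. k * ((1 - exp (- (h * \<Phi> c))) / h)) \<longlongrightarrow> k * \<Phi> c) (at_right 0)"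
    by (intro tendsto_intros tendsto_exp_rate)
  show "((\<lambda>h. (1 - exp (- (h * \<Phi> (k * c)))) / h) \<longlongrightarrow> \<Phi> (k * c)) (at_right 0)"
    by (rule tendsto_exp_rate)
  have "(1 - exp (- (h * \<Phi> (k * c)))) / h \<le> k * ((1 - exp (- (h * \<Phi> c))) / h)" if h: "0 < h" for h
  proof -
    note int = integrable_exp_X[OF less_imp_le[OF h]]
    have "expectation (\<lambda>w. 1 - exp (- (k * (c * X h w)))) \<le> expectation (\<lambda>w. k * (1 - exp (- (c * X h w))))"
      using c k h X_nonneg[of h] int[of c] int[of "k * c"]
      by (intro integral_mono exp_convex_bound) (auto simp: mult.assoc)
    also have "\<dots> = k * (1 - exp (- (h * \<Phi> c)))"
      using c h int[of c] laplace[of c h] by (simp add: prob_space mult.commute)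
    also have "expectation (\<lambda>w. 1 - exp (- (k * (c * X h w)))) = 1 - exp (- (h * \<Phi> (k * c)))"
      using c k h int[of "k * c"] laplace[of "k * c" h] by (simp add: prob_space mult_ac)
    finally show ?thesis using h by (simp add: divide_right_mono)
  qed
  then show "\<forall>\<^sub>F h in at_right 0. (1 - exp (- (h * \<Phi> (k * c)))) / h \<le> k * ((1 - exp (- (h * \<Phi> c))) / h)"
    by (auto simp: eventually_at_filter)
qed simp

lemma \<Phi>_pos:
  assumes "0 < c"
  shows "0 < \<Phi> c"
proof -
  obtain d where d: "0 < d" "0 < \<Phi> d" using nonzero \<Phi>_nonneg by force
  show ?thesis
  proof (cases "d \<le> c")
    case True
    then show ?thesis using \<Phi>_mono[of d c] d by simp
  next
    case False
    then have "\<Phi> ((d / c) * c) \<le> (d / c) * \<Phi> c" using assms by (intro \<Phi>_scale) (auto simp: field_simps)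
    then have "0 < (d / c) * \<Phi> c" using d assms by simp
    moreover have "0 < d / c" using d assms by simp
    ultimately show ?thesis by (rule zero_less_mult_pos)
  qed
qed

lemma nn_laplace:
  assumes "0 < c" "0 < s"
  shows "(\<integral>\<^sup>+w. ennreal (exp (- (c * X s w))) \<partial>M) = ennreal (exp (- \<Phi> c * s))"
proof -
  have "integrable M (\<lambda>w. exp (- (c * X s w)))" using assms by (intro integrable_exp_X) auto
  then show ?thesis using laplace[OF assms] by (simp add: nn_integral_eq_integral)
qed

lemma renewal_measure_laplace:
  assumes c: "0 < c"
  shows "has_bochner_integral renewal_measure (\<lambda>v. exp (- (c * v))) (1 / \<Phi> c)"
proof (rule has_bochner_integral_nn_integral)
  have "(\<integral>\<^sup>+v. ennreal (exp (- (c * v))) \<partial>renewal_measure) =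
      (\<integral>\<^sup>+s. \<integral>\<^sup>+w. indicator {0..} s * ennreal (exp (- (c * X (max 0 s) w))) \<partial>M \<partial>lborel)"
    by (subst nn_integral_renewal_measure) auto
  also have "\<dots> = (\<integral>\<^sup>+s. ennreal (exp (- \<Phi> c * s)) * indicator {0..} s \<partial>lborel)"
  proof (rule nn_integral_cong_AE)
    have "AE s in lborel. s \<noteq> (0::real)" by (rule AE_lborel_singleton)
    then show "AE s in lborel. (\<integral>\<^sup>+w. indicator {0..} s * ennreal (exp (- (c * X (max 0 s) w))) \<partial>M) = ennreal (exp (- \<Phi> c * s)) * indicator {0..} s"
    proof eventually_elim
      case (elim s)
      then show ?case using nn_laplace[OF c, of s]
        by (cases "0 \<le> s") (simp_all add: max_def)
    qed
  qed
  also have "\<dots> = ennreal (1 / \<Phi> c)"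
    using nn_integral_has_integral_lebesgue'[OF _ has_integral_exp_minus_to_infinity[OF \<Phi>_pos[OF c], of 0]]
    by simp
  finally show "(\<integral>\<^sup>+v. ennreal (exp (- (c * v))) \<partial>renewal_measure) = ennreal (1 / \<Phi> c)" .
qed (use \<Phi>_pos[OF c] in auto)

lemma emeasure_renewal_measure_finite: "emeasure renewal_measure {..x} < \<infinity>"
proof -
  have "integrable renewal_measure (\<lambda>v. indicator {..x} v :: real)"
  proof (rule Bochner_Integration.integrable_bound)
    show "integrable renewal_measure (\<lambda>v. exp x * exp (- (1 * v)))"
      using renewal_measure_laplace[of 1] by (auto simp: has_bochner_integral_iff)
    show "AE v in renewal_measure. norm (indicator {..x} v :: real) \<le> norm (exp x * exp (- (1 * v)))"
      by (auto simp: indicator_def exp_add[symmetric])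
  qed simp
  then show ?thesis by (subst (asm) integrable_indicator_iff) auto
qed

section \<open>Times shortly before the passage of a level\<close>

text \<open>
  Divided by \<open>h\<close>, this approximates the probability that the path is in
  \<open>B\<close> just before it passes the level \<open>t\<close>.
\<close>

definition crossing_time :: "real \<Rightarrow> real \<Rightarrow> real set \<Rightarrow> ennreal" where
  "crossing_time h t B = (\<integral>\<^sup>+w. \<integral>\<^sup>+s. indicator {s. 0 \<le> s \<and> X (max 0 s) w \<in> B \<and> X (max 0 s) w \<le> t \<and> t < X (max 0 (s + h)) w} s \<partial>lborel \<partial>M)"

text \<open>
  Given \<open>X\<^sub>s = x\<close>, the condition \<open>t < X\<^sub>s\<^sub>+\<^sub>h\<close>
  means that an independent copy of \<open>X\<^sub>h\<close> exceeds \<open>t - x\<close>.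
  Interchanging the integrals over the time and over this copy leaves the renewal measure of the
  admissible positions.
\<close>

lemma crossing_time_eq:
  assumes h: "0 \<le> h" and [measurable]: "B \<in> sets borel"
  shows "crossing_time h t B = (\<integral>\<^sup>+w. emeasure renewal_measure (B \<inter> {t - X h w<..t}) \<partial>M)"
proof -
  have [measurable]: "X h \<in> borel_measurable M" using h by simp
  interpret pair_sigma_finite lborel M ..
  interpret D: prob_space "distr M borel (X h)" by (rule prob_space_distr) simp
  interpret LD: pair_sigma_finite lborel "distr M borel (X h)" ..
  let ?G = "\<lambda>s w. indicator {s. 0 \<le> s \<and> X (max 0 s) w \<in> B \<and> X (max 0 s) w \<le> t \<and> t < X (max 0 (s + h)) w} s :: ennreal"
  let ?H = "\<lambda>s z. \<integral>\<^sup>+w. indicator {0..} s * (indicator B (X (max 0 s) w) *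
      (if t - z < X (max 0 s) w \<and> X (max 0 s) w \<le> t then 1 else 0)) \<partial>M"
  have H: "(\<integral>\<^sup>+s. ?H s z \<partial>lborel) = emeasure renewal_measure (B \<inter> {t - z<..t})" for z
  proof -
    have "(\<integral>\<^sup>+s. ?H s z \<partial>lborel) = (\<integral>\<^sup>+v. indicator B v * (if t - z < v \<and> v \<le> t then 1 else 0) \<partial>renewal_measure)"
      by (rule nn_integral_renewal_measure[symmetric]) measurable
    also have "\<dots> = (\<integral>\<^sup>+v. indicator (B \<inter> {t - z<..t}) v \<partial>renewal_measure)"
      by (intro nn_integral_cong) (auto simp: indicator_def)
    finally show ?thesis by simp
  qed
  have "crossing_time h t B = (\<integral>\<^sup>+s. \<integral>\<^sup>+w. ?G s w \<partial>M \<partial>lborel)"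
    unfolding crossing_time_def by (rule Fubini') measurable
  also have "\<dots> = (\<integral>\<^sup>+s. \<integral>\<^sup>+z. ?H s z \<partial>distr M borel (X h) \<partial>lborel)"
  proof (intro nn_integral_cong)
    fix s :: real
    show "(\<integral>\<^sup>+w. ?G s w \<partial>M) = (\<integral>\<^sup>+z. ?H s z \<partial>distr M borel (X h))"
    proof (cases "0 \<le> s")
      case True
      have [measurable]: "X s \<in> borel_measurable M" "X (s + h) \<in> borel_measurable M" using True h by auto
      interpret E: prob_space "distr M borel (X s)" by (rule prob_space_distr) simp
      interpret ED: pair_sigma_finite "distr M borel (X s)" "distr M borel (X h)" ..
      let ?S = "{p :: real \<times> real. fst p \<in> B \<and> fst p \<le> t \<and> t < fst p + snd p}"
      have [measurable]: "?S \<in> sets (borel \<Otimes>\<^sub>M borel)"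
      proof -
        have "{p \<in> space (borel \<Otimes>\<^sub>M borel). fst p \<in> B \<and> fst p \<le> t \<and> t < fst p + snd p} \<in> sets (borel \<Otimes>\<^sub>M borel)"
          by measurable
        then show ?thesis by (simp add: space_pair_measure)
      qed
      have "(\<integral>\<^sup>+w. ?G s w \<partial>M) = (\<integral>\<^sup>+w. indicator ?S (X s w, X (s + h) w - X s w) \<partial>M)"
        using True h by (intro nn_integral_cong) (auto simp: indicator_def max_def)
      also have "\<dots> = (\<integral>\<^sup>+p. indicator ?S p \<partial>(distr M borel (X s) \<Otimes>\<^sub>M distr M borel (X h)))"
        unfolding distr_increment_pair[OF True h] by (subst nn_integral_distr) auto
      also have "\<dots> = (\<integral>\<^sup>+z. \<integral>\<^sup>+x. indicator ?S (x, z) \<partial>distr M borel (X s) \<partial>distr M borel (X h))"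
        by (subst ED.nn_integral_snd[symmetric]) auto
      also have "\<dots> = (\<integral>\<^sup>+z. ?H s z \<partial>distr M borel (X h))"
        using True by (intro nn_integral_cong) (subst nn_integral_distr, auto simp: max_def indicator_def intro!: nn_integral_cong)
      finally show ?thesis .
    qed simp
  qed
  also have "\<dots> = (\<integral>\<^sup>+z. \<integral>\<^sup>+s. ?H s z \<partial>lborel \<partial>distr M borel (X h))"
    by (rule LD.Fubini'[symmetric]) measurable
  also have "\<dots> = (\<integral>\<^sup>+z. emeasure renewal_measure (B \<inter> {t - z<..t}) \<partial>distr M borel (X h))"
    unfolding H ..
  also have "\<dots> = (\<integral>\<^sup>+w. emeasure renewal_measure (B \<inter> {t - X h w<..t}) \<partial>M)"
  proof -
    have "(\<lambda>z. emeasure renewal_measure (B \<inter> {t - z<..t})) \<in> borel_measurable borel"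
      unfolding H[symmetric] by measurable
    then show ?thesis by (subst nn_integral_distr) auto
  qed
  finally show ?thesis .
qed

definition tail_rate :: "real \<Rightarrow> real \<Rightarrow> real" where
  "tail_rate h x = prob {w \<in> space M. x < X h w} / h"

definition truncated_mean_rate :: "real \<Rightarrow> real \<Rightarrow> real" where
  "truncated_mean_rate h y = expectation (\<lambda>w. min y (X h w)) / h"

lemma measure_renewal: "A \<subseteq> {..x} \<Longrightarrow> A \<in> sets borel \<Longrightarrow> emeasure renewal_measure A = ennreal (measure renewal_measure A)"
  using emeasure_renewal_measure_finite[of x] emeasure_mono[of A "{..x}" renewal_measure]
  by (intro emeasure_eq_ennreal_measure) (auto simp: top_unique)

abbreviation U :: "real \<Rightarrow> real" where
  "U x \<equiv> measure renewal_measure {..x}"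

text \<open>
  If \<open>x \<le> y\<close>, then an increment above \<open>t\<close> suffices to pass the level
  from \<open>x\<close>, and one above \<open>t - y\<close> is necessary.
\<close>

lemma crossing_time_below:
  assumes h: "0 < h" and y: "0 \<le> y" "y < t"
  shows "ennreal (h * (U y * tail_rate h t)) \<le> crossing_time h t {..y}"
    and "crossing_time h t {..y} \<le> ennreal (h * (U y * tail_rate h (t - y)))"
proof -
  have [measurable]: "X h \<in> borel_measurable M" using h by simp
  let ?u = "U y"
  have U: "emeasure renewal_measure {..y} = ennreal ?u" by (rule measure_renewal[of _ y]) auto
  have e: "ennreal (h * (?u * tail_rate h x)) = (\<integral>\<^sup>+w. ennreal ?u * indicator {w \<in> space M. x < X h w} w \<partial>M)" for x
    using h by (simp add: tail_rate_def nn_integral_cmult emeasure_eq_measure ennreal_mult[symmetric])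
  have ct: "crossing_time h t {..y} = (\<integral>\<^sup>+w. emeasure renewal_measure ({..y} \<inter> {t - X h w<..t}) \<partial>M)"
    using h by (intro crossing_time_eq) auto
  show "ennreal (h * (?u * tail_rate h t)) \<le> crossing_time h t {..y}"
    unfolding e ct
  proof (intro nn_integral_mono)
    fix w
    show "ennreal ?u * indicator {w \<in> space M. t < X h w} w \<le> emeasure renewal_measure ({..y} \<inter> {t - X h w<..t})"
    proof (cases "t < X h w")
      case True
      have "emeasure renewal_measure {..y} \<le> emeasure renewal_measure ({..y} \<inter> {t - X h w<..t})"
        using AE_renewal_measure_nonneg True y by (intro emeasure_mono_AE) auto
      then show ?thesis using True by (auto simp: U indicator_def)
    qed simp
  qed
  show "crossing_time h t {..y} \<le> ennreal (h * (?u * tail_rate h (t - y)))"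
    unfolding e ct
  proof (intro nn_integral_mono)
    fix w assume w: "w \<in> space M"
    show "emeasure renewal_measure ({..y} \<inter> {t - X h w<..t}) \<le> ennreal ?u * indicator {w \<in> space M. t - y < X h w} w"
    proof (cases "t - y < X h w")
      case True
      have "emeasure renewal_measure ({..y} \<inter> {t - X h w<..t}) \<le> emeasure renewal_measure {..y}"
        by (intro emeasure_mono) auto
      then show ?thesis using True w by (simp add: U)
    next
      case False
      then have "{..y} \<inter> {t - X h w<..t} = {}" by auto
      then show ?thesis by simp
    qed
  qed
qed

text \<open>
  An increment \<open>z\<close> passes the level from exactly the positions in
  \<open>(t - min y z, t]\<close> within \<open>(t - y, t]\<close>. Linear bounds for the renewal
  measure of such intervals therefore bound the mean length by multiples of the mean of
  \<open>min y X\<^sub>h\<close>.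
\<close>

lemma crossing_time_near:
  assumes h: "0 < h" and y: "0 < y"
  shows crossing_time_near_ge:
    "0 \<le> K \<Longrightarrow> (\<And>a. t - y \<le> a \<Longrightarrow> a < t \<Longrightarrow> K * (t - a) \<le> measure renewal_measure {a<..t}) \<Longrightarrow>
       ennreal (h * (K * truncated_mean_rate h y)) \<le> crossing_time h t {t - y<..t}"
    and crossing_time_near_le:
    "0 \<le> K \<Longrightarrow> (\<And>a. t - y \<le> a \<Longrightarrow> a < t \<Longrightarrow> measure renewal_measure {a<..t} \<le> K * (t - a)) \<Longrightarrow>
       crossing_time h t {t - y<..t} \<le> ennreal (h * (K * truncated_mean_rate h y))"
proof -
  have [measurable]: "X h \<in> borel_measurable M" using h by simp
  have int: "integrable M (\<lambda>w. min y (X h w))" using h y by (intro integrable_min_X) auto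
  have e: "ennreal (h * (K * truncated_mean_rate h y)) = (\<integral>\<^sup>+w. ennreal (K * min y (X h w)) \<partial>M)" if "0 \<le> K" for K
  proof -
    have "(\<integral>\<^sup>+w. ennreal (K * min y (X h w)) \<partial>M) = ennreal (expectation (\<lambda>w. K * min y (X h w)))"
      using int that y h X_nonneg[of h] by (intro nn_integral_eq_integral) (auto intro!: AE_I2)
    then show ?thesis using h by (simp add: truncated_mean_rate_def)
  qed
  have mm: "max (t - y) (t - z) = t - min y z" for z by (simp add: max_def min_def)
  have "crossing_time h t {t - y<..t} = (\<integral>\<^sup>+w. emeasure renewal_measure ({t - y<..t} \<inter> {t - X h w<..t}) \<partial>M)"
    using h by (intro crossing_time_eq) auto
  also have "\<dots> = (\<integral>\<^sup>+w. ennreal (measure renewal_measure {t - min y (X h w)<..t}) \<partial>M)"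
    by (intro nn_integral_cong) (subst measure_renewal[of _ t], auto simp: mm)
  finally have ct: "crossing_time h t {t - y<..t} = (\<integral>\<^sup>+w. ennreal (measure renewal_measure {t - min y (X h w)<..t}) \<partial>M)" .
  show "ennreal (h * (K * truncated_mean_rate h y)) \<le> crossing_time h t {t - y<..t}"
    if K: "0 \<le> K" "\<And>a. t - y \<le> a \<Longrightarrow> a < t \<Longrightarrow> K * (t - a) \<le> measure renewal_measure {a<..t}"
    unfolding e[OF K(1)] ct
  proof (intro nn_integral_mono ennreal_leI)
    fix w assume w: "w \<in> space M"
    show "K * min y (X h w) \<le> measure renewal_measure {t - min y (X h w)<..t}"
      using K(2)[of "t - min y (X h w)"] y X_nonneg[OF less_imp_le[OF h] w]
      by (cases "X h w = 0") auto
  qed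
  show "crossing_time h t {t - y<..t} \<le> ennreal (h * (K * truncated_mean_rate h y))"
    if K: "0 \<le> K" "\<And>a. t - y \<le> a \<Longrightarrow> a < t \<Longrightarrow> measure renewal_measure {a<..t} \<le> K * (t - a)"
    unfolding e[OF K(1)] ct
  proof (intro nn_integral_mono ennreal_leI)
    fix w assume w: "w \<in> space M"
    show "measure renewal_measure {t - min y (X h w)<..t} \<le> K * min y (X h w)"
      using K(2)[of "t - min y (X h w)"] y X_nonneg[OF less_imp_le[OF h] w]
      by (cases "X h w = 0") auto
  qed
qed

end

section \<open>The measure with density the tail rate\<close>

context subordinator
begin

text \<open>
  Its distribution function is the truncated mean rate, and its Laplace transform involves only the
  exponent. So it plays for \<open>X\<^sub>h\<close> the role that the renewal measure plays for the
  process.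
\<close>

definition tail_measure :: "real \<Rightarrow> real measure" where
  "tail_measure h = density lborel (\<lambda>v. ennreal (indicator {0..} v * tail_rate h v))"

lemma sets_tail_measure [simp, measurable_cong]: "sets (tail_measure h) = sets borel"
  by (simp add: tail_measure_def)

lemma tail_rate_nonneg: "0 < h \<Longrightarrow> 0 \<le> tail_rate h x"
  by (simp add: tail_rate_def)

lemma tail_rate_antimono: "0 < h \<Longrightarrow> x \<le> y \<Longrightarrow> tail_rate h y \<le> tail_rate h x"
  unfolding tail_rate_def by (intro divide_right_mono finite_measure_mono) auto

lemma tail_rate_measurable [measurable]: "0 < h \<Longrightarrow> tail_rate h \<in> borel_measurable borel"
proof -
  assume h: "0 < h"
  have "mono (\<lambda>x. - tail_rate h x)" using tail_rate_antimono[OF h] by (intro monoI) simp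
  from borel_measurable_mono[OF this] have "(\<lambda>x. - (- tail_rate h x)) \<in> borel_measurable borel"
    by (rule borel_measurable_uminus)
  then show ?thesis by simp
qed

lemma AE_tail_measure_nonneg: "0 < h \<Longrightarrow> AE v in tail_measure h. 0 \<le> v"
  unfolding tail_measure_def by (subst AE_density) (auto simp: indicator_def)

lemma nn_integral_tail_measure:
  assumes h: "0 < h" and [measurable]: "g \<in> borel_measurable borel"
  shows "(\<integral>\<^sup>+v. g v \<partial>tail_measure h) = ennreal (1 / h) * (\<integral>\<^sup>+w. \<integral>\<^sup>+v. g v * indicator {0..<X h w} v \<partial>lborel \<partial>M)"
proof -
  interpret pair_sigma_finite lborel M ..
  have [measurable]: "X h \<in> borel_measurable M" using h by simp
  have *: "(\<lambda>w. \<integral>\<^sup>+v. (if 0 \<le> v \<and> v < X h w then g v else 0) \<partial>lborel) \<in> borel_measurable M" by measurable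
  have ind: "g v * indicator {0..<X h w} v = (if 0 \<le> v \<and> v < X h w then g v else 0)" for v w
    by (auto simp: indicator_def)
  have "(\<integral>\<^sup>+v. g v \<partial>tail_measure h) = (\<integral>\<^sup>+v. ennreal (indicator {0..} v * tail_rate h v) * g v \<partial>lborel)"
    unfolding tail_measure_def using h by (subst nn_integral_density) auto
  also have "\<dots> = (\<integral>\<^sup>+v. \<integral>\<^sup>+w. ennreal (1 / h) * (if 0 \<le> v \<and> v < X h w then g v else 0) \<partial>M \<partial>lborel)"
  proof (intro nn_integral_cong)
    fix v :: real
    have "(\<integral>\<^sup>+w. ennreal (1 / h) * (if 0 \<le> v \<and> v < X h w then g v else 0) \<partial>M) =
      (\<integral>\<^sup>+w. (ennreal (1 / h) * indicator {0..} v * g v) * indicator {w \<in> space M. v < X h w} w \<partial>M)"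
      by (intro nn_integral_cong) (auto simp: indicator_def)
    also have "\<dots> = (ennreal (1 / h) * indicator {0..} v * g v) * ennreal (prob {w \<in> space M. v < X h w})"
      by (subst nn_integral_cmult_indicator) (auto simp: emeasure_eq_measure)
    also have "\<dots> = ennreal (indicator {0..} v * tail_rate h v) * g v"
      using h unfolding tail_rate_def
      by (simp add: indicator_def ennreal_mult'[symmetric] mult_ac split: if_splits)
    finally show "ennreal (indicator {0..} v * tail_rate h v) * g v =
       (\<integral>\<^sup>+w. ennreal (1 / h) * (if 0 \<le> v \<and> v < X h w then g v else 0) \<partial>M)" by simp
  qed
  also have "\<dots> = (\<integral>\<^sup>+w. \<integral>\<^sup>+v. ennreal (1 / h) * (if 0 \<le> v \<and> v < X h w then g v else 0) \<partial>lborel \<partial>M)"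
    by (rule Fubini'[symmetric]) measurable
  also have "\<dots> = ennreal (1 / h) * (\<integral>\<^sup>+w. \<integral>\<^sup>+v. (if 0 \<le> v \<and> v < X h w then g v else 0) \<partial>lborel \<partial>M)"
    using * by (simp add: nn_integral_cmult)
  finally show ?thesis by (simp add: ind)
qed

definition \<Phi>_rate :: "real \<Rightarrow> real \<Rightarrow> real" where
  "\<Phi>_rate h c = (1 - exp (- (h * \<Phi> c))) / h"

lemma tail_measure_laplace:
  assumes h: "0 < h" and c: "0 < c"
  shows "has_bochner_integral (tail_measure h) (\<lambda>v. exp (- (c * v))) (\<Phi>_rate h c / c)"
proof (rule has_bochner_integral_nn_integral)
  have [measurable]: "X h \<in> borel_measurable M" using h by simp
  have int: "integrable M (\<lambda>w. exp (- (c * X h w)))" using h c by (intro integrable_exp_X) auto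
  have "(\<integral>\<^sup>+w. \<integral>\<^sup>+v. ennreal (exp (- (c * v))) * indicator {0..<X h w} v \<partial>lborel \<partial>M) =
      (\<integral>\<^sup>+w. ennreal ((1 - exp (- (c * X h w))) / c) \<partial>M)"
  proof (intro nn_integral_cong)
    fix w assume w: "w \<in> space M"
    have x: "0 \<le> X h w" using h w by (intro X_nonneg) auto
    have "(\<integral>\<^sup>+v. ennreal (exp (- (c * v))) * indicator {0..<X h w} v \<partial>lborel) =
       (\<integral>\<^sup>+v. ennreal (exp (- (c * v))) * indicator {0..X h w} v \<partial>lborel)"
      using AE_lborel_singleton[of "X h w"] by (intro nn_integral_cong_AE) (auto simp: indicator_def)
    also have "\<dots> = ennreal ((\<lambda>v. - exp (- (c * v)) / c) (X h w) - (\<lambda>v. - exp (- (c * v)) / c) 0)"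
      using c x by (intro nn_integral_FTC_Icc) (auto intro!: derivative_eq_intros)
    also have "\<dots> = ennreal ((1 - exp (- (c * X h w))) / c)" by (simp add: diff_divide_distrib)
    finally show "(\<integral>\<^sup>+v. ennreal (exp (- (c * v))) * indicator {0..<X h w} v \<partial>lborel) = ennreal ((1 - exp (- (c * X h w))) / c)" .
  qed
  also have "\<dots> = ennreal (expectation (\<lambda>w. (1 - exp (- (c * X h w))) / c))"
    using int c h X_nonneg[of h] by (intro nn_integral_eq_integral) (auto intro!: AE_I2)
  also have "expectation (\<lambda>w. (1 - exp (- (c * X h w))) / c) = (1 - exp (- (h * \<Phi> c))) / c"
    using int laplace[OF c h] by (simp add: prob_space mult.commute)
  finally show "(\<integral>\<^sup>+v. ennreal (exp (- (c * v))) \<partial>tail_measure h) = ennreal (\<Phi>_rate h c / c)"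
    using h c \<Phi>_nonneg[OF c] by (subst nn_integral_tail_measure) (auto simp: \<Phi>_rate_def ennreal_mult[symmetric])
qed (use h c \<Phi>_nonneg[OF c] in \<open>auto simp: \<Phi>_rate_def\<close>)

lemma measure_tail_measure:
  assumes h: "0 < h" and y: "0 \<le> y"
  shows "measure (tail_measure h) {..y} = truncated_mean_rate h y"
proof -
  have [measurable]: "X h \<in> borel_measurable M" using h by simp
  have "(\<integral>\<^sup>+w. \<integral>\<^sup>+v. indicator {..y} v * indicator {0..<X h w} v \<partial>lborel \<partial>M) =
      (\<integral>\<^sup>+w. ennreal (min y (X h w)) \<partial>M)"
  proof (intro nn_integral_cong)
    fix w assume w: "w \<in> space M"
    have x: "0 \<le> X h w" using h w by (intro X_nonneg) auto
    have "(\<integral>\<^sup>+v. indicator {..y} v * indicator {0..<X h w} v \<partial>lborel) = (\<integral>\<^sup>+v. indicator {0..min y (X h w)} v \<partial>lborel)"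
      using AE_lborel_singleton[of "X h w"] by (intro nn_integral_cong_AE) (auto simp: indicator_def min_def elim!: eventually_mono)
    then show "(\<integral>\<^sup>+v. indicator {..y} v * indicator {0..<X h w} v \<partial>lborel) = ennreal (min y (X h w))"
      using x y by simp
  qed
  also have "\<dots> = ennreal (expectation (\<lambda>w. min y (X h w)))"
  proof (rule nn_integral_eq_integral)
    show "integrable M (\<lambda>w. min y (X h w))" using h y by (intro integrable_min_X) auto
  qed (use y h X_nonneg[of h] in \<open>auto intro!: AE_I2\<close>)
  finally have "emeasure (tail_measure h) {..y} = ennreal (truncated_mean_rate h y)"
    using nn_integral_tail_measure[OF h, of "indicator {..y}"] h
    by (simp add: truncated_mean_rate_def ennreal_mult'[symmetric])
  moreover have "0 \<le> truncated_mean_rate h y"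
    unfolding truncated_mean_rate_def using y h X_nonneg[of h] by (intro divide_nonneg_pos integral_nonneg_AE) (auto intro!: AE_I2)
  ultimately show ?thesis by (simp add: measure_def)
qed

section \<open>First passage and undershoot along a path\<close>

text \<open>
  Almost all paths have these properties, and for them first passage times are finite and positive.
\<close>

definition regular_path :: "'w \<Rightarrow> bool" where
  "regular_path w \<longleftrightarrow> w \<in> space M \<and> X 0 w = 0 \<and> (\<forall>s r. 0 \<le> s \<longrightarrow> s \<le> r \<longrightarrow> X s w \<le> X r w) \<and>
     (\<forall>t. \<exists>s\<ge>0. t < X s w)"

text \<open>
  By the exponential Markov inequality, the probability that \<open>X\<close> is at most
  \<open>x\<close> at time \<open>m\<close> decays geometrically in \<open>m\<close>.
\<close>

lemma prob_bounded_path: "prob {w \<in> space M. \<forall>n::nat. X (real n) w \<le> x} = 0"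
proof -
  have [measurable]: "X (real n) \<in> borel_measurable M" for n by simp
  have le: "prob {w \<in> space M. \<forall>n::nat. X (real n) w \<le> x} \<le> exp x * exp (- \<Phi> 1) ^ m" if m: "0 < m" for m :: nat
  proof -
    have int: "integrable M (\<lambda>w. exp (- (1 * X (real m) w)))" by (intro integrable_exp_X) auto
    have ind: "integrable M (indicator {w \<in> space M. \<forall>n::nat. X (real n) w \<le> x} :: 'w \<Rightarrow> real)"
      by (rule integrable_const_bound[of _ 1]) (auto simp: indicator_def)
    have "prob {w \<in> space M. \<forall>n::nat. X (real n) w \<le> x} = expectation (indicator {w \<in> space M. \<forall>n::nat. X (real n) w \<le> x})"
      by simp
    also have "\<dots> \<le> expectation (\<lambda>w. exp x * exp (- (1 * X (real m) w)))"
      using int ind by (intro integral_mono integrable_mult_right) (auto simp: indicator_def exp_add[symmetric])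
    also have "\<dots> = exp x * exp (- \<Phi> 1) ^ m"
      using laplace[of 1 "real m"] m by (simp add: exp_of_nat_mult[symmetric] mult.commute)
    finally show ?thesis .
  qed
  have "(\<lambda>m. exp x * exp (- \<Phi> 1) ^ m) \<longlonglongrightarrow> exp x * 0"
    using \<Phi>_pos[of 1] by (intro tendsto_mult tendsto_const LIMSEQ_power_zero) auto
  then have "prob {w \<in> space M. \<forall>n::nat. X (real n) w \<le> x} \<le> exp x * 0"
    by (rule LIMSEQ_le_const) (use le in \<open>auto intro!: exI[of _ 1]\<close>)
  then show ?thesis by (simp add: measure_le_0_iff)
qed

lemma AE_regular_path: "AE w in M. regular_path w"
proof -
  have [measurable]: "X (real n) \<in> borel_measurable M" for n by simp
  have "AE w in M. \<forall>k::nat. \<exists>n::nat. real k < X (real n) w"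
    unfolding AE_all_countable
  proof
    fix k :: nat
    have "AE w in M. w \<notin> {w \<in> space M. \<forall>n::nat. X (real n) w \<le> real k}"
      using prob_bounded_path[of "real k"] by (intro AE_not_in null_setsI) (auto simp: emeasure_eq_measure)
    with AE_space show "AE w in M. \<exists>n::nat. real k < X (real n) w"
      by eventually_elim (auto simp: not_le)
  qed
  with AE_space X_0 AE_mono show ?thesis
  proof eventually_elim
    case (elim w)
    have "\<exists>s\<ge>0. t < X s w" for t
    proof -
      obtain k :: nat where "t < real k" using reals_Archimedean2 by blast
      then show ?thesis using elim(4) by (meson less_trans of_nat_0_le_iff)
    qed
    then show ?case using elim unfolding regular_path_def by blast
  qed
qed

lemma regular_path_passage:
  assumes w: "regular_path w" and t: "0 < t" and \<tau>: "\<And>s. 0 \<le> s \<Longrightarrow> \<tau> s w = ereal (X s w)"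
  shows "\<exists>T>0. first_passage \<tau> t w = ereal T \<and> (\<forall>s. 0 \<le> s \<longrightarrow> s < T \<longrightarrow> X s w \<le> t) \<and> (\<forall>s>T. t < X s w)"
proof -
  define A where "A = {s. 0 \<le> s \<and> t < X s w}"
  define T where "T = Inf A"
  have ne: "A \<noteq> {}" and bdd: "bdd_below A" using w by (auto simp: A_def regular_path_def)
  have "\<forall>\<^sub>F u in at_right 0. X u w < t"
    using X_right_cont[of 0 w] w t by (auto simp: regular_path_def dest: order_tendstoD)
  then obtain b where b: "0 < b" "\<And>u. 0 < u \<Longrightarrow> u < b \<Longrightarrow> X u w < t"
    by (auto simp: eventually_at_right_field)
  have "b \<le> a" if "a \<in> A" for a
  proof (rule ccontr)
    assume "\<not> b \<le> a"
    then have "X a w < t \<or> a = 0" using that b(2)[of a] by (cases "a = 0") (auto simp: A_def)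
    then show False using that w t by (auto simp: A_def regular_path_def)
  qed
  then have "b \<le> T" unfolding T_def using ne by (intro cInf_greatest) auto
  then have T0: "0 < T" using b by simp
  have below: "X s w \<le> t" if "0 \<le> s" "s < T" for s
  proof (rule ccontr)
    assume "\<not> X s w \<le> t"
    then have "s \<in> A" using that by (simp add: A_def)
    then have "T \<le> s" unfolding T_def by (rule cInf_lower[OF _ bdd])
    then show False using that by simp
  qed
  have above: "t < X s w" if s: "T < s" for s
  proof -
    obtain a where a: "a \<in> A" "a < s" using cInf_lessD[OF ne] s by (auto simp: T_def)
    have "X a w \<le> X s w" using w a by (auto simp: regular_path_def A_def)
    then show ?thesis using a by (simp add: A_def)
  qed
  have "first_passage \<tau> t w = ereal T"
    unfolding first_passage_def
  proof (rule Inf_eqI)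
    fix i assume "i \<in> {ereal s |s. 0 \<le> s \<and> ereal t < \<tau> s w}"
    then obtain s where s: "i = ereal s" "s \<in> A" using \<tau> by (auto simp: A_def)
    then show "ereal T \<le> i" using cInf_lower[OF s(2) bdd] by (simp add: T_def)
  next
    fix y assume "\<And>i. i \<in> {ereal s |s. 0 \<le> s \<and> ereal t < \<tau> s w} \<Longrightarrow> y \<le> i"
    then have y: "y \<le> ereal s" if "s \<in> A" for s using that \<tau> by (auto simp: A_def)
    show "y \<le> ereal T"
    proof (cases y)
      case (real r)
      then show ?thesis using y ne unfolding T_def by (auto intro!: cInf_greatest)
    next
      case PInf
      then show ?thesis using y ne by auto
    qed simp
  qed
  with T0 below above show ?thesis by blast
qed

text \<open>
  The undershoot is the left limit at \<open>T\<close>; by monotonicity it is also the least upper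
  bound of the path before \<open>T\<close>.
\<close>

lemma regular_path_undershoot:
  assumes w: "regular_path w" and t: "0 < t" and \<tau>: "\<And>s. 0 \<le> s \<Longrightarrow> \<tau> s w = ereal (X s w)"
  obtains T g where "0 < T" "\<And>s. 0 \<le> s \<Longrightarrow> s < T \<Longrightarrow> X s w \<le> t" "\<And>s. T < s \<Longrightarrow> t < X s w"
    "undershoot \<tau> t w = ereal g" "g \<le> t" "\<And>s. 0 \<le> s \<Longrightarrow> s < T \<Longrightarrow> X s w \<le> g"
    "\<And>y. y < g \<Longrightarrow> \<exists>a. 0 \<le> a \<and> a < T \<and> (\<forall>s. a < s \<longrightarrow> s < T \<longrightarrow> y < X s w)"
proof -
  obtain T where T: "0 < T" "first_passage \<tau> t w = ereal T"
    "\<And>s. 0 \<le> s \<Longrightarrow> s < T \<Longrightarrow> X s w \<le> t" "\<And>s. T < s \<Longrightarrow> t < X s w"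
    using regular_path_passage[of w t \<tau>, OF w t \<tau>] by blast
  have wM: "w \<in> space M" using w by (simp add: regular_path_def)
  obtain g where g: "((\<lambda>u. X u w) \<longlongrightarrow> g) (at_left T)" using X_left_lim[OF T(1) wM] by blast
  have ev0: "\<forall>\<^sub>F u in at_left T. u \<in> {0<..<T}" using T(1) by (rule eventually_at_left_real)
  have "((\<lambda>u. \<tau> u w) \<longlongrightarrow> ereal g) (at_left T)"
  proof (rule Lim_transform_eventually)
    show "((\<lambda>u. ereal (X u w)) \<longlongrightarrow> ereal g) (at_left T)" using g by simp
    show "\<forall>\<^sub>F u in at_left T. ereal (X u w) = \<tau> u w" using ev0 by eventually_elim (simp add: \<tau>)
  qed
  then have "Lim (at_left T) (\<lambda>u. \<tau> u w) = ereal g" by (intro tendsto_Lim) auto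
  then have u: "undershoot \<tau> t w = ereal g"
    using T(1) by (simp add: undershoot_def left_limit_def T(2))
  have gt: "g \<le> t"
  proof (rule tendsto_upperbound[OF g])
    show "\<forall>\<^sub>F u in at_left T. X u w \<le> t" using ev0 by eventually_elim (use T(3) in auto)
  qed simp
  have sg: "X s w \<le> g" if s: "0 \<le> s" "s < T" for s
  proof (rule tendsto_lowerbound[OF g])
    have "\<forall>\<^sub>F u in at_left T. u \<in> {s<..<T}" using s(2) by (rule eventually_at_left_real)
    then show "\<forall>\<^sub>F u in at_left T. X s w \<le> X u w"
      by eventually_elim (use w s in \<open>auto simp: regular_path_def\<close>)
  qed simp
  have yg: "\<exists>a. 0 \<le> a \<and> a < T \<and> (\<forall>s. a < s \<longrightarrow> s < T \<longrightarrow> y < X s w)" if y: "y < g" for y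
  proof -
    have "\<forall>\<^sub>F u in at_left T. y < X u w" using order_tendstoD(1)[OF g y] .
    then obtain b where b: "b < T" "\<And>s. b < s \<Longrightarrow> s < T \<Longrightarrow> y < X s w"
      by (auto simp: eventually_at_left_field)
    then show ?thesis using T(1) by (intro exI[of _ "max b 0"]) auto
  qed
  from that[OF T(1,3,4) u gt sg yg] show thesis .
qed

definition crossing_set :: "real \<Rightarrow> real \<Rightarrow> real set \<Rightarrow> 'w \<Rightarrow> real set" where
  "crossing_set h t B w = {s. 0 \<le> s \<and> X (max 0 s) w \<in> B \<and> X (max 0 s) w \<le> t \<and> t < X (max 0 (s + h)) w}"

text \<open>
  Before \<open>T\<close> the path is at most at level \<open>t\<close>, after \<open>T\<close> it
  is above. What happens at \<open>T\<close> itself depends on the path, but this affects only the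
  end points.
\<close>

lemma crossing_set_bounds:
  assumes h: "0 < h" and w: "regular_path w" and T: "0 < T" "\<forall>s. 0 \<le> s \<longrightarrow> s < T \<longrightarrow> X s w \<le> t" "\<forall>s>T. t < X s w"
  shows "crossing_set h t B w \<subseteq> {T - h..T}"
    and "0 \<le> a \<Longrightarrow> h < T - a \<Longrightarrow> (\<And>s. a < s \<Longrightarrow> s < T \<Longrightarrow> X s w \<in> B) \<Longrightarrow> {T - h<..<T} \<subseteq> crossing_set h t B w"
    and "0 \<le> a \<Longrightarrow> h < T - a \<Longrightarrow> (\<And>s. a < s \<Longrightarrow> s < T \<Longrightarrow> X s w \<notin> B) \<Longrightarrow> crossing_set h t B w \<subseteq> {T}"
proof -
  show 1: "crossing_set h t B w \<subseteq> {T - h..T}"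
  proof
    fix s assume "s \<in> crossing_set h t B w"
    then have s: "0 \<le> s" "X s w \<le> t" "t < X (s + h) w" using h by (auto simp: crossing_set_def max_def)
    have "s \<le> T" using T(3) s by (meson not_le)
    moreover have "T \<le> s + h" using T(2) s h by (meson add_nonneg_pos less_imp_le not_le)
    ultimately show "s \<in> {T - h..T}" by simp
  qed
  show "{T - h<..<T} \<subseteq> crossing_set h t B w"
    if "0 \<le> a" "h < T - a" "\<And>s. a < s \<Longrightarrow> s < T \<Longrightarrow> X s w \<in> B"
  proof
    fix s assume "s \<in> {T - h<..<T}"
    then have s: "T - h < s" "s < T" by auto
    have "a < s" using s that by linarith
    moreover have "0 < s" using calculation that by linarith
    ultimately show "s \<in> crossing_set h t B w"
      using spec[OF T(2), of s] spec[OF T(3), of "s + h"] that(3)[of s] s h by (simp add: crossing_set_def max_def)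
  qed
  show "crossing_set h t B w \<subseteq> {T}"
    if a: "0 \<le> a" "h < T - a" "\<And>s. a < s \<Longrightarrow> s < T \<Longrightarrow> X s w \<notin> B"
  proof
    fix s assume sc: "s \<in> crossing_set h t B w"
    then have s: "T - h \<le> s" "s \<le> T" using 1 by auto
    have "X s w \<in> B" using sc by (auto simp: crossing_set_def max_def)
    moreover have "a < s" using s a by linarith
    ultimately have "\<not> s < T" using a(3) by blast
    then show "s \<in> {T}" using s by simp
  qed
qed

text \<open>
  Pointwise, the normalised length is eventually equal to the indicator of \<open>E\<close>, and it
  is bounded by \<open>1\<close>.
\<close>

lemma crossing_time_limit:
  assumes t: "0 < t" and [measurable]: "B \<in> sets borel" "E \<in> sets M"
    and E: "\<And>w. regular_path w \<Longrightarrow> \<exists>T a. 0 \<le> a \<and> a < T \<and> (\<forall>s. 0 \<le> s \<longrightarrow> s < T \<longrightarrow> X s w \<le> t) \<and> (\<forall>s>T. t < X s w) \<and>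
        (if w \<in> E then \<forall>s. a < s \<longrightarrow> s < T \<longrightarrow> X s w \<in> B else \<forall>s. a < s \<longrightarrow> s < T \<longrightarrow> X s w \<notin> B)"
  shows "(\<lambda>n. ennreal (real (Suc n)) * crossing_time (1 / real (Suc n)) t B) \<longlonglongrightarrow> emeasure M E"
proof -
  define c where "c n w = (\<integral>\<^sup>+s. indicator {s. 0 \<le> s \<and> X (max 0 s) w \<in> B \<and> X (max 0 s) w \<le> t \<and> t < X (max 0 (s + 1 / real (Suc n))) w} s \<partial>lborel)" for n w
  have [measurable]: "c n \<in> borel_measurable M" for n unfolding c_def by measurable
  have c: "c n w = emeasure lborel (crossing_set (1 / real (Suc n)) t B w)" if "w \<in> space M" for n w
  proof -
    have "(\<lambda>s. X (max 0 s) w) \<in> borel_measurable borel" "(\<lambda>s. X (max 0 (s + 1 / real (Suc n))) w) \<in> borel_measurable borel"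
      using that by measurable
    then have [measurable]: "{s. 0 \<le> s \<and> X (max 0 s) w \<in> B \<and> X (max 0 s) w \<le> t \<and> t < X (max 0 (s + 1 / real (Suc n))) w} \<in> sets borel"
      by measurable
    show ?thesis unfolding c_def crossing_set_def by (rule nn_integral_indicator) (simp del: of_nat_Suc)
  qed
  have "(\<lambda>n. \<integral>\<^sup>+w. ennreal (real (Suc n)) * c n w \<partial>M) \<longlonglongrightarrow> (\<integral>\<^sup>+w. indicator E w \<partial>M)"
  proof (rule nn_integral_dominated_convergence[where w = "\<lambda>_. 1"])
    show "AE w in M. ennreal (real (Suc n)) * c n w \<le> 1" for n
      using AE_regular_path
    proof eventually_elim
      case (elim w)
      obtain T a where T: "0 \<le> a" "a < T" "\<forall>s. 0 \<le> s \<longrightarrow> s < T \<longrightarrow> X s w \<le> t" "\<forall>s>T. t < X s w"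
        using E[OF elim] by blast
      let ?h = "1 / real (Suc n)"
      have "crossing_set ?h t B w \<subseteq> {T - ?h..T}"
        by (rule crossing_set_bounds(1)[OF _ elim]) (use T in auto)
      then have "emeasure lborel (crossing_set ?h t B w) \<le> emeasure lborel {T - ?h..T}"
        by (intro emeasure_mono) auto
      also have "\<dots> = ennreal ?h" by simp
      finally have "ennreal (real (Suc n)) * c n w \<le> ennreal (real (Suc n)) * ennreal ?h"
        using elim by (intro mult_left_mono) (auto simp: c regular_path_def)
      also have "\<dots> = 1" by (simp add: ennreal_mult[symmetric] del: of_nat_Suc)
      finally show ?case .
    qed
    show "AE w in M. (\<lambda>n. ennreal (real (Suc n)) * c n w) \<longlonglongrightarrow> indicator E w"
      using AE_regular_path
    proof eventually_elim
      case (elim w)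
      obtain T a where T: "0 \<le> a" "a < T" "\<forall>s. 0 \<le> s \<longrightarrow> s < T \<longrightarrow> X s w \<le> t" "\<forall>s>T. t < X s w"
        and TE: "if w \<in> E then \<forall>s. a < s \<longrightarrow> s < T \<longrightarrow> X s w \<in> B else \<forall>s. a < s \<longrightarrow> s < T \<longrightarrow> X s w \<notin> B"
        using E[OF elim] by blast
      have wM: "w \<in> space M" using elim by (simp add: regular_path_def)
      have T0: "0 < T" using T by linarith
      have "(\<lambda>n. 1 / real (Suc n)) \<longlonglongrightarrow> 0"
        using LIMSEQ_inverse_real_of_nat by (simp add: inverse_eq_divide)
      then have "\<forall>\<^sub>F n in sequentially. 1 / real (Suc n) < T - a"
        using T by (intro order_tendstoD) auto
      then have "\<forall>\<^sub>F n in sequentially. ennreal (real (Suc n)) * c n w = indicator E w"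
      proof eventually_elim
        case (elim n)
        let ?h = "1 / real (Suc n)"
        have h: "0 < ?h" by simp
        note bnd = crossing_set_bounds[OF h \<open>regular_path w\<close> T0 T(3,4)]
        have [measurable]: "crossing_set ?h t B w \<in> sets borel"
        proof -
          have "(\<lambda>s. X (max 0 s) w) \<in> borel_measurable borel" "(\<lambda>s. X (max 0 (s + 1 / real (Suc n))) w) \<in> borel_measurable borel"
            using wM by measurable
          then show ?thesis unfolding crossing_set_def by measurable
        qed
        show ?case
        proof (cases "w \<in> E")
          case True
          have "{T - ?h<..<T} \<subseteq> crossing_set ?h t B w"
            using TE True by (intro bnd(2)[OF T(1) elim]) auto
          then have "emeasure lborel {T - ?h<..<T} \<le> emeasure lborel (crossing_set ?h t B w)"
            by (intro emeasure_mono) (simp_all del: of_nat_Suc)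
          moreover have "emeasure lborel (crossing_set ?h t B w) \<le> emeasure lborel {T - ?h..T}"
            using bnd(1) by (intro emeasure_mono) auto
          ultimately have "emeasure lborel (crossing_set ?h t B w) = ennreal ?h" by simp
          then show ?thesis using True wM by (simp add: c ennreal_mult[symmetric] del: of_nat_Suc)
        next
          case False
          have "crossing_set ?h t B w \<subseteq> {T}"
            using TE False by (intro bnd(3)[OF T(1) elim]) auto
          then have "emeasure lborel (crossing_set ?h t B w) \<le> emeasure lborel {T}"
            by (intro emeasure_mono) auto
          then show ?thesis using False wM by (simp add: c)
        qed
      qed
      then show ?case by (rule tendsto_eventually)
    qed
  qed (auto simp: emeasure_space_1)
  moreover have "(\<integral>\<^sup>+w. ennreal (real (Suc n)) * c n w \<partial>M) = ennreal (real (Suc n)) * crossing_time (1 / real (Suc n)) t B" for n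
    unfolding crossing_time_def c_def[symmetric] by (rule nn_integral_cmult) measurable
  ultimately show ?thesis by simp
qed

section \<open>Measurability of the undershoot\<close>

text \<open>
  Rational times suffice for a right-continuous path, which makes the lower limit measurable in the
  path.
\<close>

lemma Liminf_right_continuous:
  fixes f :: "real \<Rightarrow> real"
  assumes f: "\<And>s. 0 \<le> s \<Longrightarrow> (f \<longlongrightarrow> f s) (at_right s)"
  shows "Liminf at_top (\<lambda>s. ereal (f s)) = (SUP n::nat. INF q\<in>{q::rat. real n \<le> real_of_rat q}. ereal (f (real_of_rat q)))"
    (is "_ = (SUP n. ?m n)")
proof (rule antisym)
  show "(SUP n. ?m n) \<le> Liminf at_top (\<lambda>s. ereal (f s))"
  proof (rule SUP_least)
    fix n :: nat
    have "?m n \<le> ereal (f s)" if s: "real n \<le> s" for s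
    proof (rule ccontr)
      assume "\<not> ?m n \<le> ereal (f s)"
      then have "ereal (f s) < ?m n" by simp
      then obtain y where y: "ereal (f s) < ereal y" "ereal y < ?m n" using ereal_dense2 by blast
      have "\<forall>\<^sub>F u in at_right s. f u < y"
        using f[of s] s y by (intro order_tendstoD(2)) auto
      then obtain b where b: "s < b" "\<And>u. s < u \<Longrightarrow> u < b \<Longrightarrow> f u < y" by (auto simp: eventually_at_right_field)
      obtain q where q: "s < real_of_rat q" "real_of_rat q < b" using of_rat_dense[OF b(1)] by blast
      have "?m n \<le> ereal (f (real_of_rat q))" using q s by (intro INF_lower) auto
      also have "\<dots> < ereal y" using b(2) q by simp
      finally show False using y by simp
    qed
    then show "?m n \<le> Liminf at_top (\<lambda>s. ereal (f s))"
      by (intro Liminf_bounded) (auto simp: eventually_at_top_linorder)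
  qed
  show "Liminf at_top (\<lambda>s. ereal (f s)) \<le> (SUP n. ?m n)"
    unfolding Liminf_def
  proof (rule SUP_least)
    fix P :: "real \<Rightarrow> bool" assume "P \<in> {P. eventually P at_top}"
    then obtain b where b: "\<And>x. b \<le> x \<Longrightarrow> P x" by (auto simp: eventually_at_top_linorder)
    obtain n :: nat where n: "b \<le> real n" using real_arch_simple by blast
    have "(INF x\<in>Collect P. ereal (f x)) \<le> ?m n"
      using b n by (intro INF_greatest INF_lower) auto
    also have "\<dots> \<le> (SUP n. ?m n)" by (intro SUP_upper) auto
    finally show "(INF x\<in>Collect P. ereal (f x)) \<le> (SUP n. ?m n)" .
  qed
qed

lemma Liminf_process_measurable:
  fixes Y :: "real \<Rightarrow> 'w \<Rightarrow> real"
  assumes Y: "\<And>s. 0 \<le> s \<Longrightarrow> Y s \<in> borel_measurable M"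
    and rc: "\<And>s w. 0 \<le> s \<Longrightarrow> w \<in> space M \<Longrightarrow> ((\<lambda>u. Y u w) \<longlongrightarrow> Y s w) (at_right s)"
  shows "(\<lambda>w. Liminf at_top (\<lambda>s. ereal (Y s w))) \<in> borel_measurable M"
proof -
  have "(\<lambda>w. SUP n::nat. INF q\<in>{q::rat. real n \<le> real_of_rat q}. ereal (Y (real_of_rat q) w)) \<in> borel_measurable M"
  proof (intro borel_measurable_SUP borel_measurable_INF borel_measurable_ereal Y)
    fix n :: nat and q assume "q \<in> {q::rat. real n \<le> real_of_rat q}"
    then have "real n \<le> real_of_rat q" by simp
    then show "0 \<le> real_of_rat q" by (meson of_nat_0_le_iff order_trans)
  qed auto
  then show ?thesis
    by (subst measurable_cong[OF Liminf_right_continuous[OF rc]]) auto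
qed

lemma first_passage_measurable:
  assumes \<tau>: "\<And>s w. 0 \<le> s \<Longrightarrow> w \<in> space M \<Longrightarrow> \<tau> s w = ereal (X s w)"
  shows "first_passage \<tau> t \<in> borel_measurable M"
proof -
  let ?F = "\<lambda>w. INF q\<in>{q::rat. 0 \<le> q}. if t < X (real_of_rat q) w then ereal (real_of_rat q) else \<infinity>"
  have "?F \<in> borel_measurable M"
  proof (intro borel_measurable_INF)
    fix q :: rat assume "q \<in> {q. 0 \<le> q}"
    then have [measurable]: "X (real_of_rat q) \<in> borel_measurable M" by simp
    show "(\<lambda>w. if t < X (real_of_rat q) w then ereal (real_of_rat q) else \<infinity>) \<in> borel_measurable M" by measurable
  qed auto
  moreover have "first_passage \<tau> t w = ?F w" if w: "w \<in> space M" for w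
  proof (rule antisym)
    show "first_passage \<tau> t w \<le> ?F w"
      unfolding first_passage_def using w
      by (intro INF_greatest) (auto intro!: Inf_lower simp: \<tau>)
    show "?F w \<le> first_passage \<tau> t w"
      unfolding first_passage_def
    proof (rule Inf_greatest)
      fix z assume "z \<in> {ereal s |s. 0 \<le> s \<and> ereal t < \<tau> s w}"
      then obtain s where s: "z = ereal s" "0 \<le> s" "t < X s w" using w \<tau> by auto
      show "?F w \<le> z"
        unfolding s
      proof (rule ereal_le_epsilon2)
        fix e :: real assume e: "0 < e"
        have "\<forall>\<^sub>F u in at_right s. t < X u w"
          using X_right_cont[OF s(2) w] s(3) by (rule order_tendstoD)
        then obtain b where b: "s < b" "\<And>u. s < u \<Longrightarrow> u < b \<Longrightarrow> t < X u w"
          by (auto simp: eventually_at_right_field)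
        obtain q where q: "s < real_of_rat q" "real_of_rat q < min b (s + e)"
          using of_rat_dense[of s "min b (s + e)"] b e by auto
        have "real_of_rat 0 < real_of_rat q" unfolding of_rat_0 using q(1) s(2) by linarith
        then have "0 \<le> q" unfolding of_rat_less by simp
        then have "?F w \<le> (if t < X (real_of_rat q) w then ereal (real_of_rat q) else \<infinity>)"
          by (intro INF_lower) auto
        also have "\<dots> = ereal (real_of_rat q)" using b(2)[of "real_of_rat q"] q by auto
        also have "\<dots> \<le> ereal s + ereal e" using q by simp
        finally show "?F w \<le> ereal s + ereal e" .
      qed
    qed
  qed
  ultimately show ?thesis by (subst measurable_cong) auto
qed

text \<open>
  Events of probability \<open>0\<close> need not be harmless, as subsets of null sets can fail to
  be measurable. So the undershoot is written as a measurable expression on the whole space,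
  including the paths that never pass the level. Such a path need not be monotone or convergent.
\<close>

lemma undershoot_measurable:
  assumes \<tau>: "\<And>s w. 0 \<le> s \<Longrightarrow> w \<in> space M \<Longrightarrow> \<tau> s w = ereal (X s w)"
  shows "undershoot \<tau> t \<in> borel_measurable M"
proof -
  note [measurable] = first_passage_measurable[OF \<tau>, of t]
  define I where "I w = Liminf at_top (\<lambda>s. ereal (X s w))" for w
  define S where "S w = - Liminf at_top (\<lambda>s. ereal (- X s w))" for w
  \<comment> \<open>The value that \<^const>\<open>Lim\<close> takes where there is no limit.\<close>
  define C where "C = (THE l::ereal. False)"
  define G where "G w = liminf (\<lambda>n. ereal (X (max 0 (real_of_ereal (first_passage \<tau> t w) - 1 / real (Suc n))) w))" for w
  have [measurable]: "I \<in> borel_measurable M" unfolding I_def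
    by (intro Liminf_process_measurable X_right_cont) auto
  have [measurable]: "S \<in> borel_measurable M" unfolding S_def
    by (intro borel_measurable_uminus_ereal Liminf_process_measurable tendsto_minus X_right_cont) auto
  have [measurable]: "G \<in> borel_measurable M" unfolding G_def by measurable
  have eq: "undershoot \<tau> t w = (if first_passage \<tau> t w \<le> 0 then 0 else if first_passage \<tau> t w = \<infinity> then
      if I w = S w then I w else C else G w)" if w: "w \<in> space M" for w
  proof -
    consider "first_passage \<tau> t w \<le> 0" | "first_passage \<tau> t w = \<infinity>" | T where "0 < T" "first_passage \<tau> t w = ereal T"
    proof (cases "first_passage \<tau> t w")
      case (real r)
      then show ?thesis using that(1) that(3)[of r] by (cases "0 < r") auto
    qed (use that(1,2) in auto)
    then show ?thesis
    proof cases
      case 1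
      then show ?thesis by (simp add: undershoot_def left_limit_def)
    next
      case 2
      have lim: "((\<lambda>s. \<tau> s w) \<longlongrightarrow> l) at_top \<longleftrightarrow> I w = l \<and> S w = l" for l
      proof -
        have "((\<lambda>s. \<tau> s w) \<longlongrightarrow> l) at_top \<longleftrightarrow> ((\<lambda>s. ereal (X s w)) \<longlongrightarrow> l) at_top"
        proof (rule tendsto_cong)
          show "\<forall>\<^sub>F s in at_top. \<tau> s w = ereal (X s w)"
            using eventually_ge_at_top[of 0] by eventually_elim (simp add: \<tau> w)
        qed
        also have "\<dots> \<longleftrightarrow> I w = l \<and> S w = l"
        proof -
          have "S w = Limsup at_top (\<lambda>s. ereal (X s w))"
            unfolding S_def uminus_ereal.simps(1)[symmetric] ereal_Liminf_uminus by simp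
          then show ?thesis unfolding I_def by (simp add: tendsto_iff_Liminf_eq_Limsup)
        qed
        finally show ?thesis .
      qed
      have "Lim at_top (\<lambda>s. \<tau> s w) = (if I w = S w then I w else C)"
      proof (cases "I w = S w")
        case False
        then have "(\<lambda>l. I w = l \<and> S w = l) = (\<lambda>_. False)" by auto
        then show ?thesis using False unfolding t2_space_class.Lim_def lim C_def by simp
      qed (auto simp: t2_space_class.Lim_def lim)
      then show ?thesis using 2 by (simp add: undershoot_def left_limit_def)
    next
      case 3
      obtain g where g: "((\<lambda>u. X u w) \<longlongrightarrow> g) (at_left T)" using X_left_lim[OF 3(1) w] by blast
      have ev0: "\<forall>\<^sub>F u in at_left T. u \<in> {0<..<T}" using 3(1) by (rule eventually_at_left_real)
      have "((\<lambda>u. \<tau> u w) \<longlongrightarrow> ereal g) (at_left T)"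
      proof (rule Lim_transform_eventually)
        show "((\<lambda>u. ereal (X u w)) \<longlongrightarrow> ereal g) (at_left T)" using g by simp
        show "\<forall>\<^sub>F u in at_left T. ereal (X u w) = \<tau> u w" using ev0 by eventually_elim (simp add: \<tau> w)
      qed
      then have L: "Lim (at_left T) (\<lambda>u. \<tau> u w) = ereal g" by (intro tendsto_Lim) auto
      have lim0: "(\<lambda>n. T - 1 / real (Suc n)) \<longlonglongrightarrow> T"
        using tendsto_diff[OF tendsto_const LIMSEQ_inverse_real_of_nat, of T] by (simp add: inverse_eq_divide)
      have "filterlim (\<lambda>n. T - 1 / real (Suc n)) (at_left T) sequentially"
        unfolding filterlim_at using lim0 by (auto intro!: always_eventually)
      then have "(\<lambda>n. X (T - 1 / real (Suc n)) w) \<longlonglongrightarrow> g" by (rule filterlim_compose[OF g])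
      moreover have "\<forall>\<^sub>F n in sequentially. X (T - 1 / real (Suc n)) w = X (max 0 (T - 1 / real (Suc n))) w"
        using order_tendstoD(1)[OF lim0 3(1)] by eventually_elim (simp add: max_def)
      ultimately have "(\<lambda>n. X (max 0 (T - 1 / real (Suc n))) w) \<longlonglongrightarrow> g" by (rule Lim_transform_eventually)
      then have "(\<lambda>n. ereal (X (max 0 (T - 1 / real (Suc n))) w)) \<longlonglongrightarrow> ereal g" by simp
      then have "G w = ereal g" unfolding G_def 3(2) real_of_ereal.simps(1) by (intro lim_imp_Liminf) auto
      then show ?thesis using 3(1) by (simp add: undershoot_def left_limit_def 3(2) L)
    qed
  qed
  have "(\<lambda>w. if first_passage \<tau> t w \<le> 0 then 0 else if first_passage \<tau> t w = \<infinity> then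
      if I w = S w then I w else C else G w) \<in> borel_measurable M" by measurable
  then show ?thesis by (subst measurable_cong[OF eq]) auto
qed

section \<open>Bounds for the law of the undershoot\<close>

context
  fixes \<tau> :: "real \<Rightarrow> 'w \<Rightarrow> ereal" and t :: real
  assumes \<tau>: "\<And>s w. 0 \<le> s \<Longrightarrow> w \<in> space M \<Longrightarrow> \<tau> s w = ereal (X s w)" and t: "0 < t"
begin

text \<open>
  The flag \<open>below\<close> selects whether \<open>B\<close> is, within
  \<open>(-\<infinity>, t]\<close>, the half-line up to \<open>y\<close> or its complement. The path
  is eventually on one side of \<open>y\<close> before \<open>T\<close>, namely on the side of the
  undershoot; if the undershoot is equal to \<open>y\<close>, the path stays at or below
  \<open>y\<close>.
\<close>

lemma crossing_time_limit_undershoot: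
  assumes [measurable]: "B \<in> sets borel" and B: "\<And>x. x \<le> t \<Longrightarrow> x \<in> B \<longleftrightarrow> (x \<le> y \<longleftrightarrow> below)"
  shows "(\<lambda>n. ennreal (real (Suc n)) * crossing_time (1 / real (Suc n)) t B) \<longlonglongrightarrow>
     emeasure M {w \<in> space M. undershoot \<tau> t w \<le> ereal y \<longleftrightarrow> below}"
proof (rule crossing_time_limit[OF t])
  note [measurable] = undershoot_measurable[OF \<tau>, of t]
  let ?E = "{w \<in> space M. undershoot \<tau> t w \<le> ereal y \<longleftrightarrow> below}"
  show "?E \<in> sets M" by (cases below) simp_all
  fix w assume w: "regular_path w"
  then have wM: "w \<in> space M" by (simp add: regular_path_def)
  obtain T g where T: "0 < T" "\<And>s. 0 \<le> s \<Longrightarrow> s < T \<Longrightarrow> X s w \<le> t" "\<And>s. T < s \<Longrightarrow> t < X s w"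
    "undershoot \<tau> t w = ereal g" "g \<le> t" "\<And>s. 0 \<le> s \<Longrightarrow> s < T \<Longrightarrow> X s w \<le> g"
    "\<And>y. y < g \<Longrightarrow> \<exists>a. 0 \<le> a \<and> a < T \<and> (\<forall>s. a < s \<longrightarrow> s < T \<longrightarrow> y < X s w)"
    using regular_path_undershoot[of w t \<tau>, OF w t \<tau>[OF _ wM]] by blast
  obtain a where a: "0 \<le> a" "a < T" "\<And>s. a < s \<Longrightarrow> s < T \<Longrightarrow> X s w \<le> y \<longleftrightarrow> g \<le> y"
  proof (cases "g \<le> y")
    case True
    have "X s w \<le> y" if "0 < s" "s < T" for s using T(6)[of s] that True by simp
    with that[of 0] T True show thesis by simp
  next
    case False
    then obtain a where "0 \<le> a" "a < T" "\<forall>s. a < s \<longrightarrow> s < T \<longrightarrow> y < X s w" using T(7)[of y] by auto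
    with that[of a] False show thesis by (simp add: not_le)
  qed
  have "X s w \<in> B \<longleftrightarrow> w \<in> ?E" if "a < s" "s < T" for s
    using B[of "X s w"] T(2)[of s] a(1) a(3)[OF that] that wM by (simp add: T(4))
  then show "\<exists>T a. 0 \<le> a \<and> a < T \<and> (\<forall>s. 0 \<le> s \<longrightarrow> s < T \<longrightarrow> X s w \<le> t) \<and> (\<forall>s>T. t < X s w) \<and>
      (if w \<in> ?E then \<forall>s. a < s \<longrightarrow> s < T \<longrightarrow> X s w \<in> B else \<forall>s. a < s \<longrightarrow> s < T \<longrightarrow> X s w \<notin> B)"
    using a(1,2) T(2,3) by (intro exI[of _ T] exI[of _ a]) auto
qed simp

lemma crossing_time_limit_le:
  "(\<lambda>n. ennreal (real (Suc n)) * crossing_time (1 / real (Suc n)) t {..y}) \<longlonglongrightarrow>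
     emeasure M {w \<in> space M. undershoot \<tau> t w \<le> ereal y}"
  using crossing_time_limit_undershoot[of "{..y}" y True] by simp

lemma crossing_time_limit_gt:
  "(\<lambda>n. ennreal (real (Suc n)) * crossing_time (1 / real (Suc n)) t {y<..t}) \<longlonglongrightarrow>
     emeasure M {w \<in> space M. ereal y < undershoot \<tau> t w}"
  using crossing_time_limit_undershoot[of "{y<..t}" y False] by (simp add: not_le)

lemma limit_bounds:
  assumes lim: "(\<lambda>n. ennreal (real (Suc n)) * crossing_time (1 / real (Suc n)) t B) \<longlonglongrightarrow> emeasure M E"
  shows limit_lower: "(\<And>h. 0 < h \<Longrightarrow> h \<le> 1 \<Longrightarrow> ennreal (h * L) \<le> crossing_time h t B) \<Longrightarrow> 0 \<le> L \<Longrightarrow> L \<le> prob E"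
    and limit_upper: "(\<And>h. 0 < h \<Longrightarrow> h \<le> 1 \<Longrightarrow> crossing_time h t B \<le> ennreal (h * L)) \<Longrightarrow> 0 \<le> L \<Longrightarrow> prob E \<le> L"
proof -
  have e: "ennreal (real (Suc n)) * ennreal (1 / real (Suc n) * L) = ennreal L" if "0 \<le> L" for n
    using that by (simp add: ennreal_mult[symmetric] del: of_nat_Suc)
  show "L \<le> prob E" if b: "\<And>h. 0 < h \<Longrightarrow> h \<le> 1 \<Longrightarrow> ennreal (h * L) \<le> crossing_time h t B" and L: "0 \<le> L"
  proof -
    have "ennreal L \<le> emeasure M E"
    proof (rule LIMSEQ_le_const[OF lim], intro exI[of _ 0] allI impI)
      fix n :: nat
      show "ennreal L \<le> ennreal (real (Suc n)) * crossing_time (1 / real (Suc n)) t B"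
        unfolding e[OF L, of n, symmetric] by (intro mult_left_mono b) auto
    qed
    then show ?thesis by (simp add: emeasure_eq_measure)
  qed
  show "prob E \<le> L" if b: "\<And>h. 0 < h \<Longrightarrow> h \<le> 1 \<Longrightarrow> crossing_time h t B \<le> ennreal (h * L)" and L: "0 \<le> L"
  proof -
    have "emeasure M E \<le> ennreal L"
    proof (rule LIMSEQ_le_const2[OF lim], intro exI[of _ 0] allI impI)
      fix n :: nat
      show "ennreal (real (Suc n)) * crossing_time (1 / real (Suc n)) t B \<le> ennreal L"
        unfolding e[OF L, of n, symmetric] by (intro mult_left_mono b) auto
    qed
    then show ?thesis using L by (simp add: emeasure_eq_measure)
  qed
qed

lemma undershoot_small_bounds:
  assumes y: "0 \<le> y" "y < t"
  shows undershoot_small_lower: "(\<And>h. 0 < h \<Longrightarrow> h \<le> 1 \<Longrightarrow> v \<le> tail_rate h t) \<Longrightarrow> 0 \<le> v \<Longrightarrow>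
      U y * v \<le> prob {w \<in> space M. undershoot \<tau> t w \<le> ereal y}"
    and undershoot_small_upper: "(\<And>h. 0 < h \<Longrightarrow> h \<le> 1 \<Longrightarrow> tail_rate h (t - y) \<le> v) \<Longrightarrow>
      prob {w \<in> space M. undershoot \<tau> t w \<le> ereal y} \<le> U y * v"
proof -
  show "U y * v \<le> prob {w \<in> space M. undershoot \<tau> t w \<le> ereal y}"
    if v: "\<And>h. 0 < h \<Longrightarrow> h \<le> 1 \<Longrightarrow> v \<le> tail_rate h t" "0 \<le> v"
  proof (rule limit_lower[OF crossing_time_limit_le])
    fix h :: real assume h: "0 < h" "h \<le> 1"
    have "ennreal (h * (U y * v)) \<le> ennreal (h * (U y * tail_rate h t))"
      using h v(1)[OF h] by (intro ennreal_leI mult_left_mono) auto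
    also have "\<dots> \<le> crossing_time h t {..y}" using h y by (intro crossing_time_below)
    finally show "ennreal (h * (U y * v)) \<le> crossing_time h t {..y}" .
  qed (use v in simp)
  show "prob {w \<in> space M. undershoot \<tau> t w \<le> ereal y} \<le> U y * v"
    if v: "\<And>h. 0 < h \<Longrightarrow> h \<le> 1 \<Longrightarrow> tail_rate h (t - y) \<le> v"
  proof (rule limit_upper[OF crossing_time_limit_le])
    fix h :: real assume h: "0 < h" "h \<le> 1"
    have "crossing_time h t {..y} \<le> ennreal (h * (U y * tail_rate h (t - y)))"
      using h y by (intro crossing_time_below)
    also have "\<dots> \<le> ennreal (h * (U y * v))"
      using h v(1)[OF h] by (intro ennreal_leI mult_left_mono) auto
    finally show "crossing_time h t {..y} \<le> ennreal (h * (U y * v))" .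
  next
    have "0 \<le> v" using v[of 1] tail_rate_nonneg[of 1 "t - y"] by simp
    then show "0 \<le> U y * v" by simp
  qed
qed

lemma undershoot_large_lower:
  assumes y: "0 < y" and K: "0 \<le> K" "\<And>a. t - y \<le> a \<Longrightarrow> a < t \<Longrightarrow> K * (t - a) \<le> measure renewal_measure {a<..t}"
    and v: "\<And>h. 0 < h \<Longrightarrow> h \<le> 1 \<Longrightarrow> v \<le> truncated_mean_rate h y" "0 \<le> v"
  shows "K * v \<le> prob {w \<in> space M. ereal (t - y) \<le> undershoot \<tau> t w}"
proof -
  note [measurable] = undershoot_measurable[OF \<tau>, of t]
  have "K * v \<le> prob {w \<in> space M. ereal (t - y) < undershoot \<tau> t w}"
  proof (rule limit_lower[OF crossing_time_limit_gt])
    fix h :: real assume h: "0 < h" "h \<le> 1"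
    have "ennreal (h * (K * v)) \<le> ennreal (h * (K * truncated_mean_rate h y))"
      using h v(1)[OF h] K by (intro ennreal_leI mult_left_mono) auto
    also have "\<dots> \<le> crossing_time h t {t - y<..t}" using h y K by (intro crossing_time_near_ge) auto
    finally show "ennreal (h * (K * v)) \<le> crossing_time h t {t - y<..t}" .
  qed (use v K in simp)
  also have "\<dots> \<le> prob {w \<in> space M. ereal (t - y) \<le> undershoot \<tau> t w}"
    by (intro finite_measure_mono) auto
  finally show ?thesis .
qed

lemma truncated_mean_rate_scale:
  assumes h: "0 < h" and k: "1 \<le> k" and y: "0 < y"
  shows "truncated_mean_rate h (k * y) \<le> k * truncated_mean_rate h y"
proof -
  have "expectation (\<lambda>w. min (k * y) (X h w)) \<le> expectation (\<lambda>w. k * min y (X h w))"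
  proof (intro integral_mono integrable_min_X integrable_mult_right)
    fix w assume "w \<in> space M"
    then have "0 \<le> X h w" using h by (intro X_nonneg) auto
    then have "X h w \<le> k * X h w" using k by (simp add: mult_le_cancel_right1)
    then show "min (k * y) (X h w) \<le> k * min y (X h w)" by (auto simp: min_def)
  qed (use h k y in auto)
  also have "\<dots> = k * expectation (\<lambda>w. min y (X h w))" by simp
  finally show ?thesis using h by (simp add: truncated_mean_rate_def divide_right_mono)
qed

text \<open>
  The bound for the crossing times concerns the event of a strict inequality. The event of a weak
  inequality is contained in the strict one for the slightly larger distance \<open>k y\<close>,
  which costs at most the factor \<open>k\<close>; then \<open>k \<longrightarrow> 1\<close>.
\<close>

lemma undershoot_large_upper:
  assumes y: "0 < y" "y < t" and b: "b < t - y" and K: "0 \<le> K" "\<And>a. b \<le> a \<Longrightarrow> a < t \<Longrightarrow> measure renewal_measure {a<..t} \<le> K * (t - a)"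
    and v: "\<And>h. 0 < h \<Longrightarrow> h \<le> 1 \<Longrightarrow> truncated_mean_rate h y \<le> v" "0 \<le> v"
  shows "prob {w \<in> space M. ereal (t - y) \<le> undershoot \<tau> t w} \<le> K * v"
proof (rule tendsto_lowerbound)
  note [measurable] = undershoot_measurable[OF \<tau>, of t]
  have "((\<lambda>k. K * (k * v)) \<longlongrightarrow> K * (1 * v)) (at_right 1)" by (intro tendsto_intros)
  then show "((\<lambda>k. K * (k * v)) \<longlongrightarrow> K * v) (at_right 1)" by simp
  have "1 < (t - b) / y" using b y by simp
  then have "\<forall>\<^sub>F k in at_right 1. k \<in> {1<..<(t - b) / y}" by (rule eventually_at_right_real)
  then show "\<forall>\<^sub>F k in at_right 1. prob {w \<in> space M. ereal (t - y) \<le> undershoot \<tau> t w} \<le> K * (k * v)"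
  proof eventually_elim
    case (elim k)
    then have k: "1 < k" "k * y < t - b" using y by (auto simp: pos_less_divide_eq)
    have ky: "y < k * y" using k y by simp
    have "prob {w \<in> space M. ereal (t - y) \<le> undershoot \<tau> t w} \<le> prob {w \<in> space M. ereal (t - k * y) < undershoot \<tau> t w}"
    proof (intro finite_measure_mono subsetI CollectI conjI)
      fix w assume w: "w \<in> {w \<in> space M. ereal (t - y) \<le> undershoot \<tau> t w}"
      have "ereal (t - k * y) < ereal (t - y)" using ky by simp
      also have "\<dots> \<le> undershoot \<tau> t w" using w by simp
      finally show "ereal (t - k * y) < undershoot \<tau> t w" .
    qed auto
    also have "\<dots> \<le> K * (k * v)"
    proof (rule limit_upper[OF crossing_time_limit_gt])
      fix h :: real assume h: "0 < h" "h \<le> 1"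
      have "crossing_time h t {t - k * y<..t} \<le> ennreal (h * (K * truncated_mean_rate h (k * y)))"
        using h y k ky K by (intro crossing_time_near_le) auto
      also have "\<dots> \<le> ennreal (h * (K * (k * v)))"
      proof (intro ennreal_leI mult_left_mono)
        have "truncated_mean_rate h (k * y) \<le> k * truncated_mean_rate h y"
          using h k y by (intro truncated_mean_rate_scale) auto
        also have "\<dots> \<le> k * v" using k v(1)[OF h] by (intro mult_left_mono) auto
        finally show "truncated_mean_rate h (k * y) \<le> k * v" .
      qed (use h K in auto)
      finally show "crossing_time h t {t - k * y<..t} \<le> ennreal (h * (K * (k * v)))" .
    qed (use v K k in simp)
    finally show ?case .
  qed
qed simp

end

end

section \<open>Limits that are uniform in the time step\<close>

text \<open>
  Difference quotients bound the quantities of interest from both sides; for each fixed increment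
  \<open>\<delta>\<close> they converge, and the limits converge to \<open>L\<close> with
  \<open>\<delta>\<close>.
\<close>

lemma family_squeeze:
  fixes f :: "'a \<Rightarrow> real" and d :: real
  assumes d: "0 < d"
    and lower: "\<And>\<delta>. 0 < \<delta> \<Longrightarrow> \<delta> < d \<Longrightarrow> \<exists>g. (\<forall>\<^sub>F x in F. g x \<le> f x) \<and> (g \<longlongrightarrow> lo \<delta>) F"
    and lo: "(lo \<longlongrightarrow> L) (at_right 0)"
    and upper: "\<And>\<delta>. 0 < \<delta> \<Longrightarrow> \<delta> < d \<Longrightarrow> \<exists>g. (\<forall>\<^sub>F x in F. f x \<le> g x) \<and> (g \<longlongrightarrow> hi \<delta>) F"
    and hi: "(hi \<longlongrightarrow> L) (at_right 0)"
  shows "(f \<longlongrightarrow> L) F"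
proof (rule order_tendstoI)
  have dd: "\<forall>\<^sub>F \<delta>::real in at_right 0. \<delta> \<in> {0<..<d}" using d by (rule eventually_at_right_real)
  fix y assume "y < L"
  from eventually_conj[OF dd order_tendstoD(1)[OF lo this]]
  obtain \<delta> where \<delta>: "0 < \<delta>" "\<delta> < d" "y < lo \<delta>"
    using eventually_happens[of _ "at_right (0::real)"] by force
  obtain g where g: "\<forall>\<^sub>F x in F. g x \<le> f x" "(g \<longlongrightarrow> lo \<delta>) F" using lower[OF \<delta>(1,2)] by blast
  show "\<forall>\<^sub>F x in F. y < f x"
    using g(1) order_tendstoD(1)[OF g(2) \<delta>(3)] by eventually_elim simp
next
  have dd: "\<forall>\<^sub>F \<delta>::real in at_right 0. \<delta> \<in> {0<..<d}" using d by (rule eventually_at_right_real)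
  fix y assume "L < y"
  from eventually_conj[OF dd order_tendstoD(2)[OF hi this]]
  obtain \<delta> where \<delta>: "0 < \<delta>" "\<delta> < d" "hi \<delta> < y"
    using eventually_happens[of _ "at_right (0::real)"] by force
  obtain g where g: "\<forall>\<^sub>F x in F. f x \<le> g x" "(g \<longlongrightarrow> hi \<delta>) F" using upper[OF \<delta>(1,2)] by blast
  show "\<forall>\<^sub>F x in F. f x < y"
    using g(1) order_tendstoD(2)[OF g(2) \<delta>(3)] by eventually_elim simp
qed

lemma powr_difference_quotient:
  fixes \<rho> c :: real
  shows "((\<lambda>\<delta>. ((1 + a * \<delta>) powr \<rho> - (1 + b * \<delta>) powr \<rho>) / \<delta>) \<longlongrightarrow> (a - b) * \<rho>) (at_right 0)"
proof -
  have "((\<lambda>\<delta>. (1 + a * \<delta>) powr \<rho> - (1 + b * \<delta>) powr \<rho>) has_real_derivative (a - b) * \<rho>) (at 0 within {0<..})"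
    by (auto intro!: derivative_eq_intros simp: algebra_simps)
  then show ?thesis unfolding has_field_derivative_iff by simp
qed

text \<open>
  Restricts the time step to \<open>(0, 1]\<close>, so that limits along the filter below are
  uniform over all these steps.
\<close>

definition clip :: "real \<Rightarrow> real" where
  "clip h = (if 0 < h \<and> h \<le> 1 then h else 1)"

lemma clip_bounds: "0 < clip h" "clip h \<le> 1"
  by (auto simp: clip_def)

abbreviation uniformly_at_top :: "(real \<times> real) filter" where
  "uniformly_at_top \<equiv> filtercomap fst at_top"

lemma tendsto_uniformly_at_top_fst:
  "(f \<longlongrightarrow> l) at_top \<Longrightarrow> ((\<lambda>i. f (fst i)) \<longlongrightarrow> l) uniformly_at_top"
  by (rule filterlim_compose[OF _ filterlim_filtercomap])

lemma eventually_uniformly_at_topD: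
  assumes "\<forall>\<^sub>F i in uniformly_at_top. P (fst i) (clip (snd i))"
  shows "\<forall>\<^sub>F x in at_top. \<forall>h. 0 < h \<longrightarrow> h \<le> 1 \<longrightarrow> P x h"
proof -
  obtain N where N: "\<And>i. N \<le> fst i \<Longrightarrow> P (fst i) (clip (snd i))"
    using assms by (auto simp: eventually_filtercomap_at_top_linorder)
  show ?thesis
    using eventually_ge_at_top[of N]
  proof eventually_elim
    case (elim x)
    have "P x (clip h)" for h using N[of "(x, h)"] elim by simp
    then show ?case by (metis clip_def)
  qed
qed

lemma measure_le_laplace:
  assumes sets_\<mu> [measurable_cong]: "sets \<mu> = sets borel" and x: "0 < x"
    and int: "integrable \<mu> (\<lambda>v. exp (- (v / x)))"
  shows "measure \<mu> {..x} \<le> exp 1 * (LINT v|\<mu>. exp (- (v / x)))"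
proof -
  have sp: "space \<mu> = UNIV" using sets_eq_imp_space_eq[OF sets_\<mu>] by simp
  have b: "(indicator {..x} v :: real) \<le> exp 1 * exp (- (v / x))" for v
    using x by (auto simp: indicator_def exp_add[symmetric] field_simps)
  have i: "integrable \<mu> (\<lambda>v. indicator {..x} v :: real)"
    by (rule Bochner_Integration.integrable_bound[OF integrable_mult_right[OF int, of "exp 1"]]) (use b in auto)
  have "measure \<mu> {..x} = (LINT v|\<mu>. indicator {..x} v)" by (simp add: sp)
  also have "\<dots> \<le> (LINT v|\<mu>. exp 1 * exp (- (v / x)))"
    by (intro integral_mono i integrable_mult_right int b)
  finally show ?thesis by simp
qed

section \<open>Tauberian asymptotics of renewal measure and tail rate\<close>

context subordinator
begin

text \<open>
  The exponent as a function of the length scale \<open>x\<close> instead of the frequency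
  \<open>1 / x\<close>.
\<close>

definition \<Psi> :: "real \<Rightarrow> real" where "\<Psi> x = \<Phi> (1 / x)"

lemma \<Psi>_pos: "0 < x \<Longrightarrow> 0 < \<Psi> x"
  by (simp add: \<Psi>_def \<Phi>_pos)

lemma \<Psi>_antimono: "0 < x \<Longrightarrow> x \<le> y \<Longrightarrow> \<Psi> y \<le> \<Psi> x"
  unfolding \<Psi>_def by (intro \<Phi>_mono) (auto simp: field_simps)

lemma \<Psi>_scale: "0 < x \<Longrightarrow> x \<le> y \<Longrightarrow> \<Psi> x \<le> y / x * \<Psi> y"
  using \<Phi>_scale[of "1 / y" "y / x"] by (simp add: \<Psi>_def)

text \<open>
  These are the Taylor bounds \<open>x - x\<^sup>2 / 2 \<le> 1 - exp (- x) \<le> x\<close>. The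
  error is uniform in \<open>h \<le> 1\<close>.
\<close>

lemma \<Phi>_rate_bounds:
  assumes h: "0 < h" "h \<le> 1" and c: "0 < c"
  shows "\<Phi>_rate h c \<le> \<Phi> c" "\<Phi> c * (1 - \<Phi> c / 2) \<le> \<Phi>_rate h c"
proof -
  have p: "0 \<le> \<Phi> c" by (rule \<Phi>_nonneg[OF c])
  have "1 - exp (- (h * \<Phi> c)) \<le> h * \<Phi> c" using exp_ge_add_one_self[of "- (h * \<Phi> c)"] by simp
  then show "\<Phi>_rate h c \<le> \<Phi> c" using h by (simp add: \<Phi>_rate_def pos_divide_le_eq mult.commute)
  have q: "exp (- x) \<le> 1 - x + x\<^sup>2 / 2" if "0 \<le> x" for x :: real
  proof -
    have "(\<lambda>y. 1 - y + y\<^sup>2 / 2 - exp (- y)) 0 \<le> (\<lambda>y. 1 - y + y\<^sup>2 / 2 - exp (- y)) x"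
    proof (rule DERIV_nonneg_imp_nondecreasing[OF that])
      fix y :: real
      show "\<exists>z. ((\<lambda>y. 1 - y + y\<^sup>2 / 2 - exp (- y)) has_real_derivative z) (at y) \<and> 0 \<le> z"
        using exp_ge_add_one_self[of "- y"]
        by (intro exI[of _ "- 1 + y + exp (- y)"]) (auto intro!: derivative_eq_intros)
    qed
    then show ?thesis by simp
  qed
  have "h * (\<Phi> c * (1 - h * \<Phi> c / 2)) \<le> 1 - exp (- (h * \<Phi> c))"
    using q[of "h * \<Phi> c"] h p by (simp add: power2_eq_square algebra_simps)
  then have "\<Phi> c * (1 - h * \<Phi> c / 2) \<le> \<Phi>_rate h c"
    using h by (simp add: \<Phi>_rate_def pos_le_divide_eq mult.commute)
  moreover have "h * \<Phi> c \<le> 1 * \<Phi> c" using h p by (intro mult_right_mono) auto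
  then have "\<Phi> c * (1 - \<Phi> c / 2) \<le> \<Phi> c * (1 - h * \<Phi> c / 2)"
    using p by (intro mult_left_mono) auto
  ultimately show "\<Phi> c * (1 - \<Phi> c / 2) \<le> \<Phi>_rate h c" by linarith
qed

lemma renewal_laplace_scaled:
  assumes "0 < x" "0 < k"
  shows "integrable renewal_measure (\<lambda>v. exp (- (k * v / x)))"
    "(LINT v|renewal_measure. exp (- (k * v / x))) = 1 / \<Psi> (x / k)"
  using renewal_measure_laplace[of "k / x"] assms
  by (simp_all add: has_bochner_integral_iff \<Psi>_def)

lemma tail_laplace_scaled:
  assumes "0 < h" "0 < x" "0 < k"
  shows "integrable (tail_measure h) (\<lambda>v. exp (- (k * v / x)))"
    "(LINT v|tail_measure h. exp (- (k * v / x))) = x / k * \<Phi>_rate h (k / x)"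
  using tail_measure_laplace[of h "k / x"] assms
  by (simp_all add: has_bochner_integral_iff mult.commute)

lemma \<Phi>_rate_pos: "0 < h \<Longrightarrow> 0 < c \<Longrightarrow> 0 < \<Phi>_rate h c"
  using \<Phi>_pos[of c] by (simp add: \<Phi>_rate_def)

text \<open>
  The tail rate is decreasing and is the derivative of the truncated mean rate.
\<close>

lemma tail_rate_slope_bounds:
  assumes h: "0 < h" and x: "0 < x"
  shows tail_rate_lower: "1 < b \<Longrightarrow> truncated_mean_rate h (b * x) - truncated_mean_rate h x \<le> (b - 1) * x * tail_rate h x"
    and tail_rate_upper: "0 \<le> b \<Longrightarrow> b < 1 \<Longrightarrow> (1 - b) * x * tail_rate h x \<le> truncated_mean_rate h x - truncated_mean_rate h (b * x)"
proof -
  have [measurable]: "X h \<in> borel_measurable M" using h by simp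
  note int = integrable_min_X[OF less_imp_le[OF h]]
  have ind: "integrable M (indicator {w \<in> space M. x < X h w} :: 'w \<Rightarrow> real)"
    by (rule integrable_const_bound[of _ 1]) (auto simp: indicator_def)
  have t: "c * x * tail_rate h x = expectation (\<lambda>w. c * x * indicator {w \<in> space M. x < X h w} w) / h" for c
    by (simp add: tail_rate_def)
  show "truncated_mean_rate h (b * x) - truncated_mean_rate h x \<le> (b - 1) * x * tail_rate h x" if b: "1 < b"
  proof -
    have "expectation (\<lambda>w. min (b * x) (X h w)) - expectation (\<lambda>w. min x (X h w)) = expectation (\<lambda>w. min (b * x) (X h w) - min x (X h w))"
      using b x by (intro Bochner_Integration.integral_diff[symmetric] int) auto
    also have "\<dots> \<le> expectation (\<lambda>w. (b - 1) * x * indicator {w \<in> space M. x < X h w} w)"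
    proof (intro integral_mono Bochner_Integration.integrable_diff int integrable_mult_right ind)
      fix w assume "w \<in> space M"
      moreover have "x \<le> b * x" using b x by simp
      ultimately show "min (b * x) (X h w) - min x (X h w) \<le> (b - 1) * x * indicator {w \<in> space M. x < X h w} w"
        by (auto simp: indicator_def min_def algebra_simps)
    qed (use b x in auto)
    finally show ?thesis using h unfolding t truncated_mean_rate_def diff_divide_distrib[symmetric]
      by (intro divide_right_mono) auto
  qed
  show "(1 - b) * x * tail_rate h x \<le> truncated_mean_rate h x - truncated_mean_rate h (b * x)" if b: "0 \<le> b" "b < 1"
  proof -
    have "expectation (\<lambda>w. (1 - b) * x * indicator {w \<in> space M. x < X h w} w) \<le> expectation (\<lambda>w. min x (X h w) - min (b * x) (X h w))"
    proof (intro integral_mono Bochner_Integration.integrable_diff int integrable_mult_right ind)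
      fix w assume "w \<in> space M"
      moreover have "b * x \<le> x" using b x by simp
      ultimately show "(1 - b) * x * indicator {w \<in> space M. x < X h w} w \<le> min x (X h w) - min (b * x) (X h w)"
        by (auto simp: indicator_def min_def algebra_simps)
    qed (use b x in auto)
    also have "\<dots> = expectation (\<lambda>w. min x (X h w)) - expectation (\<lambda>w. min (b * x) (X h w))"
      using b x by (intro Bochner_Integration.integral_diff int) auto
    finally show ?thesis using h unfolding t truncated_mean_rate_def diff_divide_distrib[symmetric]
      by (intro divide_right_mono) auto
  qed
qed

context
  fixes \<alpha> :: real
  assumes \<alpha>: "0 < \<alpha>" "\<alpha> < 1"
    and vanish: "(\<Psi> \<longlongrightarrow> 0) at_top"
    and regular: "\<And>c. 0 < c \<Longrightarrow> ((\<lambda>x. \<Psi> (c * x) / \<Psi> x) \<longlongrightarrow> c powr (- \<alpha>)) at_top"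
begin

text \<open>
  Karamata's theorem for the Laplace transform \<open>1 / \<Phi>\<close>, which has index
  \<open>\<alpha>\<close>.
\<close>

lemma renewal_tauberian:
  assumes a: "0 < a"
  shows "((\<lambda>x. U (x * a) * \<Psi> x) \<longlongrightarrow> a powr \<alpha> / Gamma (1 + \<alpha>)) at_top"
proof -
  note L = renewal_laplace_scaled[where k = 1, simplified]
  have "((\<lambda>x. U (x * a) / (LINT v|renewal_measure. exp (- (v / x)))) \<longlongrightarrow> a powr \<alpha> / Gamma (1 + \<alpha>)) at_top"
  proof (rule karamata_tauberian[OF \<alpha>(1) _ _ _ _ a])
    show "\<forall>\<^sub>F x in at_top. 0 < x \<and> integrable renewal_measure (\<lambda>v. exp (- (v / x))) \<and> 0 < (LINT v|renewal_measure. exp (- (v / x)))"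
      using eventually_gt_at_top[of 0] by eventually_elim (simp add: L \<Psi>_pos)
    fix k :: nat assume k: "1 \<le> k"
    have "((\<lambda>x. inverse (\<Psi> ((1 / real k) * x) / \<Psi> x)) \<longlongrightarrow> inverse ((1 / real k) powr (- \<alpha>))) at_top"
      using k by (intro tendsto_inverse regular) auto
    moreover have "inverse ((1 / real k) powr (- \<alpha>)) = real k powr (- \<alpha>)"
      using k by (simp add: powr_divide powr_minus field_simps)
    moreover have "\<forall>\<^sub>F x in at_top. inverse (\<Psi> ((1 / real k) * x) / \<Psi> x) =
        (LINT v|renewal_measure. exp (- (real k * v / x))) / (LINT v|renewal_measure. exp (- (v / x)))"
      using eventually_gt_at_top[of 0]
      by eventually_elim (use k in \<open>simp add: L renewal_laplace_scaled\<close>)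
    ultimately show "((\<lambda>x. (LINT v|renewal_measure. exp (- (real k * v / x))) / (LINT v|renewal_measure. exp (- (v / x)))) \<longlongrightarrow> real k powr (- \<alpha>)) at_top"
      by (simp add: tendsto_cong)
  qed (auto simp: AE_renewal_measure_nonneg)
  moreover have "\<forall>\<^sub>F x in at_top. U (x * a) / (LINT v|renewal_measure. exp (- (v / x))) = U (x * a) * \<Psi> x"
    using eventually_gt_at_top[of 0] by eventually_elim (simp add: L)
  ultimately show ?thesis by (simp add: tendsto_cong)
qed

lemma \<Phi>_rate_uniform:
  assumes k: "0 < k"
  shows "((\<lambda>i. \<Phi>_rate (clip (snd i)) (k / fst i) / \<Psi> (fst i / k)) \<longlongrightarrow> 1) uniformly_at_top"
proof (rule tendsto_sandwich)
  have x0: "\<forall>\<^sub>F i in uniformly_at_top. 0 < fst i"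
    by (rule eventually_filtercomapI[OF eventually_gt_at_top])
  have b: "1 - \<Psi> (fst i / k) / 2 \<le> \<Phi>_rate (clip (snd i)) (k / fst i) / \<Psi> (fst i / k)"
      "\<Phi>_rate (clip (snd i)) (k / fst i) / \<Psi> (fst i / k) \<le> 1" if "0 < fst i" for i
    using \<Phi>_rate_bounds[of "clip (snd i)" "k / fst i"] \<Psi>_pos[of "fst i / k"] clip_bounds[of "snd i"] that k
    by (auto simp: \<Psi>_def pos_divide_le_eq pos_le_divide_eq mult.commute)
  show "\<forall>\<^sub>F i in uniformly_at_top. 1 - \<Psi> (fst i / k) / 2 \<le> \<Phi>_rate (clip (snd i)) (k / fst i) / \<Psi> (fst i / k)"
    using x0 by eventually_elim (rule b)
  show "\<forall>\<^sub>F i in uniformly_at_top. \<Phi>_rate (clip (snd i)) (k / fst i) / \<Psi> (fst i / k) \<le> 1"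
    using x0 by eventually_elim (rule b)
  have "filterlim (\<lambda>x. x / k) at_top at_top"
    using filterlim_tendsto_pos_mult_at_top[OF tendsto_const, of "1 / k" "\<lambda>x. x" at_top] k by (simp add: filterlim_ident)
  from filterlim_compose[OF vanish this] have "((\<lambda>x. 1 - \<Psi> (x / k) / 2) \<longlongrightarrow> 1 - 0 / 2) at_top"
    by (intro tendsto_intros) auto
  then show "((\<lambda>i. 1 - \<Psi> (fst i / k) / 2) \<longlongrightarrow> 1) uniformly_at_top"
    using tendsto_uniformly_at_top_fst by fastforce
qed simp

text \<open>
  Karamata's theorem for the tail measure. Its Laplace transform is equivalent to
  \<open>\<Phi>(\<lambda>) / \<lambda>\<close>, which has index \<open>1 - \<alpha>\<close>.
\<close>

lemma truncated_mean_tauberian: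
  assumes a: "0 < a"
  shows "((\<lambda>i. truncated_mean_rate (clip (snd i)) (fst i * a) / (fst i * \<Psi> (fst i))) \<longlongrightarrow> a powr (1 - \<alpha>) / Gamma (2 - \<alpha>)) uniformly_at_top"
proof -
  let ?\<mu> = "\<lambda>i. tail_measure (clip (snd i))"
  have x0: "\<forall>\<^sub>F i in uniformly_at_top. 0 < fst i"
    by (rule eventually_filtercomapI[OF eventually_gt_at_top])
  note L = tail_laplace_scaled[where k = 1, simplified]
  have "((\<lambda>i. measure (?\<mu> i) {..fst i * a} / (LINT v|?\<mu> i. exp (- (v / fst i)))) \<longlongrightarrow> a powr (1 - \<alpha>) / Gamma (1 + (1 - \<alpha>))) uniformly_at_top"
  proof (rule karamata_tauberian)
    show "\<forall>\<^sub>F i in uniformly_at_top. 0 < fst i \<and> integrable (?\<mu> i) (\<lambda>v. exp (- (v / fst i))) \<and> 0 < (LINT v|?\<mu> i. exp (- (v / fst i)))"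
      using x0 by eventually_elim (simp add: L clip_bounds \<Phi>_rate_pos)
    fix k :: nat assume k: "1 \<le> k"
    have "((\<lambda>i. \<Phi>_rate (clip (snd i)) (real k / fst i) / \<Psi> (fst i / real k) / (\<Phi>_rate (clip (snd i)) (1 / fst i) / \<Psi> (fst i / 1))
        * (\<Psi> ((1 / real k) * fst i) / \<Psi> (fst i)) / real k) \<longlongrightarrow> 1 / 1 * (1 / real k) powr (- \<alpha>) / real k) uniformly_at_top"
      using k by (intro tendsto_intros \<Phi>_rate_uniform tendsto_uniformly_at_top_fst[OF regular]) auto
    moreover have "1 / 1 * (1 / real k) powr (- \<alpha>) / real k = real k powr (- (1 - \<alpha>))"
      using k by (simp add: powr_divide powr_minus powr_diff field_simps)
    moreover have "\<forall>\<^sub>F i in uniformly_at_top. \<Phi>_rate (clip (snd i)) (real k / fst i) / \<Psi> (fst i / real k) / (\<Phi>_rate (clip (snd i)) (1 / fst i) / \<Psi> (fst i / 1))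
        * (\<Psi> ((1 / real k) * fst i) / \<Psi> (fst i)) / real k =
        (LINT v|?\<mu> i. exp (- (real k * v / fst i))) / (LINT v|?\<mu> i. exp (- (v / fst i)))"
      using x0
    proof eventually_elim
      case (elim i)
      have "0 < \<Psi> (fst i)" "0 < \<Psi> (fst i / real k)" using elim k by (auto intro!: \<Psi>_pos)
      then show ?case using elim k by (simp add: L tail_laplace_scaled clip_bounds)
    qed
    ultimately show "((\<lambda>i. (LINT v|?\<mu> i. exp (- (real k * v / fst i))) / (LINT v|?\<mu> i. exp (- (v / fst i)))) \<longlongrightarrow> real k powr (- (1 - \<alpha>))) uniformly_at_top"
      by (simp add: tendsto_cong)
  qed (use \<alpha> a in \<open>auto simp: AE_tail_measure_nonneg clip_bounds\<close>)
  from tendsto_mult[OF this \<Phi>_rate_uniform[of 1]]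
  have "((\<lambda>i. measure (?\<mu> i) {..fst i * a} / (LINT v|?\<mu> i. exp (- (v / fst i))) * (\<Phi>_rate (clip (snd i)) (1 / fst i) / \<Psi> (fst i))) \<longlongrightarrow> a powr (1 - \<alpha>) / Gamma (2 - \<alpha>)) uniformly_at_top"
    by simp
  moreover have "\<forall>\<^sub>F i in uniformly_at_top. measure (?\<mu> i) {..fst i * a} / (LINT v|?\<mu> i. exp (- (v / fst i))) * (\<Phi>_rate (clip (snd i)) (1 / fst i) / \<Psi> (fst i)) =
      truncated_mean_rate (clip (snd i)) (fst i * a) / (fst i * \<Psi> (fst i))"
    using x0
  proof eventually_elim
    case (elim i)
    have "0 < \<Phi>_rate (clip (snd i)) (1 / fst i)" using elim by (intro \<Phi>_rate_pos clip_bounds) auto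
    then show ?case using elim a by (simp add: L clip_bounds measure_tail_measure)
  qed
  ultimately show ?thesis by (simp add: tendsto_cong)
qed

text \<open>
  Difference quotients of the truncated mean rate between \<open>x\<close> and
  \<open>(1 + \<delta>) x\<close> bound the tail rate from below, those between
  \<open>(1 - \<delta>) x\<close> and \<open>x\<close> bound it from above.
\<close>

lemma tail_rate_tauberian:
  "((\<lambda>i. tail_rate (clip (snd i)) (fst i) / \<Psi> (fst i)) \<longlongrightarrow> 1 / Gamma (1 - \<alpha>)) uniformly_at_top"
proof -
  have x0: "\<forall>\<^sub>F i in uniformly_at_top. 0 < fst i"
    by (rule eventually_filtercomapI[OF eventually_gt_at_top])
  let ?w = "\<lambda>b i. truncated_mean_rate (clip (snd i)) (fst i * b) / (fst i * \<Psi> (fst i))"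
  have G: "Gamma (2 - \<alpha>) = (1 - \<alpha>) * Gamma (1 - \<alpha>)" using Gamma_shift[of "1 - \<alpha>"] \<alpha> by simp
  have G2: "Gamma (2 - \<alpha>) \<noteq> 0" using Gamma_real_pos[of "2 - \<alpha>"] \<alpha> by linarith
  have lim: "((\<lambda>\<delta>. ((1 + a * \<delta>) powr (1 - \<alpha>) - (1 + b * \<delta>) powr (1 - \<alpha>)) / \<delta> / Gamma (2 - \<alpha>)) \<longlongrightarrow> 1 / Gamma (1 - \<alpha>)) (at_right 0)"
    if "a - b = 1" for a b
  proof -
    have "((\<lambda>\<delta>. ((1 + a * \<delta>) powr (1 - \<alpha>) - (1 + b * \<delta>) powr (1 - \<alpha>)) / \<delta> / Gamma (2 - \<alpha>)) \<longlongrightarrow> (a - b) * (1 - \<alpha>) / Gamma (2 - \<alpha>)) (at_right 0)"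
      using G2 by (intro tendsto_divide powr_difference_quotient tendsto_const)
    moreover have "(a - b) * (1 - \<alpha>) / Gamma (2 - \<alpha>) = 1 / Gamma (1 - \<alpha>)"
      using that \<alpha> unfolding G by simp
    ultimately show ?thesis by simp
  qed
  show ?thesis
  proof (rule family_squeeze[of 1])
    fix \<delta> :: real assume \<delta>: "0 < \<delta>" "\<delta> < 1"
    show "\<exists>g. (\<forall>\<^sub>F i in uniformly_at_top. g i \<le> tail_rate (clip (snd i)) (fst i) / \<Psi> (fst i)) \<and>
        (g \<longlongrightarrow> ((1 + 1 * \<delta>) powr (1 - \<alpha>) - (1 + 0 * \<delta>) powr (1 - \<alpha>)) / \<delta> / Gamma (2 - \<alpha>)) uniformly_at_top"
    proof (intro exI conjI)
      have "((\<lambda>i. (?w (1 + \<delta>) i - ?w 1 i) / \<delta>) \<longlongrightarrow> ((1 + \<delta>) powr (1 - \<alpha>) / Gamma (2 - \<alpha>) - 1 powr (1 - \<alpha>) / Gamma (2 - \<alpha>)) / \<delta>) uniformly_at_top"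
        using \<delta> by (intro tendsto_divide tendsto_diff truncated_mean_tauberian tendsto_const) auto
      then show "((\<lambda>i. (?w (1 + \<delta>) i - ?w 1 i) / \<delta>) \<longlongrightarrow> ((1 + 1 * \<delta>) powr (1 - \<alpha>) - (1 + 0 * \<delta>) powr (1 - \<alpha>)) / \<delta> / Gamma (2 - \<alpha>)) uniformly_at_top"
        by (simp add: diff_divide_distrib mult.commute)
      show "\<forall>\<^sub>F i in uniformly_at_top. (?w (1 + \<delta>) i - ?w 1 i) / \<delta> \<le> tail_rate (clip (snd i)) (fst i) / \<Psi> (fst i)"
        using x0
      proof eventually_elim
        case (elim i)
        have p: "0 < \<delta> * fst i * \<Psi> (fst i)" using elim \<delta> \<Psi>_pos[of "fst i"] by simp
        have "truncated_mean_rate (clip (snd i)) ((1 + \<delta>) * fst i) - truncated_mean_rate (clip (snd i)) (fst i) \<le> (1 + \<delta> - 1) * fst i * tail_rate (clip (snd i)) (fst i)"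
          using elim \<delta> by (intro tail_rate_lower clip_bounds) auto
        then have "(truncated_mean_rate (clip (snd i)) (fst i * (1 + \<delta>)) - truncated_mean_rate (clip (snd i)) (fst i)) / (\<delta> * fst i * \<Psi> (fst i)) \<le>
            (\<delta> * fst i * tail_rate (clip (snd i)) (fst i)) / (\<delta> * fst i * \<Psi> (fst i))"
          using p by (intro divide_right_mono) (simp_all add: mult.commute)
        also have "\<dots> = tail_rate (clip (snd i)) (fst i) / \<Psi> (fst i)" using elim \<delta> by simp
        finally have "(truncated_mean_rate (clip (snd i)) (fst i * (1 + \<delta>)) - truncated_mean_rate (clip (snd i)) (fst i)) / (\<delta> * fst i * \<Psi> (fst i)) \<le> tail_rate (clip (snd i)) (fst i) / \<Psi> (fst i)" .
        then show ?case using elim \<delta> by (simp add: diff_divide_distrib mult_ac)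
      qed
    qed
    show "\<exists>g. (\<forall>\<^sub>F i in uniformly_at_top. tail_rate (clip (snd i)) (fst i) / \<Psi> (fst i) \<le> g i) \<and>
        (g \<longlongrightarrow> ((1 + 0 * \<delta>) powr (1 - \<alpha>) - (1 + (- 1) * \<delta>) powr (1 - \<alpha>)) / \<delta> / Gamma (2 - \<alpha>)) uniformly_at_top"
    proof (intro exI conjI)
      have "((\<lambda>i. (?w 1 i - ?w (1 - \<delta>) i) / \<delta>) \<longlongrightarrow> (1 powr (1 - \<alpha>) / Gamma (2 - \<alpha>) - (1 - \<delta>) powr (1 - \<alpha>) / Gamma (2 - \<alpha>)) / \<delta>) uniformly_at_top"
        using \<delta> by (intro tendsto_divide tendsto_diff truncated_mean_tauberian tendsto_const) auto
      then show "((\<lambda>i. (?w 1 i - ?w (1 - \<delta>) i) / \<delta>) \<longlongrightarrow> ((1 + 0 * \<delta>) powr (1 - \<alpha>) - (1 + (- 1) * \<delta>) powr (1 - \<alpha>)) / \<delta> / Gamma (2 - \<alpha>)) uniformly_at_top"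
        by (simp add: diff_divide_distrib mult.commute)
      show "\<forall>\<^sub>F i in uniformly_at_top. tail_rate (clip (snd i)) (fst i) / \<Psi> (fst i) \<le> (?w 1 i - ?w (1 - \<delta>) i) / \<delta>"
        using x0
      proof eventually_elim
        case (elim i)
        have p: "0 < \<delta> * fst i * \<Psi> (fst i)" using elim \<delta> \<Psi>_pos[of "fst i"] by simp
        have "(1 - (1 - \<delta>)) * fst i * tail_rate (clip (snd i)) (fst i) \<le> truncated_mean_rate (clip (snd i)) (fst i) - truncated_mean_rate (clip (snd i)) ((1 - \<delta>) * fst i)"
          using elim \<delta> by (intro tail_rate_upper clip_bounds) auto
        then have "(\<delta> * fst i * tail_rate (clip (snd i)) (fst i)) / (\<delta> * fst i * \<Psi> (fst i)) \<le> (truncated_mean_rate (clip (snd i)) (fst i) - truncated_mean_rate (clip (snd i)) (fst i * (1 - \<delta>))) / (\<delta> * fst i * \<Psi> (fst i))"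
          using p by (intro divide_right_mono) (simp_all add: mult.commute)
        moreover have "(\<delta> * fst i * tail_rate (clip (snd i)) (fst i)) / (\<delta> * fst i * \<Psi> (fst i)) = tail_rate (clip (snd i)) (fst i) / \<Psi> (fst i)" using elim \<delta> by simp
        ultimately have "tail_rate (clip (snd i)) (fst i) / \<Psi> (fst i) \<le> (truncated_mean_rate (clip (snd i)) (fst i) - truncated_mean_rate (clip (snd i)) (fst i * (1 - \<delta>))) / (\<delta> * fst i * \<Psi> (fst i))" by simp
        then show ?case using elim \<delta> by (simp add: diff_divide_distrib mult_ac)
      qed
    qed
  qed (use lim[of 1 0] lim[of 0 "-1"] in simp_all)
qed

end

end

section \<open>Bounds without regular variation\<close>

lemma ex_powr_ge: "0 < s \<Longrightarrow> \<exists>K>1. M \<le> K powr (s::real)"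
proof -
  assume s: "0 < s"
  define K where "K = max 2 (max M 1 powr (1 / s))"
  have "max M 1 = (max M 1 powr (1 / s)) powr s" using s by (simp add: powr_powr)
  also have "\<dots> \<le> K powr s" using s by (intro powr_mono2) (auto simp: K_def)
  finally show ?thesis by (intro exI[of _ K]) (auto simp: K_def)
qed

lemma cancel_scales:
  fixes m :: real
  assumes "\<delta> \<noteq> 0" "t \<noteq> 0" "e \<noteq> 0" "p \<noteq> 0" "q \<noteq> 0"
  shows "m / (\<delta> * t) * (c * (e * p)) / (e / t * (p / q)) = m * q / \<delta> * c"
  using assms by (simp add: field_simps)

lemma dist_real_bounds:
  fixes z L \<delta> :: real
  assumes "dist z L < \<delta>"
  shows "L - \<delta> \<le> z" "z \<le> L + \<delta>"
  using assms by (auto simp: dist_real_def)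

lemma cancel_ratio:
  fixes m :: real
  assumes "p \<noteq> 0" "q \<noteq> 0"
  shows "m * (c * p) / (p / q) = m * q * c"
  using assms by (simp add: field_simps)

lemma Gamma_reflection_sin:
  fixes a :: real
  assumes a: "0 < a" "a < 1"
  shows "1 / Gamma (1 + a) * (1 / Gamma (1 - a)) = sin (pi * a) / (pi * a)"
proof -
  have "complex_of_real (rGamma a * rGamma (1 - a)) = complex_of_real (sin (pi * a) / pi)"
  proof -
    have "complex_of_real (rGamma a * rGamma (1 - a)) = rGamma (complex_of_real a) * rGamma (complex_of_real (1 - a))"
      by (simp only: of_real_mult rGamma_complex_of_real)
    also have "\<dots> = sin (complex_of_real (pi * a)) / complex_of_real pi"
      using rGamma_reflection_complex[of "complex_of_real a"] by simp
    also have "\<dots> = complex_of_real (sin (pi * a) / pi)"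
      by (simp only: sin_of_real of_real_divide)
    finally show ?thesis .
  qed
  then have "rGamma a * rGamma (1 - a) = sin (pi * a) / pi" by (simp only: of_real_eq_iff)
  then have "1 / Gamma a * (1 / Gamma (1 - a)) = sin (pi * a) / pi"
    by (simp add: rGamma_inverse_Gamma inverse_eq_divide)
  moreover have "Gamma (1 + a) = a * Gamma a" using a by (intro Gamma_shift) auto
  ultimately show ?thesis using a by (simp add: field_simps)
qed

context subordinator
begin

lemma measure_renewal_interval:
  assumes "a \<le> b"
  shows "measure renewal_measure {a<..b} = U b - U a"
proof -
  have "{a<..b} = {..b} - {..a}" by auto
  then show ?thesis
    using assms emeasure_renewal_measure_finite[of b] emeasure_renewal_measure_finite[of a]
    by (simp only:) (intro measure_Diff, auto)
qed

text \<open>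
  The upper bound is the exponential Markov inequality. For the lower one, the Laplace transform at
  \<open>4 / y\<close> is split at \<open>y\<close>; beyond \<open>y\<close>, the integrand is at
  most \<open>exp (- 2)\<close> times that at \<open>2 / y\<close>, and halving the frequency at
  most doubles the transform. So the part beyond \<open>y\<close> is at most half of the total.
\<close>

lemma renewal_bounds:
  assumes y: "0 < y"
  shows "U y * \<Psi> y \<le> exp 1" "1 / 8 \<le> U y * \<Psi> y"
proof -
  have \<Psi>y: "0 < \<Psi> y" using y by (rule \<Psi>_pos)
  note L = renewal_laplace_scaled[OF y zero_less_one, simplified]
  have "U y \<le> exp 1 * (1 / \<Psi> y)"
    using measure_le_laplace[OF sets_renewal_measure y L(1)] L(2) by simp
  then show "U y * \<Psi> y \<le> exp 1" using \<Psi>y by (simp add: pos_le_divide_eq)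
  have int: "integrable renewal_measure (\<lambda>v. exp (- (k * v / y)))" if "0 < k" for k
    using renewal_laplace_scaled(1)[OF y that] .
  have ind: "integrable renewal_measure (\<lambda>v. indicator {..y} v :: real)"
    using emeasure_renewal_measure_finite[of y] by (intro integrable_real_indicator) auto
  have sp: "space renewal_measure = UNIV" using sets_eq_imp_space_eq[OF sets_renewal_measure] by simp
  have pw: "exp (- (4 * v / y)) \<le> indicator {..y} v + exp (-2) * exp (- (2 * v / y))" if v: "0 \<le> v" for v
  proof (cases "v \<le> y")
    case True
    then show ?thesis using v y by (simp add: add_increasing2)
  next
    case False
    have "exp (- (4 * v / y)) \<le> exp (- 2 + - (2 * v / y))" using y False by (simp add: field_simps)
    also have "exp (- 2 + - (2 * v / y)) = exp (- 2) * exp (- (2 * v / y))" by (rule exp_add)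
    finally show ?thesis using False by simp
  qed
  have "1 / \<Psi> (y / 4) = (LINT v|renewal_measure. exp (- (4 * v / y)))"
    using renewal_laplace_scaled(2)[OF y, of 4] by simp
  also have "\<dots> \<le> (LINT v|renewal_measure. indicator {..y} v + exp (-2) * exp (- (2 * v / y)))"
  proof (intro integral_mono_AE Bochner_Integration.integrable_add integrable_mult_right int ind)
    show "AE v in renewal_measure. exp (- (4 * v / y)) \<le> indicator {..y} v + exp (-2) * exp (- (2 * v / y))"
      using AE_renewal_measure_nonneg by eventually_elim (rule pw)
  qed auto
  also have "\<dots> = U y + exp (-2) * (1 / \<Psi> (y / 2))"
    using int[of 2] ind renewal_laplace_scaled(2)[OF y, of 2] by (simp add: sp)
  finally have "1 / \<Psi> (y / 4) \<le> U y + exp (-2) * (1 / \<Psi> (y / 2))" .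
  moreover have "exp (-2) * (1 / \<Psi> (y / 2)) \<le> 1 / 2 * (1 / \<Psi> (y / 4))"
  proof -
    have p: "0 < \<Psi> (y / 4)" "0 < \<Psi> (y / 2)" using y by (auto intro!: \<Psi>_pos)
    have "(1 + 1) * (1 + 1) \<le> exp 1 * (exp 1 :: real)" using exp_ge_add_one_self[of 1] by (intro mult_mono) auto
    then have "4 \<le> exp (2::real)" by (simp add: exp_add[symmetric])
    then have e: "exp (-2) \<le> 1 / (4 :: real)" by (simp add: exp_minus field_simps)
    have "\<Psi> (y / 4) \<le> 2 * \<Psi> (y / 2)" using \<Psi>_scale[of "y / 4" "y / 2"] y by simp
    then have "1 / \<Psi> (y / 2) \<le> 2 * (1 / \<Psi> (y / 4))" using p by (simp add: field_simps)
    then have "exp (-2) * (1 / \<Psi> (y / 2)) \<le> 1 / 4 * (2 * (1 / \<Psi> (y / 4)))"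
      using e p by (intro mult_mono) auto
    then show ?thesis by simp
  qed
  ultimately have "1 / 2 * (1 / \<Psi> (y / 4)) \<le> U y" by linarith
  moreover have "1 / 4 * (1 / \<Psi> y) \<le> 1 / \<Psi> (y / 4)"
  proof -
    have "\<Psi> (y / 4) \<le> 4 * \<Psi> y" using \<Psi>_scale[of "y / 4" y] y by simp
    moreover have "0 < \<Psi> (y / 4)" using y by (intro \<Psi>_pos) auto
    ultimately show ?thesis using \<Psi>y by (simp add: field_simps)
  qed
  ultimately have "1 / 8 * (1 / \<Psi> y) \<le> U y" by linarith
  then have "1 / 8 * (1 / \<Psi> y) * \<Psi> y \<le> U y * \<Psi> y" using \<Psi>y by (intro mult_right_mono) auto
  then show "1 / 8 \<le> U y * \<Psi> y" using \<Psi>y by simp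
qed

lemma truncated_mean_bounds:
  assumes h: "0 < h" "h \<le> 1" and y: "0 < y"
  shows "truncated_mean_rate h y \<le> exp 1 * (y * \<Psi> y)"
    and "\<Psi> y < 1 \<Longrightarrow> y / 2 * \<Psi> y \<le> truncated_mean_rate h y"
proof -
  have \<Psi>y: "0 < \<Psi> y" using y by (rule \<Psi>_pos)
  have r: "\<Phi>_rate h (1 / y) \<le> \<Psi> y" "\<Psi> y * (1 - \<Psi> y / 2) \<le> \<Phi>_rate h (1 / y)"
    using \<Phi>_rate_bounds[OF h, of "1 / y"] y by (auto simp: \<Psi>_def)
  note L = tail_laplace_scaled[OF h(1) y zero_less_one, simplified]
  have "truncated_mean_rate h y \<le> exp 1 * (y * \<Phi>_rate h (1 / y))"
    using measure_le_laplace[OF sets_tail_measure y L(1)] measure_tail_measure[OF h(1), of y] y L(2) by simp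
  also have "\<dots> \<le> exp 1 * (y * \<Psi> y)" using r y by (intro mult_left_mono) auto
  finally show "truncated_mean_rate h y \<le> exp 1 * (y * \<Psi> y)" .
  show "y / 2 * \<Psi> y \<le> truncated_mean_rate h y" if s: "\<Psi> y < 1"
  proof -
    have int: "integrable M (\<lambda>w. exp (- (1 / y * X h w)))" using h y by (intro integrable_exp_X) auto
    have int': "integrable M (\<lambda>w. min y (X h w))" using h y by (intro integrable_min_X) auto
    have "\<Psi> y * (1 / 2) \<le> \<Psi> y * (1 - \<Psi> y / 2)" using s \<Psi>y by (intro mult_left_mono) auto
    then have "y / 2 * \<Psi> y \<le> y * \<Phi>_rate h (1 / y)"
      using r(2) y mult_left_mono[of "\<Psi> y * (1 / 2)" "\<Phi>_rate h (1 / y)" y] by simp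
    also have "\<dots> = expectation (\<lambda>w. y * (1 - exp (- (1 / y * X h w)))) / h"
      using int laplace[of "1 / y" h] h y by (simp add: \<Phi>_rate_def prob_space mult.commute)
    also have "\<dots> \<le> truncated_mean_rate h y"
      unfolding truncated_mean_rate_def
    proof (intro divide_right_mono integral_mono int' integrable_mult_right Bochner_Integration.integrable_diff int)
      fix w assume w: "w \<in> space M"
      have "1 - exp (- (1 / y * X h w)) \<le> 1 / y * X h w" using exp_ge_add_one_self[of "- (1 / y * X h w)"] by simp
      then have "y * (1 - exp (- (1 / y * X h w))) \<le> y * (1 / y * X h w)" using y by (intro mult_left_mono) auto
      then show "y * (1 - exp (- (1 / y * X h w))) \<le> min y (X h w)" using y by simp
    qed (use h in auto)
    finally show ?thesis .
  qed
qed

lemma tail_rate_bound: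
  assumes h: "0 < h" "h \<le> 1" and x: "0 < x"
  shows "tail_rate h x \<le> exp 1 * \<Psi> x"
proof -
  have "truncated_mean_rate h 0 = 0"
  proof -
    have "expectation (\<lambda>w. min 0 (X h w)) = expectation (\<lambda>w. 0)"
      using X_nonneg[of h] h by (intro Bochner_Integration.integral_cong) auto
    then show ?thesis by (simp add: truncated_mean_rate_def)
  qed
  then have "x * tail_rate h x \<le> truncated_mean_rate h x" using tail_rate_upper[OF h(1) x, of 0] by simp
  also have "\<dots> \<le> exp 1 * (x * \<Psi> x)" by (rule truncated_mean_bounds(1)[OF h x])
  finally have "x * tail_rate h x \<le> x * (exp 1 * \<Psi> x)" by (simp add: mult_ac)
  then show ?thesis using x by simp
qed

section \<open>Undershoot under regular variation\<close>

context
  fixes \<tau> :: "real \<Rightarrow> 'w \<Rightarrow> ereal" and y :: "real \<Rightarrow> real"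
  assumes \<tau>: "\<And>s w. 0 \<le> s \<Longrightarrow> w \<in> space M \<Longrightarrow> \<tau> s w = ereal (X s w)"
    and level_range: "\<And>t. 0 < t \<Longrightarrow> 0 < y t" "\<And>t. 0 < t \<Longrightarrow> y t < t"
    and y_small: "((\<lambda>t. y t / t) \<longlongrightarrow> 0) at_top"
    and y_top: "filterlim y at_top at_top"
begin

lemma eventually_gap:
  assumes "0 < \<delta>"
  shows "\<forall>\<^sub>F t in at_top. y t < \<delta> * t"
  using order_tendstoD(2)[OF y_small assms] eventually_gt_at_top[of 0]
  by eventually_elim (simp add: pos_divide_less_eq)

lemma gap_ratio: "((\<lambda>t. t / (t - y t)) \<longlongrightarrow> 1) at_top"
proof -
  have "((\<lambda>t. 1 / (1 - y t / t)) \<longlongrightarrow> 1 / (1 - 0)) at_top"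
    by (intro tendsto_intros y_small) simp
  moreover have "\<forall>\<^sub>F t in at_top. 1 / (1 - y t / t) = t / (t - y t)"
    using eventually_gt_at_top[of 0] by eventually_elim (simp add: field_simps)
  ultimately show ?thesis by (simp add: tendsto_cong)
qed

lemma gap_at_top: "filterlim (\<lambda>t. t - y t) at_top at_top"
proof (rule filterlim_at_top_mono)
  show "filterlim (\<lambda>t::real. 1 / 2 * t) at_top at_top"
    by (rule filterlim_tendsto_pos_mult_at_top[OF tendsto_const _ filterlim_ident]) simp
  show "\<forall>\<^sub>F t in at_top. 1 / 2 * t \<le> t - y t"
  proof -
    have "\<forall>\<^sub>F t in at_top. y t < 1 / 2 * t" by (rule eventually_gap) simp
    then show ?thesis by eventually_elim simp
  qed
qed

context
  fixes \<alpha> :: real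
  assumes \<alpha>: "0 < \<alpha>" "\<alpha> < 1"
    and vanish: "(\<Psi> \<longlongrightarrow> 0) at_top"
    and regular: "\<And>c. 0 < c \<Longrightarrow> ((\<lambda>x. \<Psi> (c * x) / \<Psi> x) \<longlongrightarrow> c powr (- \<alpha>)) at_top"
begin

text \<open>
  The bounds contain the tail rate at \<open>t\<close> and at \<open>t - y\<close>. Both are
  equivalent because \<open>y / t \<longrightarrow> 0\<close> and \<open>\<Psi>\<close> changes at
  most by the ratio of its arguments.
\<close>

lemma undershoot_small_limit:
  "((\<lambda>t. prob {w \<in> space M. undershoot \<tau> t w \<le> ereal (y t)} / (\<Psi> t / \<Psi> (y t))) \<longlongrightarrow>
     1 / Gamma (1 + \<alpha>) * (1 / Gamma (1 - \<alpha>))) at_top"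
proof -
  let ?P = "\<lambda>t. prob {w \<in> space M. undershoot \<tau> t w \<le> ereal (y t)}"
  define L where "L = 1 / Gamma (1 - \<alpha>)"
  have L0: "0 < L" using \<alpha> by (simp add: L_def Gamma_real_pos)
  define u where "u t = U (y t) * \<Psi> (y t)" for t
  have u: "(u \<longlongrightarrow> 1 / Gamma (1 + \<alpha>)) at_top"
    using filterlim_compose[OF renewal_tauberian[OF \<alpha> vanish regular, of 1] y_top] unfolding u_def by simp
  have tail: "\<forall>\<^sub>F x in at_top. \<forall>h. 0 < h \<longrightarrow> h \<le> 1 \<longrightarrow> dist (tail_rate h x / \<Psi> x) L < \<delta>" if "0 < \<delta>" for \<delta>
    using tendstoD[OF tail_rate_tauberian[OF \<alpha> vanish regular] that] unfolding L_def[symmetric]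
    by (rule eventually_uniformly_at_topD)
  show ?thesis
    unfolding L_def[symmetric]
  proof (rule family_squeeze[of 1])
    fix \<delta> :: real assume \<delta>: "0 < \<delta>" "\<delta> < 1"
    show "\<exists>g. (\<forall>\<^sub>F t in at_top. g t \<le> ?P t / (\<Psi> t / \<Psi> (y t))) \<and>
        (g \<longlongrightarrow> 1 / Gamma (1 + \<alpha>) * max 0 (L - \<delta>)) at_top"
    proof (intro exI conjI)
      show "((\<lambda>t. u t * max 0 (L - \<delta>)) \<longlongrightarrow> 1 / Gamma (1 + \<alpha>) * max 0 (L - \<delta>)) at_top"
        by (intro tendsto_mult u tendsto_const)
      show "\<forall>\<^sub>F t in at_top. u t * max 0 (L - \<delta>) \<le> ?P t / (\<Psi> t / \<Psi> (y t))"
        using tail[OF \<delta>(1)] eventually_gt_at_top[of 0]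
      proof eventually_elim
        case (elim t)
        note lb = level_range[OF elim(2)]
        have \<Psi>t: "0 < \<Psi> t" "0 < \<Psi> (y t)" using elim lb by (auto intro!: \<Psi>_pos)
        have "U (y t) * (max 0 (L - \<delta>) * \<Psi> t) \<le> ?P t"
        proof (rule undershoot_small_lower[OF \<tau> elim(2) _ lb(2)])
          fix h :: real assume h: "0 < h" "h \<le> 1"
          have "dist (tail_rate h t / \<Psi> t) L < \<delta>" using elim h by blast
          then have "L - \<delta> \<le> tail_rate h t / \<Psi> t" by (auto simp: dist_real_def)
          moreover have "0 \<le> tail_rate h t / \<Psi> t" using tail_rate_nonneg[OF h(1)] \<Psi>t by simp
          ultimately have "max 0 (L - \<delta>) \<le> tail_rate h t / \<Psi> t" by simp
          then show "max 0 (L - \<delta>) * \<Psi> t \<le> tail_rate h t" by (simp only: pos_le_divide_eq[OF \<Psi>t(1)])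
        qed (use lb \<Psi>t in auto)
        then have "U (y t) * (max 0 (L - \<delta>) * \<Psi> t) / (\<Psi> t / \<Psi> (y t)) \<le> ?P t / (\<Psi> t / \<Psi> (y t))"
          using \<Psi>t elim(2) by (intro divide_right_mono) auto
        moreover have "U (y t) * (max 0 (L - \<delta>) * \<Psi> t) / (\<Psi> t / \<Psi> (y t)) = u t * max 0 (L - \<delta>)"
          unfolding u_def using \<Psi>t by (intro cancel_ratio) auto
        ultimately show ?case by simp
      qed
    qed
    show "\<exists>g. (\<forall>\<^sub>F t in at_top. ?P t / (\<Psi> t / \<Psi> (y t)) \<le> g t) \<and>
        (g \<longlongrightarrow> 1 / Gamma (1 + \<alpha>) * (L + \<delta>)) at_top"
    proof (intro exI conjI)
      have "((\<lambda>t. u t * ((L + \<delta>) * (t / (t - y t)))) \<longlongrightarrow> 1 / Gamma (1 + \<alpha>) * ((L + \<delta>) * 1)) at_top"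
        by (intro tendsto_mult u tendsto_const gap_ratio)
      then show "((\<lambda>t. u t * ((L + \<delta>) * (t / (t - y t)))) \<longlongrightarrow> 1 / Gamma (1 + \<alpha>) * (L + \<delta>)) at_top" by simp
      show "\<forall>\<^sub>F t in at_top. ?P t / (\<Psi> t / \<Psi> (y t)) \<le> u t * ((L + \<delta>) * (t / (t - y t)))"
        using eventually_compose_filterlim[OF tail[OF \<delta>(1)] gap_at_top] eventually_gt_at_top[of 0]
      proof eventually_elim
        case (elim t)
        note lb = level_range[OF elim(2)]
        have \<Psi>t: "0 < \<Psi> t" "0 < \<Psi> (y t)" "0 < \<Psi> (t - y t)" using elim lb by (auto intro!: \<Psi>_pos)
        have sc: "\<Psi> (t - y t) \<le> t / (t - y t) * \<Psi> t" using lb by (intro \<Psi>_scale) auto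
        have "?P t \<le> U (y t) * ((L + \<delta>) * (t / (t - y t) * \<Psi> t))"
        proof (rule undershoot_small_upper[OF \<tau> elim(2) _ lb(2)])
          fix h :: real assume h: "0 < h" "h \<le> 1"
          have "dist (tail_rate h (t - y t) / \<Psi> (t - y t)) L < \<delta>" using elim h by blast
          then have "tail_rate h (t - y t) / \<Psi> (t - y t) \<le> L + \<delta>" unfolding dist_real_def by linarith
          then have "tail_rate h (t - y t) \<le> (L + \<delta>) * \<Psi> (t - y t)" using \<Psi>t by (simp add: pos_divide_le_eq)
          also have "\<dots> \<le> (L + \<delta>) * (t / (t - y t) * \<Psi> t)" using sc L0 \<delta> by (intro mult_left_mono) auto
          finally show "tail_rate h (t - y t) \<le> (L + \<delta>) * (t / (t - y t) * \<Psi> t)" .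
        qed (use lb in auto)
        then have "?P t / (\<Psi> t / \<Psi> (y t)) \<le>
            U (y t) * ((L + \<delta>) * (t / (t - y t) * \<Psi> t)) / (\<Psi> t / \<Psi> (y t))"
          using \<Psi>t elim(2) by (intro divide_right_mono) auto
        also have "\<dots> = u t * ((L + \<delta>) * (t / (t - y t)))"
          unfolding u_def mult.assoc[symmetric, of "L + \<delta>"] using \<Psi>t by (intro cancel_ratio) auto
        finally show ?case by simp
      qed
    qed
  next
    have "((\<lambda>\<delta>. 1 / Gamma (1 + \<alpha>) * max 0 (L - \<delta>)) \<longlongrightarrow> 1 / Gamma (1 + \<alpha>) * max 0 (L - 0)) (at_right 0)"
      by (intro tendsto_intros)
    then show "((\<lambda>\<delta>. 1 / Gamma (1 + \<alpha>) * max 0 (L - \<delta>)) \<longlongrightarrow> 1 / Gamma (1 + \<alpha>) * L) (at_right 0)" using L0 by simp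
    have "((\<lambda>\<delta>. 1 / Gamma (1 + \<alpha>) * (L + \<delta>)) \<longlongrightarrow> 1 / Gamma (1 + \<alpha>) * (L + 0)) (at_right 0)"
      by (intro tendsto_intros)
    then show "((\<lambda>\<delta>. 1 / Gamma (1 + \<alpha>) * (L + \<delta>)) \<longlongrightarrow> 1 / Gamma (1 + \<alpha>) * L) (at_right 0)" by simp
  qed simp
qed

text \<open>
  The slope of \<open>U\<close> on \<open>(t - y, t]\<close> is bounded below by its average over
  \<open>(t, (1 + \<delta>) t]\<close> and above by that over
  \<open>((1 - 2 \<delta>) t, (1 - \<delta>) t]\<close>, which lies to the left of
  \<open>t - y\<close> as \<open>y / t \<longrightarrow> 0\<close>.
\<close>

lemma undershoot_large_limit:
  assumes compare: "\<And>a b c d. 0 \<le> a \<Longrightarrow> a < b \<Longrightarrow> b \<le> c \<Longrightarrow> c < d \<Longrightarrow>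
      (b - a) * measure renewal_measure {c<..d} \<le> (d - c) * measure renewal_measure {a<..b}"
  shows "((\<lambda>t. prob {w \<in> space M. ereal (t - y t) \<le> undershoot \<tau> t w} / (y t / t * (\<Psi> (y t) / \<Psi> t))) \<longlongrightarrow>
     1 / Gamma \<alpha> * (1 / Gamma (2 - \<alpha>))) at_top"
proof -
  let ?P = "\<lambda>t. prob {w \<in> space M. ereal (t - y t) \<le> undershoot \<tau> t w}"
  define L where "L = 1 / Gamma (2 - \<alpha>)"
  have L0: "0 < L" using \<alpha> by (simp add: L_def Gamma_real_pos)
  have mean: "\<forall>\<^sub>F t in at_top. \<forall>h. 0 < h \<longrightarrow> h \<le> 1 \<longrightarrow> dist (truncated_mean_rate h (y t) / (y t * \<Psi> (y t))) L < \<delta>" if "0 < \<delta>" for \<delta>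
  proof -
    have "\<forall>\<^sub>F x in at_top. \<forall>h. 0 < h \<longrightarrow> h \<le> 1 \<longrightarrow> dist (truncated_mean_rate h (x * 1) / (x * \<Psi> x)) (1 powr (1 - \<alpha>) / Gamma (2 - \<alpha>)) < \<delta>"
      using tendstoD[OF truncated_mean_tauberian[OF \<alpha> vanish regular zero_less_one] that]
      by (rule eventually_uniformly_at_topD)
    from eventually_compose_filterlim[OF this y_top] show ?thesis by (simp add: L_def)
  qed
  define k where "k a b t = (U (t * a) - U (t * b)) * \<Psi> t" for a b t
  have k: "(k a b \<longlongrightarrow> (a powr \<alpha> - b powr \<alpha>) / Gamma (1 + \<alpha>)) at_top" if "0 < a" "0 < b" for a b
  proof -
    have "((\<lambda>t. U (t * a) * \<Psi> t - U (t * b) * \<Psi> t) \<longlongrightarrow> a powr \<alpha> / Gamma (1 + \<alpha>) - b powr \<alpha> / Gamma (1 + \<alpha>)) at_top"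
      using that by (intro tendsto_diff renewal_tauberian[OF \<alpha> vanish regular])
    then show ?thesis unfolding k_def by (simp add: left_diff_distrib diff_divide_distrib)
  qed
  note G = Gamma_shift[OF \<alpha>(1)]
  have G0: "Gamma (1 + \<alpha>) \<noteq> 0" using Gamma_real_pos[of "1 + \<alpha>"] \<alpha> by linarith
  have lim: "((\<lambda>\<delta>. ((1 + a * \<delta>) powr \<alpha> - (1 + b * \<delta>) powr \<alpha>) / \<delta> / Gamma (1 + \<alpha>)) \<longlongrightarrow> 1 / Gamma \<alpha>) (at_right 0)"
    if "a - b = 1" for a b
  proof -
    have "((\<lambda>\<delta>. ((1 + a * \<delta>) powr \<alpha> - (1 + b * \<delta>) powr \<alpha>) / \<delta> / Gamma (1 + \<alpha>)) \<longlongrightarrow> (a - b) * \<alpha> / Gamma (1 + \<alpha>)) (at_right 0)"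
      using G0 by (intro tendsto_divide powr_difference_quotient tendsto_const)
    moreover have "(a - b) * \<alpha> / Gamma (1 + \<alpha>) = 1 / Gamma \<alpha>"
      using that \<alpha> unfolding G by simp
    ultimately show ?thesis by simp
  qed
  show ?thesis
    unfolding L_def[symmetric]
  proof (rule family_squeeze[of "1/2"])
    fix \<delta> :: real assume \<delta>: "0 < \<delta>" "\<delta> < 1 / 2"
    show "\<exists>g. (\<forall>\<^sub>F t in at_top. g t \<le> ?P t / (y t / t * (\<Psi> (y t) / \<Psi> t))) \<and>
        (g \<longlongrightarrow> ((1 + 1 * \<delta>) powr \<alpha> - (1 + 0 * \<delta>) powr \<alpha>) / \<delta> / Gamma (1 + \<alpha>) * max 0 (L - \<delta>)) at_top"
    proof (intro exI conjI)
      have "((\<lambda>t. k (1 + \<delta>) 1 t / \<delta> * max 0 (L - \<delta>)) \<longlongrightarrow> ((1 + \<delta>) powr \<alpha> - 1 powr \<alpha>) / Gamma (1 + \<alpha>) / \<delta> * max 0 (L - \<delta>)) at_top"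
        using \<delta> by (intro tendsto_mult tendsto_divide k tendsto_const) auto
      then show "((\<lambda>t. k (1 + \<delta>) 1 t / \<delta> * max 0 (L - \<delta>)) \<longlongrightarrow> ((1 + 1 * \<delta>) powr \<alpha> - (1 + 0 * \<delta>) powr \<alpha>) / \<delta> / Gamma (1 + \<alpha>) * max 0 (L - \<delta>)) at_top"
        by (simp add: mult.commute)
      show "\<forall>\<^sub>F t in at_top. k (1 + \<delta>) 1 t / \<delta> * max 0 (L - \<delta>) \<le> ?P t / (y t / t * (\<Psi> (y t) / \<Psi> t))"
        using mean[OF \<delta>(1)] eventually_gt_at_top[of 0]
      proof eventually_elim
        case (elim t)
        note lb = level_range[OF elim(2)]
        have \<Psi>t: "0 < \<Psi> t" "0 < \<Psi> (y t)" "0 < y t" using elim lb by (auto intro!: \<Psi>_pos)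
        have td: "t < t * (1 + \<delta>)" using elim \<delta> by simp
        define K where "K = measure renewal_measure {t<..t * (1 + \<delta>)} / (\<delta> * t)"
        define v where "v = max 0 (L - \<delta>) * (y t * \<Psi> (y t))"
        have "K * v \<le> ?P t"
        proof (rule undershoot_large_lower[OF \<tau> elim(2) lb(1)])
          show "0 \<le> K" using elim \<delta> by (simp add: K_def)
          fix a assume a: "t - y t \<le> a" "a < t"
          have "(t - a) * measure renewal_measure {t<..t * (1 + \<delta>)} \<le> (t * (1 + \<delta>) - t) * measure renewal_measure {a<..t}"
            using a lb td by (intro compare) auto
          also have "t * (1 + \<delta>) - t = \<delta> * t" by (simp add: algebra_simps)
          finally show "K * (t - a) \<le> measure renewal_measure {a<..t}"
            unfolding K_def using elim \<delta> by (simp add: pos_divide_le_eq mult_ac)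
        next
          fix h :: real assume h: "0 < h" "h \<le> 1"
          have p: "0 < y t * \<Psi> (y t)" using lb \<Psi>t by simp
          have "dist (truncated_mean_rate h (y t) / (y t * \<Psi> (y t))) L < \<delta>" using elim h by blast
          then have "L - \<delta> \<le> truncated_mean_rate h (y t) / (y t * \<Psi> (y t))" by (rule dist_real_bounds)
          moreover have "0 \<le> truncated_mean_rate h (y t) / (y t * \<Psi> (y t))"
            using measure_tail_measure[OF h(1), of "y t"] lb p measure_nonneg[of "tail_measure h" "{..y t}"] by simp
          ultimately have "max 0 (L - \<delta>) \<le> truncated_mean_rate h (y t) / (y t * \<Psi> (y t))" by simp
          then show "v \<le> truncated_mean_rate h (y t)" unfolding v_def by (simp only: pos_le_divide_eq[OF p])
        next
          show "0 \<le> v" using lb \<Psi>t by (simp add: v_def)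
        qed
        then have "K * v / (y t / t * (\<Psi> (y t) / \<Psi> t)) \<le> ?P t / (y t / t * (\<Psi> (y t) / \<Psi> t))"
          using \<Psi>t elim(2) by (intro divide_right_mono) auto
        moreover have "K * v / (y t / t * (\<Psi> (y t) / \<Psi> t)) = k (1 + \<delta>) 1 t / \<delta> * max 0 (L - \<delta>)"
          unfolding K_def v_def k_def measure_renewal_interval[OF less_imp_le[OF td]] mult_1_right
          using \<Psi>t elim(2) \<delta> by (intro cancel_scales) auto
        ultimately show ?case by simp
      qed
    qed
    show "\<exists>g. (\<forall>\<^sub>F t in at_top. ?P t / (y t / t * (\<Psi> (y t) / \<Psi> t)) \<le> g t) \<and>
        (g \<longlongrightarrow> ((1 + (- 1) * \<delta>) powr \<alpha> - (1 + (- 2) * \<delta>) powr \<alpha>) / \<delta> / Gamma (1 + \<alpha>) * (L + \<delta>)) at_top"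
    proof (intro exI conjI)
      have "((\<lambda>t. k (1 - \<delta>) (1 - 2 * \<delta>) t / \<delta> * (L + \<delta>)) \<longlongrightarrow> ((1 - \<delta>) powr \<alpha> - (1 - 2 * \<delta>) powr \<alpha>) / Gamma (1 + \<alpha>) / \<delta> * (L + \<delta>)) at_top"
        using \<delta> by (intro tendsto_mult tendsto_divide k tendsto_const) auto
      then show "((\<lambda>t. k (1 - \<delta>) (1 - 2 * \<delta>) t / \<delta> * (L + \<delta>)) \<longlongrightarrow> ((1 + (- 1) * \<delta>) powr \<alpha> - (1 + (- 2) * \<delta>) powr \<alpha>) / \<delta> / Gamma (1 + \<alpha>) * (L + \<delta>)) at_top"
        by (simp add: mult.commute)
      show "\<forall>\<^sub>F t in at_top. ?P t / (y t / t * (\<Psi> (y t) / \<Psi> t)) \<le> k (1 - \<delta>) (1 - 2 * \<delta>) t / \<delta> * (L + \<delta>)"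
        using mean[OF \<delta>(1)] eventually_gt_at_top[of 0] eventually_gap[OF \<delta>(1)]
      proof eventually_elim
        case (elim t)
        note lb = level_range[OF elim(2)]
        have \<Psi>t: "0 < \<Psi> t" "0 < \<Psi> (y t)" "0 < y t" using elim lb by (auto intro!: \<Psi>_pos)
        have td: "0 \<le> t * (1 - 2 * \<delta>)" "t * (1 - 2 * \<delta>) < t * (1 - \<delta>)" "t * (1 - \<delta>) < t - y t"
          using elim \<delta> by (auto simp: algebra_simps)
        define K where "K = measure renewal_measure {t * (1 - 2 * \<delta>)<..t * (1 - \<delta>)} / (\<delta> * t)"
        define v where "v = (L + \<delta>) * (y t * \<Psi> (y t))"
        have "?P t \<le> K * v"
        proof (rule undershoot_large_upper[OF \<tau> elim(2) lb td(3)])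
          show "0 \<le> K" using elim \<delta> by (simp add: K_def)
          fix a assume a: "t * (1 - \<delta>) \<le> a" "a < t"
          have "(t * (1 - \<delta>) - t * (1 - 2 * \<delta>)) * measure renewal_measure {a<..t} \<le> (t - a) * measure renewal_measure {t * (1 - 2 * \<delta>)<..t * (1 - \<delta>)}"
            using a td by (intro compare) auto
          also have "t * (1 - \<delta>) - t * (1 - 2 * \<delta>) = \<delta> * t" by (simp add: algebra_simps)
          finally show "measure renewal_measure {a<..t} \<le> K * (t - a)"
            unfolding K_def using elim \<delta> by (simp add: pos_le_divide_eq mult_ac)
        next
          fix h :: real assume h: "0 < h" "h \<le> 1"
          have p: "0 < y t * \<Psi> (y t)" using lb \<Psi>t by simp
          have "dist (truncated_mean_rate h (y t) / (y t * \<Psi> (y t))) L < \<delta>" using elim h by blast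
          then have "truncated_mean_rate h (y t) / (y t * \<Psi> (y t)) \<le> L + \<delta>" by (rule dist_real_bounds)
          then show "truncated_mean_rate h (y t) \<le> v" unfolding v_def by (simp only: pos_divide_le_eq[OF p])
        next
          show "0 \<le> v" using lb \<Psi>t L0 \<delta> by (simp add: v_def)
        qed
        then have "?P t / (y t / t * (\<Psi> (y t) / \<Psi> t)) \<le> K * v / (y t / t * (\<Psi> (y t) / \<Psi> t))"
          using \<Psi>t elim(2) by (intro divide_right_mono) auto
        also have "K * v / (y t / t * (\<Psi> (y t) / \<Psi> t)) = k (1 - \<delta>) (1 - 2 * \<delta>) t / \<delta> * (L + \<delta>)"
          unfolding K_def v_def k_def measure_renewal_interval[OF less_imp_le[OF td(2)]]
          using \<Psi>t elim(2) \<delta> by (intro cancel_scales) auto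
        finally show ?case .
      qed
    qed
  next
    have "((\<lambda>\<delta>. ((1 + 1 * \<delta>) powr \<alpha> - (1 + 0 * \<delta>) powr \<alpha>) / \<delta> / Gamma (1 + \<alpha>) * max 0 (L - \<delta>)) \<longlongrightarrow> 1 / Gamma \<alpha> * max 0 (L - 0)) (at_right 0)"
      by (intro tendsto_mult lim tendsto_max tendsto_diff tendsto_const tendsto_ident_at) simp
    then show "((\<lambda>\<delta>. ((1 + 1 * \<delta>) powr \<alpha> - (1 + 0 * \<delta>) powr \<alpha>) / \<delta> / Gamma (1 + \<alpha>) * max 0 (L - \<delta>)) \<longlongrightarrow> 1 / Gamma \<alpha> * L) (at_right 0)" using L0 by simp
    have "((\<lambda>\<delta>. ((1 + (- 1) * \<delta>) powr \<alpha> - (1 + (- 2) * \<delta>) powr \<alpha>) / \<delta> / Gamma (1 + \<alpha>) * (L + \<delta>)) \<longlongrightarrow> 1 / Gamma \<alpha> * (L + 0)) (at_right 0)"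
      by (intro tendsto_mult lim tendsto_add tendsto_const tendsto_ident_at) simp
    then show "((\<lambda>\<delta>. ((1 + (- 1) * \<delta>) powr \<alpha> - (1 + (- 2) * \<delta>) powr \<alpha>) / \<delta> / Gamma (1 + \<alpha>) * (L + \<delta>)) \<longlongrightarrow> 1 / Gamma \<alpha> * L) (at_right 0)" by simp
  qed simp
qed

end

section \<open>Undershoot under two-sided bounds\<close>

context
  fixes \<alpha> \<kappa> :: real
  assumes \<alpha>: "0 < \<alpha>" "\<alpha> < 1"
    and vanish: "(\<Psi> \<longlongrightarrow> 0) at_top"
    and \<kappa>: "0 < \<kappa>"
    and comparable: "\<And>K. 0 < K \<Longrightarrow> \<forall>\<^sub>F x in at_top. \<kappa> * K powr (- \<alpha>) * \<Psi> x \<le> \<Psi> (K * x) \<and> \<Psi> (K * x) \<le> K powr (- \<alpha>) / \<kappa> * \<Psi> x"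
begin

text \<open>
  For large \<open>K\<close>, the lower bound for \<open>U(K t)\<close> exceeds the upper bound for
  \<open>U(t)\<close>, because \<open>K powr \<alpha>\<close> is unbounded.
\<close>

lemma renewal_slope_lower:
  "\<exists>K>1. \<forall>\<^sub>F t in at_top. 1 \<le> (U (K * t) - U t) * \<Psi> t"
proof -
  \<comment> \<open>The constants \<open>1 / 8\<close> and \<open>exp 1\<close> come from the bounds for \<open>U\<close>; the surplus \<open>1\<close> is the slope gained.\<close>
  obtain K where K: "1 < K" "8 * (exp 1 + 1) / \<kappa> \<le> K powr \<alpha>"
    using ex_powr_ge[OF \<alpha>(1)] by blast
  have "\<forall>\<^sub>F t in at_top. 1 \<le> (U (K * t) - U t) * \<Psi> t"
    using comparable[of K, OF less_trans[OF zero_less_one K(1)]] eventually_gt_at_top[of 0]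
  proof eventually_elim
    case (elim t)
    have \<Psi>t: "0 < \<Psi> t" "0 < \<Psi> (K * t)" using elim K by (auto intro!: \<Psi>_pos)
    have "exp 1 + 1 \<le> \<kappa> * K powr \<alpha> / 8" using K(2) \<kappa> by (simp add: field_simps)
    also have "\<dots> = 1 / 8 * (1 / (K powr (- \<alpha>) / \<kappa>))" using K(1) \<kappa> by (simp add: powr_minus field_simps)
    also have "\<dots> \<le> 1 / 8 * (\<Psi> t / \<Psi> (K * t))"
    proof -
      have ub: "\<Psi> (K * t) / \<Psi> t \<le> K powr (- \<alpha>) / \<kappa>" using elim(1) \<Psi>t(1) by (simp add: pos_divide_le_eq)
      have lb: "0 < \<Psi> (K * t) / \<Psi> t" using \<Psi>t by simp
      have "1 / (K powr (- \<alpha>) / \<kappa>) \<le> 1 / (\<Psi> (K * t) / \<Psi> t)" by (rule frac_le[OF zero_le_one order_refl lb ub])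
      then show ?thesis by simp
    qed
    also have "\<dots> \<le> U (K * t) * \<Psi> t"
      using mult_right_mono[OF renewal_bounds(2)[of "K * t"], of "\<Psi> t / \<Psi> (K * t)"] elim K \<Psi>t by simp
    finally have "exp 1 + 1 \<le> U (K * t) * \<Psi> t" .
    moreover have "U t * \<Psi> t \<le> exp 1" using elim by (intro renewal_bounds)
    ultimately show ?case by (simp add: left_diff_distrib)
  qed
  with K(1) show ?thesis by blast
qed

text \<open>
  The truncated mean rate at \<open>K x\<close> exceeds a constant multiple of
  \<open>K powr (1 - \<alpha>)\<close> times \<open>x \<Psi>(x)\<close>, so for large
  \<open>K\<close> it exceeds the upper bound at \<open>x\<close>. This is where
  \<open>\<alpha> < 1\<close> is essential.
\<close>

lemma tail_rate_comparable:
  "\<exists>c>0. \<forall>\<^sub>F x in at_top. \<forall>h. 0 < h \<longrightarrow> h \<le> 1 \<longrightarrow> c * \<Psi> x \<le> tail_rate h x"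
proof -
  \<comment> \<open>The constants \<open>1 / 2\<close> and \<open>exp 1\<close> come from the bounds for the truncated mean rate.\<close>
  obtain K where K: "1 < K" "2 * (exp 1 + 1) / \<kappa> \<le> K powr (1 - \<alpha>)"
    using ex_powr_ge[of "1 - \<alpha>"] \<alpha> by auto
  have K0: "0 < K" using K by simp
  have small: "\<forall>\<^sub>F x in at_top. \<Psi> x < 1" using order_tendstoD(2)[OF vanish, of 1] by simp
  have Kx: "filterlim (\<lambda>x. K * x) at_top at_top"
    by (rule filterlim_tendsto_pos_mult_at_top[OF tendsto_const K0 filterlim_ident])
  have "\<forall>\<^sub>F x in at_top. \<forall>h. 0 < h \<longrightarrow> h \<le> 1 \<longrightarrow> 1 / (K - 1) * \<Psi> x \<le> tail_rate h x"
    using comparable[OF K0] eventually_gt_at_top[of 0] eventually_compose_filterlim[OF small Kx]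
  proof eventually_elim
    case (elim x)
    have \<Psi>x: "0 < \<Psi> x" "0 < \<Psi> (K * x)" using elim K by (auto intro!: \<Psi>_pos)
    show ?case
    proof (intro allI impI)
      fix h :: real assume h: "0 < h" "h \<le> 1"
      have "exp 1 + 1 \<le> \<kappa> * K powr (1 - \<alpha>) / 2" using K(2) \<kappa> by (simp add: field_simps)
      also have "\<dots> = K / 2 * (\<kappa> * K powr (- \<alpha>))" using K0 by (simp add: powr_diff powr_minus field_simps)
      finally have "(exp 1 + 1) * (x * \<Psi> x) \<le> K / 2 * (\<kappa> * K powr (- \<alpha>)) * (x * \<Psi> x)"
        using elim \<Psi>x by (intro mult_right_mono) auto
      also have "\<dots> = K * x / 2 * (\<kappa> * K powr (- \<alpha>) * \<Psi> x)" by simp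
      also have "\<dots> \<le> K * x / 2 * \<Psi> (K * x)" using elim K0 by (intro mult_left_mono) auto
      also have "\<dots> \<le> truncated_mean_rate h (K * x)"
        using truncated_mean_bounds(2)[OF h, of "K * x"] elim K0 by simp
      finally have "(exp 1 + 1) * (x * \<Psi> x) \<le> truncated_mean_rate h (K * x)" .
      moreover have "truncated_mean_rate h x \<le> exp 1 * (x * \<Psi> x)"
        using truncated_mean_bounds(1)[OF h, of x] elim by simp
      ultimately have "x * \<Psi> x \<le> truncated_mean_rate h (K * x) - truncated_mean_rate h x" by (simp add: algebra_simps)
      also have "\<dots> \<le> (K - 1) * x * tail_rate h x" using h elim K by (intro tail_rate_lower)
      finally have "x * \<Psi> x \<le> x * ((K - 1) * tail_rate h x)" by (simp add: mult_ac)
      then have "\<Psi> x \<le> (K - 1) * tail_rate h x" using elim by simp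
      then show "1 / (K - 1) * \<Psi> x \<le> tail_rate h x" using K by (simp add: pos_divide_le_eq mult.commute)
    qed
  qed
  then show ?thesis using K by (intro exI[of _ "1 / (K - 1)"]) auto
qed

lemma undershoot_small_comparable:
  "(\<lambda>t. prob {w \<in> space M. undershoot \<tau> t w \<le> ereal (y t)}) \<in> \<Theta>(\<lambda>t. \<Psi> t / \<Psi> (y t))"
proof -
  obtain c where c: "0 < c" "\<forall>\<^sub>F x in at_top. \<forall>h. 0 < h \<longrightarrow> h \<le> 1 \<longrightarrow> c * \<Psi> x \<le> tail_rate h x"
    using tail_rate_comparable by blast
  show ?thesis
  proof (rule bigthetaI'[of "c / 8" "2 * exp 1 * exp 1"])
    have gap: "\<forall>\<^sub>F t in at_top. y t < 1 / 2 * t" by (rule eventually_gap) simp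
    show "\<forall>\<^sub>F t in at_top. c / 8 * norm (\<Psi> t / \<Psi> (y t)) \<le> norm (prob {w \<in> space M. undershoot \<tau> t w \<le> ereal (y t)}) \<and>
        norm (prob {w \<in> space M. undershoot \<tau> t w \<le> ereal (y t)}) \<le> 2 * exp 1 * exp 1 * norm (\<Psi> t / \<Psi> (y t))"
      using c(2) eventually_gt_at_top[of 0] gap
    proof eventually_elim
      case (elim t)
      note lb = level_range[OF elim(2)]
      have \<Psi>t: "0 < \<Psi> t" "0 < \<Psi> (y t)" using elim lb by (auto intro!: \<Psi>_pos)
      let ?P = "prob {w \<in> space M. undershoot \<tau> t w \<le> ereal (y t)}"
      let ?U = "U (y t)"
      have "?U * (c * \<Psi> t) \<le> ?P"
        by (rule undershoot_small_lower[OF \<tau> elim(2) _ lb(2)]) (use elim lb c \<Psi>t in auto)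
      moreover have "c / 8 * (\<Psi> t / \<Psi> (y t)) \<le> ?U * (c * \<Psi> t)"
        using mult_right_mono[OF renewal_bounds(2)[OF lb(1)], of "c * \<Psi> t / \<Psi> (y t)"] c \<Psi>t by simp
      ultimately have 1: "c / 8 * (\<Psi> t / \<Psi> (y t)) \<le> ?P" by simp
      have "?P \<le> ?U * (exp 1 * (2 * \<Psi> t))"
      proof (rule undershoot_small_upper[OF \<tau> elim(2) _ lb(2)])
        fix h :: real assume h: "0 < h" "h \<le> 1"
        have "tail_rate h (t - y t) \<le> exp 1 * \<Psi> (t - y t)" using h lb by (intro tail_rate_bound) auto
        also have "\<Psi> (t - y t) \<le> t / (t - y t) * \<Psi> t" using lb by (intro \<Psi>_scale) auto
        also have "\<dots> \<le> 2 * \<Psi> t"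
        proof (intro mult_right_mono)
          show "t / (t - y t) \<le> 2" using elim lb by (simp add: pos_divide_le_eq)
        qed (use \<Psi>t in simp)
        finally show "tail_rate h (t - y t) \<le> exp 1 * (2 * \<Psi> t)" by simp
      qed (use lb in auto)
      also have "\<dots> \<le> exp 1 / \<Psi> (y t) * (exp 1 * (2 * \<Psi> t))"
        using renewal_bounds(1)[OF lb(1)] \<Psi>t by (intro mult_right_mono) (simp_all add: pos_le_divide_eq)
      also have "\<dots> = 2 * exp 1 * exp 1 * (\<Psi> t / \<Psi> (y t))" by simp
      finally show ?case using 1 \<Psi>t by simp
    qed
  qed (use c in auto)
qed

lemma undershoot_large_comparable:
  assumes compare: "\<And>a b c d. 0 \<le> a \<Longrightarrow> a < b \<Longrightarrow> b \<le> c \<Longrightarrow> c < d \<Longrightarrow>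
      (b - a) * measure renewal_measure {c<..d} \<le> (d - c) * measure renewal_measure {a<..b}"
  shows "(\<lambda>t. prob {w \<in> space M. ereal (t - y t) \<le> undershoot \<tau> t w}) \<in> \<Theta>(\<lambda>t. y t / t * (\<Psi> (y t) / \<Psi> t))"
proof -
  obtain K where K: "1 < K" "\<forall>\<^sub>F t in at_top. 1 \<le> (U (K * t) - U t) * \<Psi> t"
    using renewal_slope_lower by blast
  have small: "\<forall>\<^sub>F x in at_top. \<Psi> x < 1" using order_tendstoD(2)[OF vanish, of 1] by simp
  show ?thesis
  proof (rule bigthetaI'[of "1 / (2 * (K - 1))" "4 * exp 1 * exp 1"])
    have gap: "\<forall>\<^sub>F t in at_top. y t < 1 / 2 * t" by (rule eventually_gap) simp
    show "\<forall>\<^sub>F t in at_top. 1 / (2 * (K - 1)) * norm (y t / t * (\<Psi> (y t) / \<Psi> t)) \<le> norm (prob {w \<in> space M. ereal (t - y t) \<le> undershoot \<tau> t w}) \<and>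
        norm (prob {w \<in> space M. ereal (t - y t) \<le> undershoot \<tau> t w}) \<le> 4 * exp 1 * exp 1 * norm (y t / t * (\<Psi> (y t) / \<Psi> t))"
      using K(2) eventually_gt_at_top[of 0] gap eventually_compose_filterlim[OF small y_top]
    proof eventually_elim
      case (elim t)
      note lb = level_range[OF elim(2)]
      have \<Psi>t: "0 < \<Psi> t" "0 < \<Psi> (y t)" "0 < y t" using elim lb by (auto intro!: \<Psi>_pos)
      let ?P = "prob {w \<in> space M. ereal (t - y t) \<le> undershoot \<tau> t w}"
      have td: "t < K * t" using elim K by simp
      define m where "m = measure renewal_measure {t<..K * t}"
      have m: "1 / \<Psi> t \<le> m"
        using elim(1) \<Psi>t unfolding m_def measure_renewal_interval[OF less_imp_le[OF td]] by (simp add: pos_divide_le_eq)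
      have "m / ((K - 1) * t) * (y t / 2 * \<Psi> (y t)) \<le> ?P"
      proof (rule undershoot_large_lower[OF \<tau> elim(2) lb(1)])
        show "0 \<le> m / ((K - 1) * t)" using elim K by (simp add: m_def)
        fix a assume a: "t - y t \<le> a" "a < t"
        have "(t - a) * m \<le> (K * t - t) * measure renewal_measure {a<..t}"
          unfolding m_def using a lb td by (intro compare) auto
        also have "K * t - t = (K - 1) * t" by (simp add: algebra_simps)
        finally show "m / ((K - 1) * t) * (t - a) \<le> measure renewal_measure {a<..t}"
          using elim K by (simp add: pos_divide_le_eq mult_ac)
      next
        fix h :: real assume h: "0 < h" "h \<le> 1"
        show "y t / 2 * \<Psi> (y t) \<le> truncated_mean_rate h (y t)"
          using truncated_mean_bounds(2)[OF h lb(1)] elim by simp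
      qed (use elim(2) \<Psi>t in auto)
      moreover have "1 / (2 * (K - 1)) * (y t / t * (\<Psi> (y t) / \<Psi> t)) \<le> m / ((K - 1) * t) * (y t / 2 * \<Psi> (y t))"
      proof -
        have "1 / (2 * (K - 1)) * (y t / t * (\<Psi> (y t) / \<Psi> t)) = 1 / \<Psi> t * (y t / t * \<Psi> (y t) / (2 * (K - 1)))" by simp
        also have "\<dots> \<le> m * (y t / t * \<Psi> (y t) / (2 * (K - 1)))"
          using m \<Psi>t K(1) elim(2) by (intro mult_right_mono) auto
        also have "\<dots> = m / ((K - 1) * t) * (y t / 2 * \<Psi> (y t))" using elim(2) by simp
        finally show ?thesis .
      qed
      ultimately have 1: "1 / (2 * (K - 1)) * (y t / t * (\<Psi> (y t) / \<Psi> t)) \<le> ?P"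
        by (rule order_trans[rotated])
      \<comment> \<open>For the upper bound, any interval of length proportional to \<open>t\<close> to the left of \<open>t - y t\<close> will do.\<close>
      define m' where "m' = measure renewal_measure {0<..t / 2}"
      have th: "0 < t / 2" using elim by simp
      have "?P \<le> m' / (t / 2) * (exp 1 * (y t * \<Psi> (y t)))"
      proof (rule undershoot_large_upper[OF \<tau> elim(2) lb])
        show "t / 2 < t - y t" using elim by simp
        show "0 \<le> m' / (t / 2)" using elim by (simp add: m'_def)
        fix a assume a: "t / 2 \<le> a" "a < t"
        have "(t / 2 - 0) * measure renewal_measure {a<..t} \<le> (t - a) * m'"
          unfolding m'_def using a elim by (intro compare) auto
        then show "measure renewal_measure {a<..t} \<le> m' / (t / 2) * (t - a)"
          using th by (simp add: pos_le_divide_eq mult_ac)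
      next
        fix h :: real assume h: "0 < h" "h \<le> 1"
        show "truncated_mean_rate h (y t) \<le> exp 1 * (y t * \<Psi> (y t))"
          using truncated_mean_bounds(1)[OF h lb(1)] by simp
      qed (use elim(2) \<Psi>t in auto)
      also have "\<dots> \<le> exp 1 / \<Psi> t / (t / 2) * (exp 1 * (y t * \<Psi> (y t)))"
      proof (intro mult_right_mono divide_right_mono)
        have "m' \<le> U (t / 2)"
          using th unfolding m'_def measure_renewal_interval[OF less_imp_le[OF th]] by simp
        also have "\<dots> \<le> exp 1 / \<Psi> (t / 2)"
          using renewal_bounds(1)[OF th] \<Psi>_pos[OF th] by (simp add: pos_le_divide_eq)
        also have "\<dots> \<le> exp 1 / \<Psi> t"
          using \<Psi>_antimono[of "t / 2" t] \<Psi>_pos[OF th] \<Psi>t th by (intro divide_left_mono) auto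
        finally show "m' \<le> exp 1 / \<Psi> t" .
      qed (use th lb \<Psi>t in auto)
      also have "\<dots> = 2 * exp 1 * exp 1 * (y t / t * (\<Psi> (y t) / \<Psi> t))" using elim(2) by (simp add: mult_ac)
      also have "\<dots> \<le> 4 * exp 1 * exp 1 * (y t / t * (\<Psi> (y t) / \<Psi> t))"
        using \<Psi>t elim(2) by (intro mult_right_mono) auto
      finally show ?case using 1 \<Psi>t elim(2) by (simp add: abs_mult)
    qed
  qed (use K in auto)
qed

end

end

end

section \<open>Slow variation and the theorem\<close>

text \<open>
  The hypotheses compare \<open>\<Phi>(1 / x)\<close> with this function.
\<close>

definition regvar_model :: "real \<Rightarrow> (real \<Rightarrow> real) \<Rightarrow> real \<Rightarrow> real" where
  "regvar_model \<alpha> l x = x powr (- \<alpha>) * l x"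

lemma regvar_model_pos: "slowly_varying l \<Longrightarrow> 0 < x \<Longrightarrow> 0 < regvar_model \<alpha> l x"
  by (simp add: regvar_model_def slowly_varying_def)

lemma regvar_model_ratio:
  assumes l: "slowly_varying l" and c: "0 < c"
  shows "((\<lambda>x. regvar_model \<alpha> l (c * x) / regvar_model \<alpha> l x) \<longlongrightarrow> c powr (- \<alpha>)) at_top"
proof -
  have "((\<lambda>x. c powr (- \<alpha>) * (l (c * x) / l x)) \<longlongrightarrow> c powr (- \<alpha>) * 1) at_top"
    using l c by (intro tendsto_mult tendsto_const) (auto simp: slowly_varying_def)
  moreover have "\<forall>\<^sub>F x in at_top. c powr (- \<alpha>) * (l (c * x) / l x) = regvar_model \<alpha> l (c * x) / regvar_model \<alpha> l x"
    using eventually_gt_at_top[of 0] by eventually_elim (use c in \<open>simp add: regvar_model_def powr_mult\<close>)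
  ultimately show ?thesis by (simp add: tendsto_cong)
qed

lemma two_power_at_top: "filterlim (\<lambda>n::nat. (2::real) ^ n) at_top sequentially"
proof (rule filterlim_at_top_mono[OF filterlim_real_sequentially])
  show "\<forall>\<^sub>F n in sequentially. real n \<le> 2 ^ n"
    by (intro always_eventually allI less_imp_le of_nat_less_two_power)
qed

text \<open>
  The quotient of consecutive terms tends to \<open>2 powr - \<alpha>\<close>, which is below
  \<open>1\<close>.
\<close>

lemma regvar_model_dyadic_vanishes:
  assumes l: "slowly_varying l" and \<alpha>: "0 < \<alpha>"
  shows "(\<lambda>n. regvar_model \<alpha> l (2 ^ n)) \<longlonglongrightarrow> 0"
proof -
  let ?r = "\<lambda>n. regvar_model \<alpha> l (2 ^ n)"
  have top: "filterlim (\<lambda>n::nat. (2::real) ^ n) at_top sequentially"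
    by (rule two_power_at_top)
  have "(2::real) powr (- \<alpha>) < 1" using \<alpha> by (simp add: powr_less_one)
  then obtain q where q: "2 powr (- \<alpha>) < q" "q < (1::real)" using dense by blast
  have "\<forall>\<^sub>F x in at_top. regvar_model \<alpha> l (2 * x) / regvar_model \<alpha> l x < q"
    using regvar_model_ratio[OF l, of 2 \<alpha>] q by (intro order_tendstoD(2)) auto
  from eventually_compose_filterlim[OF this top]
  obtain N where N: "\<And>n. N \<le> n \<Longrightarrow> ?r (Suc n) / ?r n < q"
    by (auto simp: eventually_sequentially)
  have "summable ?r"
  proof (rule summable_ratio_test[OF q(2)])
    fix n assume "N \<le> n"
    from N[OF this] show "norm (?r (Suc n)) \<le> q * norm (?r n)"
      using regvar_model_pos[OF l, of "2 ^ n" \<alpha>] regvar_model_pos[OF l, of "2 ^ Suc n" \<alpha>]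
      by (simp add: pos_divide_less_eq)
  qed
  then show ?thesis by (rule summable_LIMSEQ_zero)
qed

lemma reciprocal_at_right_0: "filterlim (\<lambda>x::real. 1 / x) (at_right 0) at_top"
  using filterlim_inverse_at_right_top by (simp add: inverse_eq_divide)

lemma bigtheta_at_infinity:
  assumes "\<Phi> \<in> \<Theta>[at_right 0](\<lambda>x. x powr \<alpha> * l (1 / x))"
  shows "(\<lambda>x. \<Phi> (1 / x)) \<in> \<Theta>[at_top](regvar_model \<alpha> l)"
proof -
  have "(\<lambda>x. \<Phi> (1 / x)) \<in> \<Theta>[at_top](\<lambda>x. (1 / x) powr \<alpha> * l (1 / (1 / x)))"
    by (rule landau_theta.compose[OF assms reciprocal_at_right_0])
  also have "(\<lambda>x. (1 / x) powr \<alpha> * l (1 / (1 / x))) \<in> \<Theta>[at_top](regvar_model \<alpha> l)"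
  proof (rule bigthetaI_cong)
    show "\<forall>\<^sub>F x in at_top. (1 / x) powr \<alpha> * l (1 / (1 / x)) = regvar_model \<alpha> l x"
      using eventually_gt_at_top[of 0] by eventually_elim (simp add: regvar_model_def powr_divide powr_minus field_simps)
  qed
  finally show ?thesis .
qed

lemma asymp_equiv_at_infinity:
  assumes "\<Phi> \<sim>[at_right 0] (\<lambda>x. x powr \<alpha> * l (1 / x))"
  shows "(\<lambda>x. \<Phi> (1 / x)) \<sim>[at_top] regvar_model \<alpha> l"
proof -
  have "(\<lambda>x. \<Phi> (1 / x)) \<sim>[at_top] (\<lambda>x. (1 / x) powr \<alpha> * l (1 / (1 / x)))"
    by (rule asymp_equiv_compose'[OF assms reciprocal_at_right_0])
  also have "(\<lambda>x. (1 / x) powr \<alpha> * l (1 / (1 / x))) \<sim>[at_top] regvar_model \<alpha> l"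
  proof (rule asymp_equiv_refl_ev)
    show "\<forall>\<^sub>F x in at_top. (1 / x) powr \<alpha> * l (1 / (1 / x)) = regvar_model \<alpha> l x"
      using eventually_gt_at_top[of 0] by eventually_elim (simp add: regvar_model_def powr_divide powr_minus field_simps)
  qed
  finally show ?thesis .
qed

lemma bigtheta_two_sided:
  fixes f g :: "real \<Rightarrow> real"
  assumes "f \<in> \<Theta>[at_top](g)" "\<And>x. 0 < x \<Longrightarrow> 0 \<le> f x" "\<And>x. 0 < x \<Longrightarrow> 0 \<le> g x"
  obtains a A where "0 < a" "0 < A" "\<forall>\<^sub>F x in at_top. a * g x \<le> f x \<and> f x \<le> A * g x"
proof -
  obtain A where A: "0 < A" "\<forall>\<^sub>F x in at_top. norm (f x) \<le> A * norm (g x)"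
    by (rule landau_o.bigE[OF bigthetaD1[OF assms(1)]])
  obtain a where a: "0 < a" "\<forall>\<^sub>F x in at_top. norm (f x) \<ge> a * norm (g x)"
    by (rule landau_omega.bigE[OF bigthetaD2[OF assms(1)]])
  have "\<forall>\<^sub>F x in at_top. a * g x \<le> f x \<and> f x \<le> A * g x"
    using A(2) a(2) eventually_gt_at_top[of 0] by eventually_elim (use assms in auto)
  with that A a show thesis by blast
qed

lemma exponent_dyadic_vanishes:
  assumes l: "slowly_varying l" and \<alpha>: "0 < \<alpha>"
    and \<Phi>: "\<Phi> \<in> \<Theta>[at_right 0](\<lambda>x. x powr \<alpha> * l (1 / x))" and nonneg: "\<And>x. 0 < x \<Longrightarrow> 0 \<le> \<Phi> x"
  shows "(\<lambda>n. \<Phi> (1 / 2 ^ n)) \<longlonglongrightarrow> 0"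
proof -
  have top: "filterlim (\<lambda>n::nat. (2::real) ^ n) at_top sequentially"
    by (rule two_power_at_top)
  obtain a A where A: "0 < A" "\<forall>\<^sub>F x in at_top. a * regvar_model \<alpha> l x \<le> \<Phi> (1 / x) \<and> \<Phi> (1 / x) \<le> A * regvar_model \<alpha> l x"
    by (rule bigtheta_two_sided[OF bigtheta_at_infinity[OF \<Phi>]]) (auto simp: nonneg less_imp_le[OF regvar_model_pos[OF l]])
  show ?thesis
  proof (rule tendsto_sandwich[OF _ _ tendsto_const])
    show "\<forall>\<^sub>F n in sequentially. 0 \<le> \<Phi> (1 / 2 ^ n)" by (simp add: nonneg)
    show "\<forall>\<^sub>F n in sequentially. \<Phi> (1 / 2 ^ n) \<le> A * regvar_model \<alpha> l (2 ^ n)"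
      using eventually_compose_filterlim[OF A(2) top] by eventually_elim simp
    show "(\<lambda>n. A * regvar_model \<alpha> l (2 ^ n)) \<longlonglongrightarrow> 0"
      using tendsto_mult[OF tendsto_const regvar_model_dyadic_vanishes[OF l \<alpha>], of A] by simp
  qed
qed

text \<open>
  The exponential functional vanishes after the killing time, whose tail is
  \<open>exp (- q s)\<close>.
\<close>

lemma killed_laplace_exponent_ge:
  assumes M: "prob_space M" and X: "nonneg_levy_process M X" and \<xi>: "distributed M lborel \<xi> (exponential_density q)" and q: "0 < q"
    and \<tau>: "\<forall>s\<ge>0. \<forall>w\<in>space M. \<tau> s w = (if s < \<xi> w then ereal (X s w) else \<infinity>)"
    and L: "is_laplace_exponent M \<tau> \<Phi>" and x: "0 < x"
  shows "q \<le> \<Phi> x"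
proof -
  interpret prob_space M by fact
  have [measurable]: "\<xi> \<in> borel_measurable M" using \<xi> by (simp add: distributed_def)
  have [measurable]: "X 1 \<in> borel_measurable M" using X by (auto simp: nonneg_levy_process_def levy_process_def)
  have pos: "0 \<le> X 1 w" if "w \<in> space M" for w using X that by (auto simp: nonneg_levy_process_def)
  have eq: "exp_neg (ereal x * \<tau> 1 w) = (if 1 < \<xi> w then exp (- (x * X 1 w)) else 0)" if "w \<in> space M" for w
    using that \<tau> x by (auto simp: exp_neg_def)
  have "exp (- \<Phi> x) = (\<integral>w. exp_neg (ereal x * \<tau> 1 w) \<partial>M)" using L x by (auto simp: is_laplace_exponent_def)
  also have "\<dots> = (\<integral>w. (if 1 < \<xi> w then exp (- (x * X 1 w)) else 0) \<partial>M)"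
    by (intro Bochner_Integration.integral_cong eq) auto
  also have "\<dots> \<le> (\<integral>w. indicator {w \<in> space M. 1 < \<xi> w} w \<partial>M)"
  proof (rule integral_mono)
    show "integrable M (\<lambda>w. if 1 < \<xi> w then exp (- (x * X 1 w)) else 0)"
      by (rule integrable_const_bound[of _ 1]) (use x pos in \<open>auto intro!: AE_I2\<close>)
    show "integrable M (\<lambda>w. indicator {w \<in> space M. 1 < \<xi> w} w :: real)"
      by (rule integrable_const_bound[of _ 1]) (auto simp: indicator_def)
  qed (use x pos in \<open>auto simp: indicator_def\<close>)
  also have "\<dots> = prob {w \<in> space M. 1 < \<xi> w}" by simp
  also have "\<dots> = exp (- 1 * q)" using exponential_distributedD_gt[OF \<xi>, of 1] q by simp
  finally show ?thesis by simp
qed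

context subordinator
begin

text \<open>
  Along powers of \<open>2\<close> this is the decay of the comparison function; monotonicity fills
  the gaps.
\<close>

lemma \<Psi>_vanishes:
  assumes "slowly_varying l" "0 < \<alpha>" "\<Phi> \<in> \<Theta>[at_right 0](\<lambda>x. x powr \<alpha> * l (1 / x))"
  shows "(\<Psi> \<longlongrightarrow> 0) at_top"
proof (rule order_tendstoI)
  fix y :: real assume y: "y < 0"
  show "\<forall>\<^sub>F x in at_top. y < \<Psi> x"
    using eventually_gt_at_top[of 0] by eventually_elim (rule less_trans[OF y \<Psi>_pos])
next
  fix y :: real assume y: "0 < y"
  have "\<forall>\<^sub>F n in sequentially. \<Phi> (1 / 2 ^ n) < y"
    using exponent_dyadic_vanishes[OF assms \<Phi>_nonneg] y by (intro order_tendstoD(2)) auto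
  then obtain n where "\<Phi> (1 / 2 ^ n) < y" by (auto simp: eventually_sequentially)
  then have n: "\<Psi> (2 ^ n) < y" by (simp add: \<Psi>_def)
  show "\<forall>\<^sub>F x in at_top. \<Psi> x < y"
    using eventually_ge_at_top[of "2 ^ n"]
  proof eventually_elim
    case (elim x)
    then show ?case using \<Psi>_antimono[of "2 ^ n" x] n by simp
  qed
qed

lemma regular_of_equiv:
  assumes l: "slowly_varying l" and equiv: "\<Phi> \<sim>[at_right 0] (\<lambda>x. x powr \<alpha> * l (1 / x))" and c: "0 < c"
  shows "((\<lambda>x. \<Psi> (c * x) / \<Psi> x) \<longlongrightarrow> c powr (- \<alpha>)) at_top"
proof -
  have e: "\<Psi> \<sim>[at_top] regvar_model \<alpha> l"
    using asymp_equiv_at_infinity[OF equiv] by (simp add: \<Psi>_def[abs_def])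
  have "filterlim (\<lambda>x. c * x) at_top at_top"
    by (rule filterlim_tendsto_pos_mult_at_top[OF tendsto_const c filterlim_ident])
  from asymp_equiv_compose'[OF e this] have "(\<lambda>x. \<Psi> (c * x) / \<Psi> x) \<sim>[at_top] (\<lambda>x. regvar_model \<alpha> l (c * x) / regvar_model \<alpha> l x)"
    by (intro asymp_equiv_divide e)
  then show ?thesis
    using regvar_model_ratio[OF l c] by (rule tendsto_asymp_equiv_cong[THEN iffD2])
qed

lemma comparable_of_theta:
  assumes l: "slowly_varying l" and theta: "\<Phi> \<in> \<Theta>[at_right 0](\<lambda>x. x powr \<alpha> * l (1 / x))"
  obtains \<kappa> where "0 < \<kappa>"
    "\<And>K. 0 < K \<Longrightarrow> \<forall>\<^sub>F x in at_top. \<kappa> * K powr (- \<alpha>) * \<Psi> x \<le> \<Psi> (K * x) \<and> \<Psi> (K * x) \<le> K powr (- \<alpha>) / \<kappa> * \<Psi> x"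
proof -
  let ?r = "regvar_model \<alpha> l"
  have "\<Psi> \<in> \<Theta>[at_top](?r)" using bigtheta_at_infinity[OF theta] by (simp add: \<Psi>_def[abs_def])
  from bigtheta_two_sided[OF this] obtain a A where a: "0 < a" "0 < A" and aA: "\<forall>\<^sub>F x in at_top. a * ?r x \<le> \<Psi> x \<and> \<Psi> x \<le> A * ?r x"
    by (auto simp: less_imp_le[OF regvar_model_pos[OF l]] less_imp_le[OF \<Psi>_pos])
  show thesis
  proof (rule that[of "a / (2 * A)"])
    show "0 < a / (2 * A)" using a by simp
    fix K :: real assume K: "0 < K"
    have Kp: "0 < K powr (- \<alpha>)" using K by simp
    have top: "filterlim (\<lambda>x. K * x) at_top at_top"
      by (rule filterlim_tendsto_pos_mult_at_top[OF tendsto_const K filterlim_ident])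
    have lo: "\<forall>\<^sub>F x in at_top. K powr (- \<alpha>) / 2 < ?r (K * x) / ?r x"
      using Kp by (intro order_tendstoD(1)[OF regvar_model_ratio[OF l K]]) simp
    have hi: "\<forall>\<^sub>F x in at_top. ?r (K * x) / ?r x < K powr (- \<alpha>) * 2"
      using Kp by (intro order_tendstoD(2)[OF regvar_model_ratio[OF l K]]) simp
    show "\<forall>\<^sub>F x in at_top. a / (2 * A) * K powr (- \<alpha>) * \<Psi> x \<le> \<Psi> (K * x) \<and> \<Psi> (K * x) \<le> K powr (- \<alpha>) / (a / (2 * A)) * \<Psi> x"
      using lo hi aA eventually_compose_filterlim[OF aA top] eventually_gt_at_top[of 0]
    proof eventually_elim
      case (elim x)
      have r: "0 < ?r x" using regvar_model_pos[OF l] elim by simp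
      have 1: "K powr (- \<alpha>) / 2 * ?r x \<le> ?r (K * x)" "?r (K * x) \<le> K powr (- \<alpha>) * 2 * ?r x"
        using elim(1,2) r by (auto simp: pos_less_divide_eq pos_divide_less_eq)
      have "a / (2 * A) * K powr (- \<alpha>) * \<Psi> x \<le> a / (2 * A) * K powr (- \<alpha>) * (A * ?r x)"
        using elim(3) a Kp by (intro mult_left_mono) auto
      also have "\<dots> = a * (K powr (- \<alpha>) / 2 * ?r x)" using a by simp
      also have "\<dots> \<le> a * ?r (K * x)" using 1 a by (intro mult_left_mono) auto
      also have "\<dots> \<le> \<Psi> (K * x)" using elim by simp
      finally have 2: "a / (2 * A) * K powr (- \<alpha>) * \<Psi> x \<le> \<Psi> (K * x)" .
      have "\<Psi> (K * x) \<le> A * ?r (K * x)" using elim by simp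
      also have "\<dots> \<le> A * (K powr (- \<alpha>) * 2 * ?r x)" using 1 a by (intro mult_left_mono) auto
      also have "\<dots> = K powr (- \<alpha>) / (a / (2 * A)) * (a * ?r x)" using a by simp
      also have "\<dots> \<le> K powr (- \<alpha>) / (a / (2 * A)) * \<Psi> x" using elim a Kp by (intro mult_left_mono) auto
      finally show ?case using 2 by simp
    qed
  qed
qed

lemma special_average_antimono:
  assumes special: "special_bernstein_function \<Phi>'" and eq: "\<And>x. 0 < x \<Longrightarrow> \<Phi>' x = \<Phi> x"
    and "0 \<le> a" "a < b" "b \<le> c" "c < d"
  shows "(b - a) * measure renewal_measure {c<..d} \<le> (d - c) * measure renewal_measure {a<..b}"
proof -
  interpret B: bernstein_renewal renewal_measure "\<lambda>x. x / \<Phi>' x"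
  proof
    show "AE v in renewal_measure. 0 \<le> v" by (rule AE_renewal_measure_nonneg)
    show "integrable renewal_measure (\<lambda>v. exp (- (c * v)))" if "0 < c" for c
      using renewal_measure_laplace[OF that] by (simp add: has_bochner_integral_iff)
    show "c / \<Phi>' c = c * (LINT v|renewal_measure. exp (- (c * v)))" if "0 < c" for c
      using renewal_measure_laplace[OF that] eq[OF that] by (simp add: has_bochner_integral_iff)
    show "bernstein_function (\<lambda>x. x / \<Phi>' x)" using special by (simp add: special_bernstein_function_def)
  qed simp
  show ?thesis using assms by (intro B.interval_average_antimono)
qed

end

lemma ereal_divide_le_iff: "0 < t \<Longrightarrow> x / ereal t \<le> ereal e \<longleftrightarrow> x \<le> ereal (e * t)" for t e :: real
  by (cases x) (auto simp: pos_divide_le_eq)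

lemma ereal_le_divide_iff: "0 < t \<Longrightarrow> ereal e \<le> x / ereal t \<longleftrightarrow> ereal (e * t) \<le> x" for t e :: real
  by (cases x) (auto simp: pos_le_divide_eq)

theorem theorem3p3:
  fixes M :: "'w measure"
    and \<tau> :: "real \<Rightarrow> 'w \<Rightarrow> ereal"
    and \<Phi> l \<epsilon> :: "real \<Rightarrow> real"
    and \<alpha> \<alpha>' :: real
  assumes "prob_space M"
    and "killed_subordinator M \<tau>"
    and "is_laplace_exponent M \<tau> \<Phi>"
    and "\<exists>x>0. \<Phi> x \<noteq> 0"
    and "0 < \<alpha>" and "\<alpha> < 1" and "\<alpha>' = 1 - \<alpha>"
    and "slowly_varying l"
    and "\<forall>t>0. 0 < \<epsilon> t \<and> \<epsilon> t < 1"
    and "(\<epsilon> \<longlongrightarrow> 0) at_top"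
    and "filterlim (\<lambda>t. \<epsilon> t * t) at_top at_top"
  shows
    "(\<Phi> \<sim>[at_right 0] (\<lambda>x. x powr \<alpha> * l (1 / x)) \<longrightarrow>
        (\<lambda>t. measure M {w \<in> space M. undershoot \<tau> t w / ereal t \<le> ereal (\<epsilon> t)})
          \<sim>[at_top] (\<lambda>t. sin (pi * \<alpha>) / (pi * \<alpha>) * (l t / l (\<epsilon> t * t)) * \<epsilon> t powr \<alpha>) \<and>
        (special_subordinator M \<tau> \<longrightarrow>
          (\<lambda>t. measure M {w \<in> space M. undershoot \<tau> t w / ereal t \<ge> ereal (1 - \<epsilon> t)})
            \<sim>[at_top] (\<lambda>t. sin (pi * \<alpha>') / (pi * \<alpha>') * (l (\<epsilon> t * t) / l t) * \<epsilon> t powr \<alpha>')))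
     \<and>
     (\<Phi> \<in> \<Theta>[at_right 0](\<lambda>x. x powr \<alpha> * l (1 / x)) \<longrightarrow>
        (\<lambda>t. measure M {w \<in> space M. undershoot \<tau> t w / ereal t \<le> ereal (\<epsilon> t)})
          \<in> \<Theta>[at_top](\<lambda>t. l t / l (\<epsilon> t * t) * \<epsilon> t powr \<alpha>) \<and>
        (special_subordinator M \<tau> \<longrightarrow>
          (\<lambda>t. measure M {w \<in> space M. undershoot \<tau> t w / ereal t \<ge> ereal (1 - \<epsilon> t)})
            \<in> \<Theta>[at_top](\<lambda>t. l (\<epsilon> t * t) / l t * \<epsilon> t powr \<alpha>')))"
proof -
  let ?model = "\<lambda>x. x powr \<alpha> * l (1 / x)"
  let ?small = "\<lambda>t. measure M {w \<in> space M. undershoot \<tau> t w / ereal t \<le> ereal (\<epsilon> t)}"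
  let ?large = "\<lambda>t. measure M {w \<in> space M. undershoot \<tau> t w / ereal t \<ge> ereal (1 - \<epsilon> t)}"
  note l = \<open>slowly_varying l\<close>
  have \<Phi>_nonneg: "0 \<le> \<Phi> x" if "0 < x" for x using assms(3) that by (simp add: is_laplace_exponent_def)
  have main: "(\<Phi> \<sim>[at_right 0] ?model \<longrightarrow>
        ?small \<sim>[at_top] (\<lambda>t. sin (pi * \<alpha>) / (pi * \<alpha>) * (l t / l (\<epsilon> t * t)) * \<epsilon> t powr \<alpha>) \<and>
        (special_subordinator M \<tau> \<longrightarrow> ?large \<sim>[at_top] (\<lambda>t. sin (pi * \<alpha>') / (pi * \<alpha>') * (l (\<epsilon> t * t) / l t) * \<epsilon> t powr \<alpha>'))) \<and>
        ?small \<in> \<Theta>[at_top](\<lambda>t. l t / l (\<epsilon> t * t) * \<epsilon> t powr \<alpha>) \<and>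
        (special_subordinator M \<tau> \<longrightarrow> ?large \<in> \<Theta>[at_top](\<lambda>t. l (\<epsilon> t * t) / l t * \<epsilon> t powr \<alpha>'))"
    if theta: "\<Phi> \<in> \<Theta>[at_right 0](?model)"
  proof -
    obtain X where X: "nonneg_levy_process M X" and \<tau>: "\<And>s w. 0 \<le> s \<Longrightarrow> w \<in> space M \<Longrightarrow> \<tau> s w = ereal (X s w)"
    proof -
      obtain X where X: "nonneg_levy_process M X"
        and alt: "(\<forall>s\<ge>0. \<forall>w\<in>space M. \<tau> s w = ereal (X s w)) \<or>
         (\<exists>q>0. \<exists>\<xi>. distributed M lborel \<xi> (exponential_density q) \<and>
            (\<forall>s\<ge>0. \<forall>w\<in>space M. \<tau> s w = (if s < \<xi> w then ereal (X s w) else \<infinity>)))"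
        using assms(2) unfolding killed_subordinator_def by blast
      have "\<forall>s\<ge>0. \<forall>w\<in>space M. \<tau> s w = ereal (X s w)"
        using alt
      proof
        assume "\<exists>q>0. \<exists>\<xi>. distributed M lborel \<xi> (exponential_density q) \<and>
            (\<forall>s\<ge>0. \<forall>w\<in>space M. \<tau> s w = (if s < \<xi> w then ereal (X s w) else \<infinity>))"
        then obtain q \<xi> where q: "0 < q" "distributed M lborel \<xi> (exponential_density q)"
            "\<forall>s\<ge>0. \<forall>w\<in>space M. \<tau> s w = (if s < \<xi> w then ereal (X s w) else \<infinity>)" by blast
        \<comment> \<open>\<open>\<Phi>\<close> is at least \<open>q\<close> everywhere, but tends to \<open>0\<close> along \<open>1 / 2 ^ n\<close>.\<close>
        have "q \<le> 0"
        proof (rule LIMSEQ_le_const[OF exponent_dyadic_vanishes[OF l assms(5) theta \<Phi>_nonneg]])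
          show "\<exists>N. \<forall>n\<ge>N. q \<le> \<Phi> (1 / 2 ^ n)"
            by (intro exI allI impI killed_laplace_exponent_ge[OF assms(1) X q(2,1,3) assms(3)]) simp
        qed
        with q(1) show ?thesis by simp
      qed
      with X that show thesis by blast
    qed
    interpret subordinator M X \<Phi>
    proof (intro subordinator.intro subordinator_axioms.intro assms(1) X \<Phi>_nonneg)
      fix c s :: real assume cs: "0 < c" "0 < s"
      have "exp (- \<Phi> c * s) = (\<integral>w. exp_neg (ereal c * \<tau> s w) \<partial>M)"
        using assms(3) cs by (simp add: is_laplace_exponent_def)
      also have "\<dots> = (\<integral>w. exp (- (c * X s w)) \<partial>M)"
        using cs \<tau> by (intro Bochner_Integration.integral_cong) (auto simp: exp_neg_def)
      finally show "(\<integral>w. exp (- (c * X s w)) \<partial>M) = exp (- \<Phi> c * s)" by simp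
    qed (use assms(4) in auto)
    have \<epsilon>: "\<And>t. 0 < t \<Longrightarrow> 0 < \<epsilon> t" "\<And>t. 0 < t \<Longrightarrow> \<epsilon> t < 1" using assms(9) by auto
    have vanish: "(\<Psi> \<longlongrightarrow> 0) at_top" by (rule \<Psi>_vanishes[OF l assms(5) theta])
    let ?r = "regvar_model \<alpha> l"
    let ?P = "\<lambda>t. prob {w \<in> space M. undershoot \<tau> t w \<le> ereal (\<epsilon> t * t)}"
    let ?Q = "\<lambda>t. prob {w \<in> space M. ereal (t - \<epsilon> t * t) \<le> undershoot \<tau> t w}"
    have small: "\<forall>\<^sub>F t in at_top. ?P t = ?small t"
      using eventually_gt_at_top[of 0] by eventually_elim (simp add: ereal_divide_le_iff)
    have large: "\<forall>\<^sub>F t in at_top. ?Q t = ?large t"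
      using eventually_gt_at_top[of 0] by eventually_elim (simp add: ereal_le_divide_iff left_diff_distrib)
    have model_small: "\<forall>\<^sub>F t in at_top. ?r t / ?r (\<epsilon> t * t) = l t / l (\<epsilon> t * t) * \<epsilon> t powr \<alpha>"
      using eventually_gt_at_top[of 0]
    proof eventually_elim
      case (elim t)
      then show ?case using \<epsilon>[OF elim] by (simp add: regvar_model_def powr_mult powr_minus field_simps)
    qed
    have model_large: "\<forall>\<^sub>F t in at_top. \<epsilon> t * t / t * (?r (\<epsilon> t * t) / ?r t) = l (\<epsilon> t * t) / l t * \<epsilon> t powr \<alpha>'"
      using eventually_gt_at_top[of 0]
    proof eventually_elim
      case (elim t)
      have p: "\<epsilon> t powr \<alpha>' = \<epsilon> t / \<epsilon> t powr \<alpha>"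
        unfolding assms(7) using \<epsilon>[OF elim] by (simp add: powr_diff)
      show ?case unfolding p using \<epsilon>[OF elim] elim by (simp add: regvar_model_def powr_mult powr_minus field_simps)
    qed
    have \<Psi>_theta: "\<Psi> \<in> \<Theta>[at_top](?r)" using bigtheta_at_infinity[OF theta] by (simp add: \<Psi>_def[abs_def])
    have compare: "(b - a) * measure renewal_measure {c<..d} \<le> (d - c) * measure renewal_measure {a<..b}"
      if sp: "special_subordinator M \<tau>" and ab: "0 \<le> a" "a < b" "b \<le> c" "c < d" for a b c d
    proof -
      obtain \<Phi>' where \<Phi>': "is_laplace_exponent M \<tau> \<Phi>'" "special_bernstein_function \<Phi>'"
        using sp by (auto simp: special_subordinator_def)
      have "\<Phi>' x = \<Phi> x" if "0 < x" for x
      proof -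
        have "exp (- \<Phi>' x * 1) = exp (- \<Phi> x * 1)"
          using \<Phi>'(1) assms(3) that unfolding is_laplace_exponent_def by (metis zero_less_one)
        then show ?thesis by simp
      qed
      from special_average_antimono[OF \<Phi>'(2) this ab] show ?thesis .
    qed
    obtain \<kappa> where \<kappa>: "0 < \<kappa>"
      "\<And>K. 0 < K \<Longrightarrow> \<forall>\<^sub>F x in at_top. \<kappa> * K powr (- \<alpha>) * \<Psi> x \<le> \<Psi> (K * x) \<and> \<Psi> (K * x) \<le> K powr (- \<alpha>) / \<kappa> * \<Psi> x"
      using comparable_of_theta[OF l theta] by blast
    have "\<forall>\<^sub>F t in at_top. \<epsilon> t * t / t = \<epsilon> t"
      using eventually_gt_at_top[of 0] by eventually_elim simp
    then have level_small: "((\<lambda>t. \<epsilon> t * t / t) \<longlongrightarrow> 0) at_top"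
      using assms(10) by (simp add: tendsto_cong)
    have level: "0 < \<epsilon> t * t" "\<epsilon> t * t < t" if "0 < t" for t using \<epsilon>[OF that] that by auto
    note ctx = \<tau> level level_small assms(11) assms(5,6) vanish
    show ?thesis
    proof (intro conjI impI)
      have "?small \<in> \<Theta>(?P)" using small by (intro bigthetaI_cong) (auto elim: eventually_mono)
      also have "?P \<in> \<Theta>(\<lambda>t. \<Psi> t / \<Psi> (\<epsilon> t * t))" by (rule undershoot_small_comparable[OF ctx \<kappa>])
      also have "(\<lambda>t. \<Psi> t / \<Psi> (\<epsilon> t * t)) \<in> \<Theta>(\<lambda>t. ?r t / ?r (\<epsilon> t * t))"
        by (intro bigtheta_divide \<Psi>_theta landau_theta.compose[OF \<Psi>_theta assms(11)])
      also have "(\<lambda>t. ?r t / ?r (\<epsilon> t * t)) \<in> \<Theta>(\<lambda>t. l t / l (\<epsilon> t * t) * \<epsilon> t powr \<alpha>)"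
        by (rule bigthetaI_cong[OF model_small])
      finally show "?small \<in> \<Theta>(\<lambda>t. l t / l (\<epsilon> t * t) * \<epsilon> t powr \<alpha>)" .
    next
      assume special: "special_subordinator M \<tau>"
      have "?large \<in> \<Theta>(?Q)" using large by (intro bigthetaI_cong) (auto elim: eventually_mono)
      also have "?Q \<in> \<Theta>(\<lambda>t. \<epsilon> t * t / t * (\<Psi> (\<epsilon> t * t) / \<Psi> t))"
        by (rule undershoot_large_comparable[OF ctx \<kappa> compare[OF special]])
      also have "(\<lambda>t. \<epsilon> t * t / t * (\<Psi> (\<epsilon> t * t) / \<Psi> t)) \<in> \<Theta>(\<lambda>t. \<epsilon> t * t / t * (?r (\<epsilon> t * t) / ?r t))"
        by (intro landau_theta.mult bigtheta_refl bigtheta_divide \<Psi>_theta landau_theta.compose[OF \<Psi>_theta assms(11)])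
      also have "(\<lambda>t. \<epsilon> t * t / t * (?r (\<epsilon> t * t) / ?r t)) \<in> \<Theta>(\<lambda>t. l (\<epsilon> t * t) / l t * \<epsilon> t powr \<alpha>')"
        by (rule bigthetaI_cong[OF model_large])
      finally show "?large \<in> \<Theta>(\<lambda>t. l (\<epsilon> t * t) / l t * \<epsilon> t powr \<alpha>')" .
    next
      assume equiv: "\<Phi> \<sim>[at_right 0] ?model"
      have \<Psi>_equiv: "\<Psi> \<sim>[at_top] ?r" using asymp_equiv_at_infinity[OF equiv] by (simp add: \<Psi>_def[abs_def])
      note lim = undershoot_small_limit[OF ctx regular_of_equiv[OF l equiv]]
      have nz: "sin (pi * \<alpha>) / (pi * \<alpha>) \<noteq> 0"
        using assms(5,6) sin_gt_zero[of "pi * \<alpha>"] by simp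
      have "?small \<sim>[at_top] ?P" using small by (intro asymp_equiv_refl_ev) (auto elim: eventually_mono)
      also have "?P \<sim>[at_top] (\<lambda>t. sin (pi * \<alpha>) / (pi * \<alpha>) * (\<Psi> t / \<Psi> (\<epsilon> t * t)))"
        using lim nz unfolding Gamma_reflection_sin[OF assms(5,6)] by (rule asymp_equivI'_const)
      also have "\<dots> \<sim>[at_top] (\<lambda>t. sin (pi * \<alpha>) / (pi * \<alpha>) * (?r t / ?r (\<epsilon> t * t)))"
        by (intro asymp_equiv_mult asymp_equiv_refl asymp_equiv_divide \<Psi>_equiv asymp_equiv_compose'[OF \<Psi>_equiv assms(11)])
      also have "\<dots> \<sim>[at_top] (\<lambda>t. sin (pi * \<alpha>) / (pi * \<alpha>) * (l t / l (\<epsilon> t * t)) * \<epsilon> t powr \<alpha>)"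
        by (rule asymp_equiv_refl_ev, use model_small in eventually_elim) (simp only: mult.assoc)
      finally show "?small \<sim>[at_top] (\<lambda>t. sin (pi * \<alpha>) / (pi * \<alpha>) * (l t / l (\<epsilon> t * t)) * \<epsilon> t powr \<alpha>)" .
    next
      assume equiv: "\<Phi> \<sim>[at_right 0] ?model" and special: "special_subordinator M \<tau>"
      have \<Psi>_equiv: "\<Psi> \<sim>[at_top] ?r" using asymp_equiv_at_infinity[OF equiv] by (simp add: \<Psi>_def[abs_def])
      note lim = undershoot_large_limit[OF ctx regular_of_equiv[OF l equiv] compare[OF special]]
      have \<alpha>': "0 < \<alpha>'" "\<alpha>' < 1" using assms(5-7) by auto
      have nz: "sin (pi * \<alpha>') / (pi * \<alpha>') \<noteq> 0"
        using \<alpha>' sin_gt_zero[of "pi * \<alpha>'"] by simp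
      have const: "1 / Gamma \<alpha> * (1 / Gamma (2 - \<alpha>)) = sin (pi * \<alpha>') / (pi * \<alpha>')"
        using Gamma_reflection_sin[OF \<alpha>'] assms(7) by (simp add: mult.commute)
      have "?large \<sim>[at_top] ?Q" using large by (intro asymp_equiv_refl_ev) (auto elim: eventually_mono)
      also have "?Q \<sim>[at_top] (\<lambda>t. sin (pi * \<alpha>') / (pi * \<alpha>') * (\<epsilon> t * t / t * (\<Psi> (\<epsilon> t * t) / \<Psi> t)))"
        using lim nz unfolding const by (rule asymp_equivI'_const)
      also have "\<dots> \<sim>[at_top] (\<lambda>t. sin (pi * \<alpha>') / (pi * \<alpha>') * (\<epsilon> t * t / t * (?r (\<epsilon> t * t) / ?r t)))"
        by (intro asymp_equiv_mult asymp_equiv_refl asymp_equiv_divide \<Psi>_equiv asymp_equiv_compose'[OF \<Psi>_equiv assms(11)])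
      also have "\<dots> \<sim>[at_top] (\<lambda>t. sin (pi * \<alpha>') / (pi * \<alpha>') * (l (\<epsilon> t * t) / l t) * \<epsilon> t powr \<alpha>')"
        by (rule asymp_equiv_refl_ev, use model_large in eventually_elim) (simp only: mult.assoc)
      finally show "?large \<sim>[at_top] (\<lambda>t. sin (pi * \<alpha>') / (pi * \<alpha>') * (l (\<epsilon> t * t) / l t) * \<epsilon> t powr \<alpha>')" .
    qed
  qed
  show ?thesis using main asymp_equiv_imp_bigtheta[of \<Phi> "at_right 0" ?model] by blast
qed

end
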